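(* Let $\kappa>0$ and let $\sigma:\mathbf{R}\to\mathbf{R}$ be Lipschitz continuous with $\sigma(0)=0$ and $\mathrm{L}_\sigma:=\inf_{x\in\mathbf{R}}|\sigma(x)/x|>0$. Let $u_0:\mathbf{R}\to\mathbf{R}_+$ and $v_0:\mathbf{R}\to\mathbf{R}$ be bounded, and let $u$ be the mild solution of the stochastic wave equation $\partial_t^2u_t(x)=\kappa^2\partial_x^2u_t(x)+\sigma(u_t(x))\,\partial^2_{tx}W(t,x)$, $t>0$, $x\in\mathbf{R}$, with initial position $u_0$ and initial velocity $v_0$. Suppose $u_0,v_0\in\mathcal{D}_{\mathit{exp}}$, $u_0>0$ on a set of positive Lebesgue measure, and $v_0\ge0$. Then $0<\underline{\lambda}(\nu)\le\overline{\lambda}(\nu)<\infty$ for all $\nu\in[2,\infty)$. If in addition $u_0$ and $v_0$ have compact support, then $\underline{\lambda}(\nu)=\overline{\lambda}(\nu)=\kappa$ for all $\nu\in[2,\infty)$.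
   Context: $W$ is a two-parameter Brownian sheet indexed by $\mathbf{R}_+\times\mathbf{R}$. With $\Gamma_t(x):=\frac12\mathbf{1}_{[-\kappa t,\kappa t]}(x)$, the mild solution is the (a.s. unique) predictable random field with $u_t(x)=\frac12(u_0(x+\kappa t)+u_0(x-\kappa t))+\frac{1}{2\kappa}\int_{x-\kappa t}^{x+\kappa t}v_0(y)\,dy+\int_{[0,t]\times\mathbf{R}}\Gamma_{t-s}(y-x)\sigma(u_s(y))\,W(ds\,dy)$. $\mathcal{D}_{\mathit{exp}}$ denotes the set of bounded lower semicontinuous functions $h:\mathbf{R}\to\mathbf{R}_+$ for which there exists $\rho>0$ with $h(x)=O(e^{-\rho|x|})$ as $|x|\to\infty$. Growth indices: $\overline{\lambda}(\nu):=\inf\{\alpha>0:\limsup_{t\to\infty}\frac1t\sup_{|x|\ge\alpha t}\ln\mathrm{E}(|u_t(x)|^\nu)<0\}$ (with $\inf\varnothing=\infty$), and $\underline{\lambda}(\nu):=\sup\{\alpha>0:\limsup_{t\to\infty}\frac1t\sup_{|x|\ge\alpha t}\ln\mathrm{E}(|u_t(x)|^\nu)>0\}$ (with $\sup\varnothing=0$). *)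

theory Defs
  imports "HOL-Probability.Probability" "HOL-Library.Landau_Symbols"
begin

definition lower_semicont :: "(real \<Rightarrow> real) \<Rightarrow> bool" where
  "lower_semicont h \<longleftrightarrow> (\<forall>c. open {x. c < h x})"

definition D_exp :: "(real \<Rightarrow> real) set" where
  "D_exp = {h. (\<forall>x. 0 \<le> h x) \<and> bounded (range h) \<and> lower_semicont h \<and>
               (\<exists>\<rho>>0. h \<in> O[at_infinity](\<lambda>x. exp (- \<rho> * \<bar>x\<bar>)))}"

text \<open>Fundamental solution of the wave equation, Gamma_t(x) = 1/2 * 1_{[-kappa t, kappa t]}(x).\<close>
definition Gamma :: "real \<Rightarrow> real \<Rightarrow> real \<Rightarrow> real" where
  "Gamma \<kappa> t x = (1/2) * indicator {- \<kappa> * t .. \<kappa> * t} x"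

definition rect_incr :: "(real \<Rightarrow> real \<Rightarrow> 'a \<Rightarrow> real) \<Rightarrow> real \<times> real \<times> real \<times> real \<Rightarrow> 'a \<Rightarrow> real" where
  "rect_incr W R \<omega> = (case R of (a, b, c, d) \<Rightarrow> W b d \<omega> - W a d \<omega> - W b c \<omega> + W a c \<omega>)"

definition rect_set :: "real \<times> real \<times> real \<times> real \<Rightarrow> (real \<times> real) set" where
  "rect_set R = (case R of (a, b, c, d) \<Rightarrow> {a<..b} \<times> {c<..d})"

definition good_rect :: "real \<times> real \<times> real \<times> real \<Rightarrow> bool" where
  "good_rect R = (case R of (a, b, c, d) \<Rightarrow> 0 \<le> a \<and> a < b \<and> c < d)"

definition brownian_sheet ::
  "'a measure \<Rightarrow> (real \<Rightarrow> 'a measure) \<Rightarrow> (real \<Rightarrow> real \<Rightarrow> 'a \<Rightarrow> real) \<Rightarrow> bool" where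
  "brownian_sheet M F W \<longleftrightarrow>
     prob_space M \<and>
     filtration (space M) F \<and> (\<forall>t. subalgebra M (F t)) \<and>
     (\<forall>t x. 0 \<le> t \<longrightarrow> W t x \<in> borel_measurable (F t)) \<and>
     (\<forall>x. AE \<omega> in M. W 0 x \<omega> = 0) \<and> (\<forall>t. AE \<omega> in M. W t 0 \<omega> = 0) \<and>
     (\<forall>a b c d. good_rect (a, b, c, d) \<longrightarrow>
        distributed M lborel (rect_incr W (a, b, c, d))
          (normal_density 0 (sqrt ((b - a) * (d - c))))) \<and>
     (\<forall>(I :: nat set) R. finite I \<longrightarrow> (\<forall>i\<in>I. good_rect (R i)) \<longrightarrow>
        disjoint_family_on (\<lambda>i. rect_set (R i)) I \<longrightarrow>
        prob_space.indep_vars M (\<lambda>_. borel) (\<lambda>i. rect_incr W (R i)) I) \<and>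
     (\<forall>s a b c d. 0 \<le> s \<longrightarrow> s \<le> a \<longrightarrow> good_rect (a, b, c, d) \<longrightarrow>
        (\<forall>A\<in>sets (F s). \<forall>B\<in>sets borel.
           measure M (A \<inter> (rect_incr W (a, b, c, d) -` B \<inter> space M)) =
           measure M A * measure M (rect_incr W (a, b, c, d) -` B \<inter> space M)))"

text \<open>Elementary predictable integrands X(omega) 1_{(a,b]}(s) 1_{(c,d]}(y),
  X bounded and F_a-measurable, represented by (X, (a, b, c, d)).\<close>
definition elem_ok ::
  "'a measure \<Rightarrow> (real \<Rightarrow> 'a measure) \<Rightarrow> ('a \<Rightarrow> real) \<times> (real \<times> real \<times> real \<times> real) \<Rightarrow> bool" where
  "elem_ok M F e = (case e of (X, (a, b, c, d)) \<Rightarrow>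
      0 \<le> a \<and> a \<le> b \<and> c \<le> d \<and> X \<in> borel_measurable (F a) \<and>
      (\<exists>B. \<forall>\<omega>\<in>space M. \<bar>X \<omega>\<bar> \<le> B))"

definition simple_fun ::
  "(('a \<Rightarrow> real) \<times> (real \<times> real \<times> real \<times> real)) list \<Rightarrow> 'a \<Rightarrow> real \<Rightarrow> real \<Rightarrow> real" where
  "simple_fun es \<omega> s y =
     (\<Sum>e\<leftarrow>es. (case e of (X, (a, b, c, d)) \<Rightarrow>
        X \<omega> * indicator {a<..b} s * indicator {c<..d} y))"

definition simple_int ::
  "(real \<Rightarrow> real \<Rightarrow> 'a \<Rightarrow> real) \<Rightarrow> (('a \<Rightarrow> real) \<times> (real \<times> real \<times> real \<times> real)) list \<Rightarrow> 'a \<Rightarrow> real" where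
  "simple_int W es \<omega> = (\<Sum>e\<leftarrow>es. (case e of (X, R) \<Rightarrow> X \<omega> * rect_incr W R \<omega>))"

definition walsh_integral ::
  "'a measure \<Rightarrow> (real \<Rightarrow> 'a measure) \<Rightarrow> (real \<Rightarrow> real \<Rightarrow> 'a \<Rightarrow> real) \<Rightarrow>
   ('a \<Rightarrow> real \<Rightarrow> real \<Rightarrow> real) \<Rightarrow> ('a \<Rightarrow> real) \<Rightarrow> bool" where
  "walsh_integral M F W f Y \<longleftrightarrow> Y \<in> borel_measurable M \<and>
     (\<exists>es :: nat \<Rightarrow> (('a \<Rightarrow> real) \<times> (real \<times> real \<times> real \<times> real)) list.
        (\<forall>n. \<forall>e\<in>set (es n). elem_ok M F e) \<and>
        (\<lambda>n. \<integral>\<^sup>+ z. (case z of (\<omega>, s, y) \<Rightarrow>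
              ennreal ((simple_fun (es n) \<omega> s y - f \<omega> s y)\<^sup>2) * indicator {0..} s)
            \<partial>(M \<Otimes>\<^sub>M (lborel \<Otimes>\<^sub>M lborel))) \<longlonglongrightarrow> 0 \<and>
        (\<lambda>n. \<integral>\<^sup>+ \<omega>. ennreal ((simple_int W (es n) \<omega> - Y \<omega>)\<^sup>2) \<partial>M) \<longlonglongrightarrow> 0)"

definition pred_sigma :: "'a measure \<Rightarrow> (real \<Rightarrow> 'a measure) \<Rightarrow> ('a \<times> real \<times> real) measure" where
  "pred_sigma M F = sigma (space M \<times> {0..} \<times> UNIV)
     ({A \<times> {a<..b} \<times> B | A a b B. 0 \<le> a \<and> a \<le> b \<and> A \<in> sets (F a) \<and> B \<in> sets borel} \<union>
      {A \<times> {0} \<times> B | A B. A \<in> sets (F 0) \<and> B \<in> sets borel})"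

definition predictable :: "'a measure \<Rightarrow> (real \<Rightarrow> 'a measure) \<Rightarrow> (real \<Rightarrow> real \<Rightarrow> 'a \<Rightarrow> real) \<Rightarrow> bool" where
  "predictable M F u \<longleftrightarrow> (\<lambda>z. case z of (\<omega>, s, y) \<Rightarrow> u s y \<omega>) \<in> borel_measurable (pred_sigma M F)"

definition mild_solution ::
  "'a measure \<Rightarrow> (real \<Rightarrow> 'a measure) \<Rightarrow> (real \<Rightarrow> real \<Rightarrow> 'a \<Rightarrow> real) \<Rightarrow> real \<Rightarrow>
   (real \<Rightarrow> real) \<Rightarrow> (real \<Rightarrow> real) \<Rightarrow> (real \<Rightarrow> real) \<Rightarrow> (real \<Rightarrow> real \<Rightarrow> 'a \<Rightarrow> real) \<Rightarrow> bool" where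
  "mild_solution M F W \<kappa> \<sigma> u0 v0 u \<longleftrightarrow>
     predictable M F u \<and>
     (\<forall>T. \<exists>C::real. \<forall>t\<in>{0..T}. \<forall>x. (\<integral>\<^sup>+ \<omega>. ennreal ((u t x \<omega>)\<^sup>2) \<partial>M) \<le> ennreal C) \<and>
     (\<forall>t\<ge>0. \<forall>x. \<exists>Y.
        walsh_integral M F W
          (\<lambda>\<omega> s y. indicator {0..t} s * Gamma \<kappa> (t - s) (y - x) * \<sigma> (u s y \<omega>)) Y \<and>
        (AE \<omega> in M. u t x \<omega> =
            (u0 (x + \<kappa> * t) + u0 (x - \<kappa> * t)) / 2
            + 1 / (2 * \<kappa>) * (\<integral>y\<in>{x - \<kappa> * t .. x + \<kappa> * t}. v0 y \<partial>lborel)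
            + Y \<omega>))"

definition moment :: "'a measure \<Rightarrow> (real \<Rightarrow> real \<Rightarrow> 'a \<Rightarrow> real) \<Rightarrow> real \<Rightarrow> real \<Rightarrow> real \<Rightarrow> ennreal" where
  "moment M u \<nu> t x = (\<integral>\<^sup>+ \<omega>. ennreal (\<bar>u t x \<omega>\<bar> powr \<nu>) \<partial>M)"

definition ln_ennreal :: "ennreal \<Rightarrow> ereal" where
  "ln_ennreal e = (if e = 0 then - \<infinity> else if e = \<infinity> then \<infinity> else ereal (ln (enn2real e)))"

definition growth_rate :: "'a measure \<Rightarrow> (real \<Rightarrow> real \<Rightarrow> 'a \<Rightarrow> real) \<Rightarrow> real \<Rightarrow> real \<Rightarrow> ereal" where
  "growth_rate M u \<nu> \<alpha> = Limsup at_top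
     (\<lambda>t. ereal (1 / t) * (SUP x\<in>{x. \<alpha> * t \<le> \<bar>x\<bar>}. ln_ennreal (moment M u \<nu> t x)))"

definition upper_index :: "'a measure \<Rightarrow> (real \<Rightarrow> real \<Rightarrow> 'a \<Rightarrow> real) \<Rightarrow> real \<Rightarrow> ereal" where
  "upper_index M u \<nu> = Inf {ereal \<alpha> | \<alpha>. \<alpha> > 0 \<and> growth_rate M u \<nu> \<alpha> < 0}"

definition lower_index :: "'a measure \<Rightarrow> (real \<Rightarrow> real \<Rightarrow> 'a \<Rightarrow> real) \<Rightarrow> real \<Rightarrow> ereal" where
  "lower_index M u \<nu> = Sup ({0} \<union> {ereal \<alpha> | \<alpha>. \<alpha> > 0 \<and> growth_rate M u \<nu> \<alpha> > 0})"

end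

theory Submission
  imports Defs
begin

text \<open>The upper bounds come from a Burkholder-type inequality for truncated powers of stochastic
  integrals, \<open>E \<phi>(Y) \<le> C \<integral> \<delta>^(-k) E \<phi>(f)\<close>, obtained from a discretised Ito expansion and the
  inequality \<open>\<phi>''(a) b^2 \<le> \<delta> \<phi>(a) + C \<delta>^(-k) \<phi>(b)\<close> with \<open>\<delta>\<close> decaying exponentially along the
  backward light cone. For the mild solution this is a renewal inequality on light cones whose
  kernel grows only exponentially in time. It is solved by taking weighted suprema, for weights
  that are compatible with propagation at speed \<open>\<kappa>\<close>: exponential weights give
  \<open>E |u|^p \<le> D exp(\<beta> t - c |x|)\<close>, and the indicator of the exterior of the light cone gives finite
  propagation for compactly supported data.

  For the lower bounds, Jensen's inequality reduces everything to the second moment, which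
  dominates a multiple of its own integral over the backward light cone. Positive initial data
  survive along a characteristic, hence give a uniform lower bound on a forward light cone, and
  this bound grows exponentially along every ray of speed less than \<open>\<kappa>\<close>. So the lower index is at
  least \<open>\<kappa>\<close> even without compact support.\<close>

section \<open>Truncated powers\<close>

text \<open>The stochastic integral is given only as an L^2 limit of elementary integrals: no path
  regularity, no quadratic variation, no maximal inequality. Every estimate is therefore proved for
  elementary integrands, with constants that do not see the approximating sequence, and its test
  function must survive an L^2 limit.

  The decay of \<delta> settles a conflict. The share \<delta> \<phi>(a) of the Ito correction is
  absorbed by a supremum over time, so the integral of \<delta> over the backward cone must be small
  uniformly in the apex (t, x). A constant \<delta> would have to be of order t^(-2), at the price
  \<delta>^(-k) of order t^(2k), and the renewal kernel would not be bounded by an exponential of t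
  - s. With \<delta> proportional to exp(-(t - s)) the integral is bounded, and the price exp(k (t -
  s)) is beaten by a weight exp(-\<beta> t) with \<beta> large.

  Upper bounds are proved for even powers and lower bounds for the second moment; comparing moments
  yields every real \<nu> of at least 2. Factors lost in the L^2 limit are harmless, because the
  indices depend only on the signs of exponential rates.\<close>

lemma power_Taylor2_bound:
  fixes a d m :: real
  assumes "\<bar>a\<bar> \<le> m" "\<bar>d\<bar> \<le> m"
  shows "\<bar>(a + d)^(n+2) - a^(n+2) - real (n+2) * a^(n+1) * d\<bar> \<le> 4^(n+2) * d\<^sup>2 * m^n"
proof (induction n)
  case 0
  have "(a + d)^2 - a^2 - 2 * a * d = d^2" by (simp add: power2_eq_square algebra_simps)
  moreover have "\<bar>d\<^sup>2\<bar> \<le> 16 * d\<^sup>2" by simp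
  ultimately show ?case by (simp add: numeral_2_eq_2)
next
  case (Suc n)
  have m: "0 \<le> m" using assms by linarith
  \<comment> \<open>The next Taylor remainder is \<open>a + d\<close> times the previous one, plus
    what the linear term leaves over. The two parts cost 2 and 1 times the old constant, which the
    factor 4 per step covers.\<close>
  have eq: "(a + d)^(Suc n+2) - a^(Suc n+2) - real (Suc n+2) * a^(Suc n+1) * d
    = (a + d) * ((a + d)^(n+2) - a^(n+2) - real (n+2) * a^(n+1) * d) + real (n+2) * a^(n+1) * d\<^sup>2"
    by (simp add: power2_eq_square algebra_simps)
  have "\<bar>(a + d) * ((a + d)^(n+2) - a^(n+2) - real (n+2) * a^(n+1) * d)\<bar> \<le> (2*m) * (4^(n+2) * d\<^sup>2 * m^n)"
    unfolding abs_mult using assms by (intro mult_mono Suc) auto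
  moreover have "\<bar>real (n+2) * a^(n+1) * d\<^sup>2\<bar> \<le> real (n+2) * m^(n+1) * d\<^sup>2"
    unfolding abs_mult power_abs using assms m
    by (intro mult_mono power_mono[of "\<bar>a\<bar>" m "n+1"] order_refl) auto
  moreover have "real (n+2) * m^(n+1) * d\<^sup>2 \<le> 4^(n+2) * m^(n+1) * d\<^sup>2"
  proof -
    have "n+2 \<le> 2^(n+2)" by (rule order_less_imp_le[OF less_exp])
    also have "\<dots> \<le> 4^(n+2)" by (rule power_mono) auto
    finally have "real (n+2) \<le> real (4^(n+2))" unfolding of_nat_le_iff .
    then show ?thesis using m by (intro mult_right_mono) auto
  qed
  ultimately have "\<bar>(a + d)^(Suc n+2) - a^(Suc n+2) - real (Suc n+2) * a^(Suc n+1) * d\<bar>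
      \<le> 3 * (4^(n+2) * d\<^sup>2 * m^(n+1))"
    unfolding eq by (simp add: algebra_simps)
  also have "\<dots> \<le> 4^(Suc n+2) * d\<^sup>2 * m^(Suc n)"
    using m by simp
  finally show ?case .
qed

text \<open>The solution is only known to have finite second moments, so \<open>a^(2k+2)\<close> is replaced by
  \<open>min (a^(2k)) K * a^2\<close>: this is at most quadratic, still satisfies a Taylor estimate from above
  (the kink of a minimum is concave, so it does no harm), and leads to final bounds whose
  constants do not depend on \<open>K\<close>, so that \<open>K\<close> can be sent to infinity.\<close>

definition trunc_weight :: "nat \<Rightarrow> real \<Rightarrow> real \<Rightarrow> real" where
  "trunc_weight k K a = min (a^(2*k)) K"

definition trunc_pow :: "nat \<Rightarrow> real \<Rightarrow> real \<Rightarrow> real" where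
  "trunc_pow k K a = trunc_weight k K a * a\<^sup>2"

text \<open>The derivative of \<open>trunc_pow k K\<close> away from the kink
  \<open>a^(2*k) = K\<close>. At the kink itself it is the slope of the inner branch
  \<open>a^(2*k+2)\<close>, in agreement with the case split of
  \<open>trunc_pow_expand\<close>.\<close>

definition trunc_slope :: "nat \<Rightarrow> real \<Rightarrow> real \<Rightarrow> real" where
  "trunc_slope k K a = (if a^(2*k) \<le> K then real (2*k+2) else 2) * trunc_weight k K a * a"

lemma trunc_measurable [measurable]:
  "trunc_weight k K \<in> borel_measurable borel"
  "trunc_pow k K \<in> borel_measurable borel"
  "trunc_slope k K \<in> borel_measurable borel"
  unfolding trunc_slope_def[abs_def] trunc_pow_def[abs_def] trunc_weight_def[abs_def] by measurable

context
  fixes k :: nat and K :: real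
  assumes K: "0 < K"
begin

lemma trunc_weight_nonneg: "0 \<le> trunc_weight k K a"
  using K by (simp add: trunc_weight_def)

lemma trunc_weight_le: "trunc_weight k K a \<le> K"
  by (simp add: trunc_weight_def)

lemma trunc_pow_nonneg: "0 \<le> trunc_pow k K a"
  using trunc_weight_nonneg by (simp add: trunc_pow_def)

lemma trunc_pow_le_square: "trunc_pow k K a \<le> K * a\<^sup>2"
  unfolding trunc_pow_def by (intro mult_right_mono trunc_weight_le) simp

lemma trunc_pow_le_power: "trunc_pow k K a \<le> a^(2*k+2)"
proof -
  have "trunc_pow k K a \<le> a^(2*k) * a\<^sup>2"
    unfolding trunc_pow_def by (intro mult_right_mono) (auto simp: trunc_weight_def)
  then show ?thesis by (simp only: power_add)
qed

lemma trunc_weight_mono: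
  assumes "\<bar>a\<bar> \<le> \<bar>b\<bar>" shows "trunc_weight k K a \<le> trunc_weight k K b"
proof -
  have "a^(2*k) \<le> b^(2*k)"
    using power_mono[OF assms, of "2*k"] by (simp add: power_even_abs)
  then show ?thesis by (auto simp: trunc_weight_def)
qed

lemma trunc_pow_mono:
  assumes "\<bar>a\<bar> \<le> \<bar>b\<bar>" shows "trunc_pow k K a \<le> trunc_pow k K b"
  unfolding trunc_pow_def using assms
  by (intro mult_mono trunc_weight_mono trunc_weight_nonneg) (auto simp: abs_le_square_iff)

lemma trunc_weight_scale:
  assumes "1 \<le> c" shows "trunc_weight k K (c * a) \<le> c^(2*k) * trunc_weight k K a"
proof -
  have "1 \<le> c^(2*k)" using assms by simp
  then have "K \<le> c^(2*k) * K" using K by simp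
  moreover have "c^(2*k) * trunc_weight k K a = min ((c * a)^(2*k)) (c^(2*k) * K)"
    using assms by (simp add: trunc_weight_def power_mult_distrib min_mult_distrib_left)
  ultimately show ?thesis by (simp add: trunc_weight_def min.coboundedI2)
qed

lemma trunc_pow_scale:
  assumes "1 \<le> c" shows "trunc_pow k K (c * a) \<le> c^(2*k+2) * trunc_pow k K a"
proof -
  have "trunc_pow k K (c * a) \<le> c^(2*k) * trunc_weight k K a * (c * a)\<^sup>2"
    unfolding trunc_pow_def by (intro mult_right_mono trunc_weight_scale assms) simp
  then show ?thesis by (simp add: trunc_pow_def power_mult_distrib power_add power2_eq_square mult_ac)
qed

text \<open>The larger of the two summands carries at least half of \<open>a + b\<close>, and
  doubling costs \<open>2^(2*k+2)\<close>, which is \<open>4^(k+1)\<close>. This replaces a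
  convexity argument, which fails because the slope of the truncated power drops at the
  kink.\<close>

lemma trunc_pow_add: "trunc_pow k K (a + b) \<le> 4^(k+1) * (trunc_pow k K a + trunc_pow k K b)"
proof -
  have *: "trunc_pow k K (a + b) \<le> 4^(k+1) * trunc_pow k K c" if "\<bar>a + b\<bar> \<le> \<bar>2 * c\<bar>" for c
  proof -
    have "(2::real)^(2*k+2) = 4^(k+1)" by (simp add: power_mult power_add)
    then show ?thesis
      using trunc_pow_mono[OF that] trunc_pow_scale[of 2 c] by simp
  qed
  show ?thesis
  proof (cases "\<bar>a\<bar> \<le> \<bar>b\<bar>")
    case True
    then have "trunc_pow k K (a + b) \<le> 4^(k+1) * trunc_pow k K b" by (intro *) linarith
    then show ?thesis using trunc_pow_nonneg[of a] by (simp add: distrib_left add_increasing)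
  next
    case False
    then have "trunc_pow k K (a + b) \<le> 4^(k+1) * trunc_pow k K a" by (intro *) linarith
    then show ?thesis using trunc_pow_nonneg[of b] by (simp add: distrib_left add_increasing2)
  qed
qed

text \<open>Up to constants, \<open>trunc_weight\<close> stands for the second derivative. Either
  b^2 is at most \<delta> a^2 and the first term suffices, or \<bar>a\<bar> is at most
  \<delta>^(-1/2) \<bar>b\<bar>. In the latter case b replaces a inside the weight, and since the
  weight has degree 2k this costs \<delta>^(-k).\<close>

lemma trunc_weight_mult_square:
  assumes "0 < \<delta>" "\<delta> \<le> 1"
  shows "trunc_weight k K a * b\<^sup>2 \<le> \<delta> * trunc_pow k K a + (1/\<delta>)^k * trunc_pow k K b"
proof (cases "b\<^sup>2 \<le> \<delta> * a\<^sup>2")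
  case True
  then have "trunc_weight k K a * b\<^sup>2 \<le> trunc_weight k K a * (\<delta> * a\<^sup>2)"
    by (intro mult_left_mono trunc_weight_nonneg)
  also have "\<dots> = \<delta> * trunc_pow k K a" by (simp add: trunc_pow_def)
  finally show ?thesis
    using assms trunc_pow_nonneg[of b] by (simp add: add_increasing2)
next
  case False
  define c where "c = 1 / sqrt \<delta>"
  have c: "1 \<le> c" "c\<^sup>2 = 1/\<delta>" using assms by (auto simp: c_def power_divide)
  have "a\<^sup>2 \<le> c\<^sup>2 * b\<^sup>2" using False assms by (simp add: c field_simps)
  then have "\<bar>a\<bar> \<le> \<bar>c * b\<bar>" by (simp add: abs_le_square_iff power_mult_distrib)
  then have "trunc_weight k K a \<le> c^(2*k) * trunc_weight k K b"
    using trunc_weight_mono trunc_weight_scale[OF c(1)] order_trans by blast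
  then have "trunc_weight k K a * b\<^sup>2 \<le> (c^(2*k) * trunc_weight k K b) * b\<^sup>2"
    by (intro mult_right_mono) auto
  also have "\<dots> = (1/\<delta>)^k * trunc_pow k K b"
    by (simp add: trunc_pow_def power_mult c(2))
  finally show ?thesis
    using assms trunc_pow_nonneg[of a] by (simp add: add_increasing)
qed

lemma abs_trunc_slope_le: "\<bar>trunc_slope k K a\<bar> \<le> real (2*k+2) * K * \<bar>a\<bar>"
  unfolding trunc_slope_def abs_mult
  using K trunc_weight_nonneg[of a] trunc_weight_le[of a]
  by (intro mult_mono) auto

text \<open>The error is a fourth power because fourth moments of Gaussian increments are quadratic
  in the length of the time step. Beyond the kink, \<open>K * (a + d)\<^sup>2\<close> is an exact
  quadratic that lies above the truncated power and touches it at d = 0. Inside, the polynomial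
  Taylor bound serves as long as \<bar>d\<bar> is at most \<bar>a\<bar>; a dominant d makes
  everything comparable with the truncated power of d, which is O(d^4).\<close>

lemma trunc_pow_expand:
  assumes k: "1 \<le> k"
  shows "trunc_pow k K (a + d) \<le> trunc_pow k K a + trunc_slope k K a * d
     + 4^(2*k+2) * trunc_weight k K a * d\<^sup>2 + 4^(k+1) * max 1 K * d^4"
proof -
  have nn: "0 \<le> 4^(k+1) * max 1 K * d^4" by simp
  have one: "(1::real) \<le> 4^(2*k+2)" by (rule one_le_power) simp
  consider "K < a^(2*k)" | "a^(2*k) \<le> K" "\<bar>d\<bar> \<le> \<bar>a\<bar>" | "a^(2*k) \<le> K" "\<bar>a\<bar> < \<bar>d\<bar>" by linarith
  then show ?thesis
  proof cases
    case 1
    have "trunc_pow k K (a + d) \<le> K * (a + d)\<^sup>2" by (rule trunc_pow_le_square)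
    also have "\<dots> = trunc_pow k K a + trunc_slope k K a * d + 1 * (trunc_weight k K a * d\<^sup>2)"
      using 1 by (simp add: trunc_pow_def trunc_weight_def trunc_slope_def power2_eq_square algebra_simps)
    also have "\<dots> \<le> trunc_pow k K a + trunc_slope k K a * d + 4^(2*k+2) * (trunc_weight k K a * d\<^sup>2)"
      using trunc_weight_nonneg[of a] by (intro add_left_mono mult_right_mono one) simp
    also have "\<dots> = trunc_pow k K a + trunc_slope k K a * d + 4^(2*k+2) * trunc_weight k K a * d\<^sup>2"
      by (simp only: mult.assoc)
    finally show ?thesis using nn by linarith
  next
    case 2
    have q: "trunc_weight k K a = a^(2*k)" using 2 by (simp add: trunc_weight_def)
    have "(a + d)^(2*k+2) \<le> a^(2*k+2) + real (2*k+2) * a^(2*k+1) * d + 4^(2*k+2) * d\<^sup>2 * \<bar>a\<bar>^(2*k)"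
      using power_Taylor2_bound[of a "\<bar>a\<bar>" d "2*k"] 2 by linarith
    also have "\<dots> = trunc_pow k K a + trunc_slope k K a * d + 4^(2*k+2) * trunc_weight k K a * d\<^sup>2"
      using 2 by (simp add: trunc_pow_def trunc_slope_def q power2_eq_square power_even_abs algebra_simps)
    finally show ?thesis using nn trunc_pow_le_power[of "a+d"] by linarith
  next
    case 3
    have q: "trunc_weight k K a = a^(2*k)" using 3 by (simp add: trunc_weight_def)
    have "trunc_pow k K (a + d) \<le> trunc_pow k K (2 * d)" using 3 by (intro trunc_pow_mono) linarith
    also have "\<dots> \<le> 4^(k+1) * trunc_pow k K d" using trunc_pow_scale[of 2 d] by (simp add: power_mult power_add)
    also have "\<dots> \<le> 4^(k+1) * (max 1 K * d^4)"
    proof (rule mult_left_mono)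
      \<comment> \<open>For small d the power bound is used, the exponent 2k+2 being at least 4
        since k is at least 1; for large d the quadratic bound is used.\<close>
      show "trunc_pow k K d \<le> max 1 K * d^4"
      proof (cases "\<bar>d\<bar> \<le> 1")
        case True
        have "\<bar>d\<bar>^(2*k+2) \<le> \<bar>d\<bar>^4" using True k by (intro power_decreasing) auto
        then have "d^(2*k+2) \<le> 1 * d^4" by (simp add: power_even_abs)
        also have "\<dots> \<le> max 1 K * d^4" by (intro mult_right_mono) auto
        finally show ?thesis using trunc_pow_le_power[of d] by linarith
      next
        case False
        then have "\<bar>d\<bar>^2 \<le> \<bar>d\<bar>^4" by (intro power_increasing) auto
        then have "K * d\<^sup>2 \<le> max 1 K * d^4" using K by (intro mult_mono) (auto simp: power_even_abs)
        then show ?thesis using trunc_pow_le_square[of d] by linarith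
      qed
    qed simp
    finally have 1: "trunc_pow k K (a + d) \<le> 4^(k+1) * max 1 K * d^4" by simp
    \<comment> \<open>The first-order term has no sign, yet it must appear on the right-hand side,
      where its expectation will vanish. Its absolute value is paid for by the second-order term,
      using that \<bar>a\<bar> is smaller than \<bar>d\<bar>.\<close>
    have "\<bar>trunc_slope k K a * d\<bar> = real (2*k+2) * a^(2*k) * (\<bar>a\<bar> * \<bar>d\<bar>)"
      using 3 by (simp add: trunc_slope_def q abs_mult)
    also have "\<dots> \<le> 4^(2*k+2) * a^(2*k) * d\<^sup>2"
    proof (intro mult_mono)
      have "2*k+2 < 2^(2*k+2)" by (rule less_exp)
      also have "\<dots> \<le> 4^(2*k+2)" by (rule power_mono) auto
      finally have "real (2*k+2) < real (4^(2*k+2))" unfolding of_nat_less_iff .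
      then show "real (2*k+2) \<le> 4^(2*k+2)" by simp
      show "\<bar>a\<bar> * \<bar>d\<bar> \<le> d\<^sup>2"
        using 3 mult_right_mono[of "\<bar>a\<bar>" "\<bar>d\<bar>" "\<bar>d\<bar>"] by (simp add: power2_eq_square)
    qed auto
    finally show ?thesis using 1 trunc_pow_nonneg[of a] by (simp add: q)
  qed
qed

end

section \<open>White noise increments\<close>

lemma has_bochner_integral_pair_times:
  fixes f :: "'a \<Rightarrow> real" and g :: "'b \<Rightarrow> real"
  assumes "sigma_finite_measure M" "sigma_finite_measure N"
    and f: "has_bochner_integral M f a" and g: "has_bochner_integral N g b"
  shows "has_bochner_integral (M \<Otimes>\<^sub>M N) (\<lambda>(x, y). f x * g y) (a * b)"
proof -
  interpret M: sigma_finite_measure M by fact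
  interpret N: sigma_finite_measure N by fact
  interpret P: pair_sigma_finite M N ..
  have [measurable]: "f \<in> borel_measurable M" "g \<in> borel_measurable N" using f g by auto
  have int: "integrable (M \<Otimes>\<^sub>M N) (\<lambda>(x, y). f x * g y)"
  proof (subst integrable_iff_bounded, intro conjI)
    have "(\<integral>\<^sup>+ z. ennreal (norm (case z of (x, y) \<Rightarrow> f x * g y)) \<partial>(M \<Otimes>\<^sub>M N))
       = (\<integral>\<^sup>+ x. \<integral>\<^sup>+ y. ennreal (norm (f x * g y)) \<partial>N \<partial>M)"
      by (subst N.nn_integral_fst[symmetric]) auto
    also have "\<dots> = (\<integral>\<^sup>+ x. ennreal (norm (f x)) * (\<integral>\<^sup>+ y. ennreal (norm (g y)) \<partial>N) \<partial>M)"
      by (simp add: abs_mult ennreal_mult nn_integral_cmult)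
    also have "\<dots> = (\<integral>\<^sup>+ x. ennreal (norm (f x)) \<partial>M) * (\<integral>\<^sup>+ y. ennreal (norm (g y)) \<partial>N)"
      by (simp add: nn_integral_multc)
    also have "\<dots> < \<infinity>"
      using f g by (auto simp: has_bochner_integral_iff integrable_iff_bounded ennreal_mult_less_top)
    finally show "(\<integral>\<^sup>+ z. ennreal (norm (case z of (x, y) \<Rightarrow> f x * g y)) \<partial>(M \<Otimes>\<^sub>M N)) < \<infinity>" .
  qed measurable
  have "(\<integral>z. (case z of (x, y) \<Rightarrow> f x * g y) \<partial>(M \<Otimes>\<^sub>M N)) = (\<integral>x. (\<integral>y. f x * g y \<partial>N) \<partial>M)"
    using P.integral_fst'[OF int] by simp
  also have "\<dots> = a * b"
    using f g by (simp add: has_bochner_integral_iff)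
  finally show ?thesis using int by (simp add: has_bochner_integral_iff)
qed

lemma integrable_bounded_mult:
  fixes f H :: "'a \<Rightarrow> real"
  assumes H: "H \<in> borel_measurable M" "\<And>x. x \<in> space M \<Longrightarrow> \<bar>H x\<bar> \<le> B" and f: "integrable M f"
  shows "integrable M (\<lambda>x. H x * f x)"
proof (rule Bochner_Integration.integrable_bound)
  show "integrable M (\<lambda>x. B * f x)" using f by simp
  show "(\<lambda>x. H x * f x) \<in> borel_measurable M" using H f by simp
  show "AE x in M. norm (H x * f x) \<le> norm (B * f x)"
  proof (rule AE_I2)
    fix x assume "x \<in> space M"
    then have "\<bar>H x\<bar> \<le> \<bar>B\<bar>" using H(2) by fastforce
    then show "norm (H x * f x) \<le> norm (B * f x)" by (simp add: abs_mult mult_right_mono)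
  qed
qed

lemma Int_stable_vimage: "Int_stable {X -` A \<inter> S |A. A \<in> sets N}"
proof (rule Int_stableI)
  fix B C assume "B \<in> {X -` A \<inter> S |A. A \<in> sets N}" "C \<in> {X -` A \<inter> S |A. A \<in> sets N}"
  then obtain A A' where *: "A \<in> sets N" "A' \<in> sets N" "B = X -` A \<inter> S" "C = X -` A' \<inter> S" by auto
  then have "B \<inter> C = X -` (A \<inter> A') \<inter> S" "A \<inter> A' \<in> sets N" by auto
  then show "B \<inter> C \<in> {X -` A \<inter> S |A. A \<in> sets N}" by blast
qed

lemma rect_incr_degenerate [simp]:
  "rect_incr W (a, a, c, d) \<omega> = 0" "rect_incr W (a, b, c, c) \<omega> = 0"
  by (simp_all add: rect_incr_def)

locale white_noise =
  fixes M :: "'a measure" and F :: "real \<Rightarrow> 'a measure" and W :: "real \<Rightarrow> real \<Rightarrow> 'a \<Rightarrow> real"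
  assumes sheet: "brownian_sheet M F W"
begin

abbreviation incr :: "real \<Rightarrow> real \<Rightarrow> real \<Rightarrow> real \<Rightarrow> 'a \<Rightarrow> real" where
  "incr a b c d \<equiv> rect_incr W (a, b, c, d)"

sublocale prob_space M using sheet by (simp add: brownian_sheet_def)

lemma space_F: "space (F t) = space M" and sets_F_mono: "s \<le> t \<Longrightarrow> sets (F s) \<subseteq> sets (F t)"
  using sheet by (auto simp: brownian_sheet_def filtration_def)

lemma sets_F: "sets (F t) \<subseteq> sets M"
  using sheet by (auto simp: brownian_sheet_def subalgebra_def)

lemma F_measurable_M: "f \<in> borel_measurable (F t) \<Longrightarrow> f \<in> borel_measurable M"
  using sheet by (auto simp: brownian_sheet_def intro: measurable_from_subalg)

lemma F_measurable_mono:
  assumes "f \<in> borel_measurable (F s)" "s \<le> t" shows "f \<in> borel_measurable (F t)"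
  using assms sets_F_mono[of s t] by (auto simp: measurable_def space_F)

lemma rect_incr_measurable_F:
  assumes "0 \<le> a" "a \<le> b" shows "incr a b c d \<in> borel_measurable (F b)"
proof -
  have "W t x \<in> borel_measurable (F t)" if "0 \<le> t" for t x
    using sheet that by (simp add: brownian_sheet_def)
  then have [measurable]: "W t x \<in> borel_measurable (F b)" if "0 \<le> t" "t \<le> b" for t x
    using F_measurable_mono that by blast
  show ?thesis using assms by (simp add: rect_incr_def[abs_def])
qed

lemma rect_incr_measurable: "0 \<le> a \<Longrightarrow> a \<le> b \<Longrightarrow> incr a b c d \<in> borel_measurable M"
  by (rule F_measurable_M[OF rect_incr_measurable_F])

lemma rect_incr_moment:
  assumes "good_rect (a, b, c, d)"
  shows "integrable M (\<lambda>\<omega>. incr a b c d \<omega> ^ n)"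
    and "expectation (\<lambda>\<omega>. incr a b c d \<omega> ^ n) =
      (\<integral>x. normal_density 0 (sqrt ((b - a) * (d - c))) x * x ^ n \<partial>lborel)"
proof -
  have D: "distributed M lborel (incr a b c d) (normal_density 0 (sqrt ((b - a) * (d - c))))"
    using sheet assms by (simp add: brownian_sheet_def)
  have pos: "0 < sqrt ((b - a) * (d - c))" using assms by (simp add: good_rect_def)
  show "integrable M (\<lambda>\<omega>. incr a b c d \<omega> ^ n)"
    using distributed_integrable[OF D, of "\<lambda>x. x^n"] integrable_normal_moment[OF pos, of 0 n] by simp
  show "expectation (\<lambda>\<omega>. incr a b c d \<omega> ^ n) =
      (\<integral>x. normal_density 0 (sqrt ((b - a) * (d - c))) x * x ^ n \<partial>lborel)"
    using distributed_integral[OF D, of "\<lambda>x. x^n"] by simp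
qed

text \<open>The sheet axiom is a product formula for single events, applied here with s = a.
  Preimages of Borel sets form intersection-stable generators, so the formula passes to the
  generated sigma-algebras.\<close>

lemma rect_incr_indep:
  assumes R: "good_rect (a, b, c, d)" and H: "H \<in> borel_measurable (F a)"
  shows "indep_var borel H borel (incr a b c d)"
proof -
  have ab: "0 \<le> a" "a \<le> b" using R by (auto simp: good_rect_def)
  note [measurable] = F_measurable_M[OF H] rect_incr_measurable[OF ab, of c d]
  have ind: "prob (A \<inter> (incr a b c d -` B \<inter> space M)) =
       prob A * prob (incr a b c d -` B \<inter> space M)" if "A \<in> sets (F a)" "B \<in> sets borel" for A B
  proof -
    have "\<forall>s a b c d. 0 \<le> s \<longrightarrow> s \<le> a \<longrightarrow> good_rect (a, b, c, d) \<longrightarrow>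
        (\<forall>A\<in>sets (F s). \<forall>B\<in>sets borel.
           measure M (A \<inter> (incr a b c d -` B \<inter> space M)) =
           measure M A * measure M (incr a b c d -` B \<inter> space M))"
      using sheet unfolding brownian_sheet_def by (elim conjE)
    with R that ab show ?thesis by simp
  qed
  have "indep_set {H -` A \<inter> space M |A. A \<in> sets borel} {incr a b c d -` A \<inter> space M |A. A \<in> sets borel}"
  proof (rule indep_setI)
    fix A B assume "A \<in> {H -` A \<inter> space M |A. A \<in> sets borel}"
      and "B \<in> {incr a b c d -` A \<inter> space M |A. A \<in> sets borel}"
    then show "prob (A \<inter> B) = prob A * prob B"
      using measurable_sets[OF H] by (auto simp: space_F intro: ind)
  qed auto
  then have "indep_set (sigma_sets (space M) {H -` A \<inter> space M |A. A \<in> sets borel})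
     (sigma_sets (space M) {incr a b c d -` A \<inter> space M |A. A \<in> sets borel})"
    by (rule indep_set_sigma_sets) (rule Int_stable_vimage)+
  then show ?thesis by (simp add: indep_var_eq)
qed

lemma rect_incr_cond_moment:
  assumes "0 \<le> a" "a \<le> b" "c \<le> d" and H: "H \<in> borel_measurable (F a)" "integrable M H"
  shows "has_bochner_integral M (\<lambda>\<omega>. H \<omega> * incr a b c d \<omega> ^ n)
    (expectation H * expectation (\<lambda>\<omega>. incr a b c d \<omega> ^ n))"
proof (cases "a < b \<and> c < d")
  case True
  then have R: "good_rect (a, b, c, d)" using assms by (simp add: good_rect_def)
  have "indep_var borel ((\<lambda>x. x) \<circ> H) borel ((\<lambda>x. x ^ n) \<circ> incr a b c d)"
    by (rule indep_var_compose[OF rect_incr_indep[OF R H(1)]]) auto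
  then have "indep_var borel H borel (\<lambda>\<omega>. incr a b c d \<omega> ^ n)" by (simp add: comp_def)
  from indep_var_integrable[OF this H(2) rect_incr_moment(1)[OF R]]
       indep_var_lebesgue_integral[OF this H(2) rect_incr_moment(1)[OF R]]
  show ?thesis by (simp add: has_bochner_integral_iff)
next
  case False
  then have "a = b \<or> c = d" using assms by linarith
  then have "incr a b c d = (\<lambda>_. 0)" by (auto simp: fun_eq_iff)
  then show ?thesis using H by (simp add: has_bochner_integral_iff prob_space)
qed

lemma rect_incr_moments:
  assumes "0 \<le> a" "a \<le> b" "c \<le> d"
  shows "expectation (incr a b c d) = 0"
    and "expectation (\<lambda>\<omega>. incr a b c d \<omega> ^ 2) = (b - a) * (d - c)"
    and "expectation (\<lambda>\<omega>. incr a b c d \<omega> ^ 4) = 3 * ((b - a) * (d - c))\<^sup>2"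
proof -
  have "expectation (incr a b c d) = 0 \<and>
    expectation (\<lambda>\<omega>. incr a b c d \<omega> ^ 2) = (b - a) * (d - c) \<and>
    expectation (\<lambda>\<omega>. incr a b c d \<omega> ^ 4) = 3 * ((b - a) * (d - c))\<^sup>2"
  proof (cases "a < b \<and> c < d")
    case True
    then have R: "good_rect (a, b, c, d)" using assms by (simp add: good_rect_def)
    then have pos: "0 < sqrt ((b - a) * (d - c))" by (simp add: good_rect_def)
    have "0 < (b - a) * (d - c)" using pos by simp
    then show ?thesis
      using rect_incr_moment(2)[OF R, of 1] rect_incr_moment(2)[OF R, of 2] rect_incr_moment(2)[OF R, of 4]
        integral_normal_moment_odd[OF pos, of 0 0] integral_normal_moment_even[OF pos, of 0 1]
        integral_normal_moment_even[OF pos, of 0 2]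
      by (simp add: fact_numeral power_divide)
  next
    case False
    then have deg: "a = b \<or> c = d" using assms by linarith
    then have "incr a b c d = (\<lambda>_. 0)" by (auto simp: fun_eq_iff)
    then show ?thesis using deg by auto
  qed
  then show "expectation (incr a b c d) = 0"
    and "expectation (\<lambda>\<omega>. incr a b c d \<omega> ^ 2) = (b - a) * (d - c)"
    and "expectation (\<lambda>\<omega>. incr a b c d \<omega> ^ 4) = 3 * ((b - a) * (d - c))\<^sup>2" by auto
qed

text \<open>Only the increment over a single rectangle is known to be independent of the past; the joint
  behaviour of two increments over the same time interval is recovered from the four rectangles
  that their space endpoints span.\<close>

lemma rect_incr_polarization:
  assumes ab: "0 \<le> a" "a \<le> b" and cd: "c \<le> d" "c' \<le> d'"
    and H: "H \<in> borel_measurable (F a)" "integrable M H"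
  shows "has_bochner_integral M (\<lambda>\<omega>. H \<omega> * incr a b c d \<omega> * incr a b c' d' \<omega>)
    (expectation H * ((b - a) * max 0 (min d d' - max c c')))"
proof -
  let ?D = "\<lambda>x y \<omega>. incr a b x y \<omega>"
  have factor: "(1/2) * (((e * (h * p) + e * (h * q)) - e * (h * r)) - e * (h * s))
      = e * (h * ((1/2) * (p + q - r - s)))" for e h p q r s :: real
    by (simp add: algebra_simps)
  \<comment> \<open>The endpoints x and y may come in either order: reversing them changes only the
    sign of the increment. This accounts for the absolute value in the variance.\<close>
  have sq: "has_bochner_integral M (\<lambda>\<omega>. H \<omega> * (?D x y \<omega>)\<^sup>2) (expectation H * ((b - a) * \<bar>y - x\<bar>))" for x y
  proof (cases "x \<le> y")
    case True
    then show ?thesis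
      using rect_incr_cond_moment[OF ab True H, of 2] rect_incr_moments(2)[OF ab True] by simp
  next
    case False
    then have "y \<le> x" by simp
    moreover have "(?D x y \<omega>)\<^sup>2 = (?D y x \<omega>)\<^sup>2" for \<omega>
      by (simp add: rect_incr_def power2_eq_square algebra_simps)
    ultimately show ?thesis
      using rect_incr_cond_moment[OF ab \<open>y \<le> x\<close> H, of 2] rect_incr_moments(2)[OF ab \<open>y \<le> x\<close>] by simp
  qed
  \<comment> \<open>Polarization: with B(x) the increment up to x, twice (B(d) - B(c)) (B(d') -
    B(c')) equals (B(d) - B(c'))^2 + (B(d') - B(c))^2 - (B(d) - B(d'))^2 - (B(c) - B(c'))^2. The
    same combination of absolute values is twice the length of the overlap of the two
    intervals.\<close>
  have "has_bochner_integral M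
     (\<lambda>\<omega>. (1/2) * (((H \<omega> * (?D c' d \<omega>)\<^sup>2 + H \<omega> * (?D c d' \<omega>)\<^sup>2) - H \<omega> * (?D d' d \<omega>)\<^sup>2) - H \<omega> * (?D c' c \<omega>)\<^sup>2))
     ((1/2) * (((expectation H * ((b - a) * \<bar>d - c'\<bar>) + expectation H * ((b - a) * \<bar>d' - c\<bar>))
        - expectation H * ((b - a) * \<bar>d - d'\<bar>)) - expectation H * ((b - a) * \<bar>c - c'\<bar>)))"
    by (intro has_bochner_integral_mult_right has_bochner_integral_diff has_bochner_integral_add sq)
  moreover have "(\<lambda>\<omega>. (1/2) * (((H \<omega> * (?D c' d \<omega>)\<^sup>2 + H \<omega> * (?D c d' \<omega>)\<^sup>2) - H \<omega> * (?D d' d \<omega>)\<^sup>2) - H \<omega> * (?D c' c \<omega>)\<^sup>2))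
      = (\<lambda>\<omega>. H \<omega> * ?D c d \<omega> * ?D c' d' \<omega>)"
    by (rule ext) (simp add: rect_incr_def power2_eq_square algebra_simps)
  moreover have "(1/2) * (((expectation H * ((b - a) * \<bar>d - c'\<bar>) + expectation H * ((b - a) * \<bar>d' - c\<bar>))
        - expectation H * ((b - a) * \<bar>d - d'\<bar>)) - expectation H * ((b - a) * \<bar>c - c'\<bar>))
     = expectation H * ((b - a) * ((1/2) * (\<bar>d - c'\<bar> + \<bar>d' - c\<bar> - \<bar>d - d'\<bar> - \<bar>c - c'\<bar>)))"
    by (rule factor)
  moreover have "(1/2) * (\<bar>d - c'\<bar> + \<bar>d' - c\<bar> - \<bar>d - d'\<bar> - \<bar>c - c'\<bar>) = max 0 (min d d' - max c c')"
    using cd by (cases "c \<le> c'"; cases "d \<le> d'"; cases "c' \<le> d"; cases "c \<le> d'") auto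
  ultimately show ?thesis by (simp only:)
qed

text \<open>The earlier increment is known at time \<open>a'\<close>, so it can be counted as part
  of the coefficient; the later increment is then independent of it and centred.\<close>

lemma rect_incr_orthogonal:
  assumes ab: "0 \<le> a" "a \<le> b" "b \<le> a'" "a' \<le> b'" and cd: "c \<le> d" "c' \<le> d'"
    and H: "H \<in> borel_measurable (F a')" "\<And>\<omega>. \<omega> \<in> space M \<Longrightarrow> \<bar>H \<omega>\<bar> \<le> B"
  shows "has_bochner_integral M (\<lambda>\<omega>. H \<omega> * incr a b c d \<omega> * incr a' b' c' d' \<omega>) 0"
proof -
  have m: "(\<lambda>\<omega>. H \<omega> * incr a b c d \<omega>) \<in> borel_measurable (F a')"
    using H(1) F_measurable_mono[OF rect_incr_measurable_F[OF ab(1,2)] ab(3)] by (rule borel_measurable_times)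
  have "integrable M (\<lambda>\<omega>. 1 * incr a b c d \<omega> ^ 1)"
    by (rule integrable.intros[OF rect_incr_cond_moment[OF ab(1,2) cd(1)]]) auto
  then have "integrable M (\<lambda>\<omega>. H \<omega> * incr a b c d \<omega>)"
    using integrable_bounded_mult[OF F_measurable_M[OF H(1)] H(2)] by simp
  from rect_incr_cond_moment[OF _ ab(4) cd(2) m this, of 1] rect_incr_moments(1)[OF _ ab(4) cd(2)] ab
  show ?thesis by simp
qed

lemma rect_incr_add_time:
  "incr a b c d \<omega> = incr a t c d \<omega> + incr t b c d \<omega>"
  by (simp add: rect_incr_def)

text \<open>Both time intervals are cut at the later start \<open>a'\<close> and the earlier end
  \<open>m\<close>. On the common piece polarization applies; in every other surviving product one
  increment lies entirely after the other, so its expectation is zero. The coefficient needs to be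
  known only at the later start, which is what a product of two adapted coefficients
  provides.\<close>

lemma rect_incr_product:
  assumes ab: "0 \<le> a" "a \<le> b" "0 \<le> a'" "a' \<le> b'" and cd: "c \<le> d" "c' \<le> d'"
    and H: "H \<in> borel_measurable (F (max a a'))" "\<And>\<omega>. \<omega> \<in> space M \<Longrightarrow> \<bar>H \<omega>\<bar> \<le> B"
  shows "has_bochner_integral M (\<lambda>\<omega>. H \<omega> * incr a b c d \<omega> * incr a' b' c' d' \<omega>)
    (expectation H * (max 0 (min b b' - max a a') * max 0 (min d d' - max c c')))"
proof -
  have le: "has_bochner_integral M (\<lambda>\<omega>. H \<omega> * incr a b c d \<omega> * incr a' b' c' d' \<omega>)
    (expectation H * (max 0 (min b b' - a') * max 0 (min d d' - max c c')))"
    if ab: "0 \<le> a" "a \<le> b" "a \<le> a'" "a' \<le> b'" and cd: "c \<le> d" "c' \<le> d'" and Hm: "H \<in> borel_measurable (F a')"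
    for a b c d a' b' c' d'
  proof (cases "b \<le> a'")
    case True
    then show ?thesis using rect_incr_orthogonal[OF ab(1,2) True ab(4) cd Hm H(2)] by simp
  next
    case False
    define m where "m = min b b'"
    have m: "a' \<le> m" "m \<le> b" "m \<le> b'" "m = b \<or> m = b'" "0 \<le> a'" "0 \<le> m" using False ab by (auto simp: m_def min_def)
    have Hm': "H \<in> borel_measurable (F m)" by (rule F_measurable_mono[OF Hm m(1)])
    \<comment> \<open>Here \<open>d2\<close> and \<open>e2\<close> are the pieces after time
      \<open>m\<close>. Since \<open>m\<close> is one of the two end times, one of these pieces is
      empty and their product vanishes.\<close>
    have expand: "h * p * q = h * d1 * e1 + h * d0 * q + h * d1 * e2 + h * e1 * d2"
      if "d2 * e2 = 0" "p = d0 + (d1 + d2)" "q = e1 + e2" for h p q d0 d1 d2 e1 e2 :: real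
    proof -
      have "h * (d2 * e2) = 0" using that(1) by simp
      then show ?thesis unfolding that(2,3) by (simp add: distrib_left distrib_right mult_ac)
    qed
    let ?D = "\<lambda>x y \<omega>. incr x y c d \<omega>" and ?E = "\<lambda>x y \<omega>. incr x y c' d' \<omega>"
    have "integrable M H"
      using F_measurable_M[OF Hm] H(2) by (intro integrable_const_bound[where B=B]) auto
    then have main: "has_bochner_integral M (\<lambda>\<omega>. H \<omega> * ?D a' m \<omega> * ?E a' m \<omega>)
       (expectation H * ((m - a') * max 0 (min d d' - max c c')))"
      by (rule rect_incr_polarization[OF m(5,1) cd Hm])
    have 1: "has_bochner_integral M (\<lambda>\<omega>. H \<omega> * ?D a a' \<omega> * ?E a' b' \<omega>) 0"
      by (rule rect_incr_orthogonal[OF ab(1,3) order_refl ab(4) cd Hm H(2)])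
    have 2: "has_bochner_integral M (\<lambda>\<omega>. H \<omega> * ?D a' m \<omega> * ?E m b' \<omega>) 0"
      by (rule rect_incr_orthogonal[OF m(5,1) order_refl m(3) cd Hm' H(2)])
    have 3: "has_bochner_integral M (\<lambda>\<omega>. H \<omega> * ?E a' m \<omega> * ?D m b \<omega>) 0"
      by (rule rect_incr_orthogonal[OF m(5,1) order_refl m(2) cd(2,1) Hm' H(2)])
    have "has_bochner_integral M (\<lambda>\<omega>. H \<omega> * ?D a' m \<omega> * ?E a' m \<omega> + H \<omega> * ?D a a' \<omega> * ?E a' b' \<omega>
         + H \<omega> * ?D a' m \<omega> * ?E m b' \<omega> + H \<omega> * ?E a' m \<omega> * ?D m b \<omega>)
        (expectation H * ((m - a') * max 0 (min d d' - max c c')) + 0 + 0 + 0)"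
      by (intro has_bochner_integral_add main 1 2 3)
    moreover have "H \<omega> * ?D a b \<omega> * ?E a' b' \<omega> = H \<omega> * ?D a' m \<omega> * ?E a' m \<omega> + H \<omega> * ?D a a' \<omega> * ?E a' b' \<omega>
         + H \<omega> * ?D a' m \<omega> * ?E m b' \<omega> + H \<omega> * ?E a' m \<omega> * ?D m b \<omega>" for \<omega>
    proof -
      have "?D m b \<omega> * ?E m b' \<omega> = 0" using m(4) by auto
      moreover have "?D a b \<omega> = ?D a a' \<omega> + (?D a' m \<omega> + ?D m b \<omega>)"
        by (simp only: rect_incr_add_time[of a b c d \<omega> a'] rect_incr_add_time[of a' b c d \<omega> m])
      moreover have "?E a' b' \<omega> = ?E a' m \<omega> + ?E m b' \<omega>" by (rule rect_incr_add_time)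
      ultimately show ?thesis by (rule expand)
    qed
    ultimately show ?thesis using m by (simp add: m_def[symmetric])
  qed
  show ?thesis
  proof (cases "a \<le> a'")
    case True
    then have "max a a' = a'" by simp
    then show ?thesis using le[OF ab(1,2) True ab(4) cd] H(1) by simp
  next
    case False
    then have *: "max a a' = a" "a' \<le> a" by auto
    have "has_bochner_integral M (\<lambda>\<omega>. H \<omega> * incr a' b' c' d' \<omega> * incr a b c d \<omega>)
      (expectation H * (max 0 (min b' b - a) * max 0 (min d' d - max c' c)))"
      using le[OF ab(3,4) *(2) ab(2) cd(2,1)] H(1) * by simp
    moreover have "min b' b = min b b'" "min d' d = min d d'" "max c' c = max c c'"
      by (auto simp: min_def max_def)
    ultimately show ?thesis by (simp add: * mult.assoc mult.commute[of "incr a' b' c' d' _"])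
  qed
qed

end

section \<open>Elementary integrands\<close>

lemma hbi_indicator_Ioc:
  "has_bochner_integral lborel (\<lambda>s. indicator {a<..b} s * indicator {a'<..b'} s :: real)
     (max 0 (min b b' - max a a'))"
proof -
  have "(\<lambda>s. indicator {a<..b} s * indicator {a'<..b'} s :: real) = indicator {max a a'<..min b b'}"
    by (auto simp: fun_eq_iff indicator_def)
  moreover have "measure lborel {max a a'<..min b b'} = max 0 (min b b' - max a a')"
    by (cases "max a a' \<le> min b b'") (auto simp: max_absorb1 max_absorb2)
  moreover have "emeasure lborel {max a a'<..min b b'} < \<infinity>"
    by (cases "max a a' \<le> min b b'") auto
  ultimately show ?thesis
    using has_bochner_integral_real_indicator[of "{max a a'<..min b b'}" lborel] by simp
qed

lemma hbi_indicator_rect: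
  "has_bochner_integral (lborel \<Otimes>\<^sub>M lborel)
     (\<lambda>(s, y). (indicator {a<..b} s * indicator {a'<..b'} s) * (indicator {c<..d} y * indicator {c'<..d'} y) :: real)
     (max 0 (min b b' - max a a') * max 0 (min d d' - max c c'))"
  by (rule has_bochner_integral_pair_times[OF _ _ hbi_indicator_Ioc hbi_indicator_Ioc]) (rule lborel.sigma_finite_measure_axioms)+

lemma simple_fun_Nil [simp]: "simple_fun [] \<omega> s y = 0"
  and simple_fun_Cons: "simple_fun ((X, (a, b, c, d)) # es) \<omega> s y =
    X \<omega> * indicator {a<..b} s * indicator {c<..d} y + simple_fun es \<omega> s y"
  and simple_int_Nil [simp]: "simple_int W [] \<omega> = 0"
  and simple_int_Cons: "simple_int W ((X, R) # es) \<omega> = X \<omega> * rect_incr W R \<omega> + simple_int W es \<omega>"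
  by (simp_all add: simple_fun_def simple_int_def)

text \<open>The left endpoint of an integrand may only be moved to the right, because its coefficient is
  measurable at time \<open>a\<close>; this is the reason for the nested \<open>max\<close>.\<close>

definition strip :: "real \<Rightarrow> real \<Rightarrow> (('a \<Rightarrow> real) \<times> (real \<times> real \<times> real \<times> real)) list
    \<Rightarrow> (('a \<Rightarrow> real) \<times> (real \<times> real \<times> real \<times> real)) list" where
  "strip r' r = map (\<lambda>(X, (a, b, c, d)). (X, (max a r', max (max a r') (min b r), c, d)))"

lemma strip_Nil [simp]: "strip r' r [] = []"
  and strip_Cons: "strip r' r ((X, (a, b, c, d)) # es) = (X, (max a r', max (max a r') (min b r), c, d)) # strip r' r es"
  by (simp_all add: strip_def)

lemma simple_fun_strip:
  "simple_fun (strip r' r es) \<omega> s y = indicator {r'<..r} s * simple_fun es \<omega> s y"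
proof (induction es)
  case (Cons e es)
  obtain X a b c d where e: "e = (X, (a, b, c, d))" by (cases e) auto
  have "indicator {max a r'<..max (max a r') (min b r)} s = (indicator {r'<..r} s * indicator {a<..b} s :: real)"
    by (auto simp: indicator_def)
  then show ?case using Cons by (simp add: e strip_Cons simple_fun_Cons algebra_simps)
qed simp

context white_noise
begin

abbreviation lplane :: "(real \<times> real) measure" where "lplane \<equiv> lborel \<Otimes>\<^sub>M lborel"
abbreviation MP :: "('a \<times> real \<times> real) measure" where "MP \<equiv> M \<Otimes>\<^sub>M lplane"

lemma sigma_finite_plane: "sigma_finite_measure lplane"
  unfolding lborel_prod by (rule lborel.sigma_finite_measure_axioms)

text \<open>The lower bound on the starting times ensures that a weight known at time
  \<open>r\<close> is known before every increment of the list. For \<open>r = 0\<close> the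
  condition reduces to \<open>elem_ok\<close>.\<close>

definition elems_from :: "real \<Rightarrow> (('a \<Rightarrow> real) \<times> (real \<times> real \<times> real \<times> real)) list \<Rightarrow> bool" where
  "elems_from r es \<longleftrightarrow> (\<forall>e\<in>set es. elem_ok M F e \<and> r \<le> fst (snd e))"

lemma elems_from_Nil [simp]: "elems_from r []"
  and elems_from_Cons: "elems_from r ((X, (a, b, c, d)) # es) \<longleftrightarrow>
    r \<le> a \<and> elem_ok M F (X, (a, b, c, d)) \<and> elems_from r es"
  by (auto simp: elems_from_def)

lemma elem_okE:
  assumes "elem_ok M F (X, (a, b, c, d))"
  obtains B where "0 \<le> a" "a \<le> b" "c \<le> d" "X \<in> borel_measurable (F a)" "X \<in> borel_measurable M"
    "\<And>\<omega>. \<omega> \<in> space M \<Longrightarrow> \<bar>X \<omega>\<bar> \<le> B"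
  using assms F_measurable_M unfolding elem_ok_def by auto

lemma elems_from_0: "(\<forall>e\<in>set es. elem_ok M F e) \<longleftrightarrow> elems_from 0 es"
proof -
  have "elem_ok M F e \<Longrightarrow> 0 \<le> fst (snd e)" for e by (auto simp: elem_ok_def split: prod.splits)
  then show ?thesis by (auto simp: elems_from_def)
qed

lemma simple_fun_measurable:
  assumes "elems_from r es"
  shows "(\<lambda>(\<omega>, s, y). simple_fun es \<omega> s y) \<in> borel_measurable MP"
  using assms
proof (induction es)
  case (Cons e es)
  obtain X a b c d where e: "e = (X, (a, b, c, d))" by (cases e) auto
  with Cons have ok: "elem_ok M F (X, (a, b, c, d))" by (simp add: elems_from_Cons)
  have [measurable]: "X \<in> borel_measurable M" by (rule elem_okE[OF ok])
  have [measurable]: "(\<lambda>(\<omega>, s, y). simple_fun es \<omega> s y) \<in> borel_measurable MP"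
    using Cons by (simp add: e elems_from_Cons)
  have "(\<lambda>(\<omega>, s, y). X \<omega> * indicator {a<..b} s * indicator {c<..d} y) \<in> borel_measurable MP"
    by measurable
  then have "(\<lambda>z. (\<lambda>(\<omega>, s, y). X \<omega> * indicator {a<..b} s * indicator {c<..d} y) z + (\<lambda>(\<omega>, s, y). simple_fun es \<omega> s y) z)
      \<in> borel_measurable MP" by measurable
  then show ?case by (simp add: e simple_fun_Cons case_prod_unfold)
qed (simp add: case_prod_unfold)

lemma simple_int_measurable:
  assumes "elems_from r es" shows "simple_int W es \<in> borel_measurable M"
  using assms
proof (induction es)
  case Nil
  then show ?case by (simp add: simple_int_def[abs_def])
next
  case (Cons e es)
  obtain X a b c d where e: "e = (X, (a, b, c, d))" by (cases e) auto
  with Cons have ok: "elem_ok M F (X, (a, b, c, d))" by (simp add: elems_from_Cons)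
  then obtain B where X: "0 \<le> a" "a \<le> b" and [measurable]: "X \<in> borel_measurable M" by (rule elem_okE) blast
  have [measurable]: "simple_int W es \<in> borel_measurable M" using Cons by (simp add: e elems_from_Cons)
  note [measurable] = rect_incr_measurable[OF X]
  have "(\<lambda>\<omega>. X \<omega> * incr a b c d \<omega> + simple_int W es \<omega>) \<in> borel_measurable M" by measurable
  then show ?case by (simp add: e simple_int_Cons[abs_def])
qed

text \<open>A relation rather than an equation between integrals: integrability of both sides is
  carried through the inductions together with equality, and the common value need not be
  computed.\<close>

definition equal_integrals :: "('a \<Rightarrow> real) \<Rightarrow> ('a \<times> real \<times> real \<Rightarrow> real) \<Rightarrow> bool" where
  "equal_integrals f g \<longleftrightarrow> (\<exists>v. has_bochner_integral M f v \<and> has_bochner_integral MP g v)"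

lemma equal_integrals_add:
  assumes "equal_integrals f g" "equal_integrals f' g'"
  shows "equal_integrals (\<lambda>\<omega>. f \<omega> + f' \<omega>) (\<lambda>z. g z + g' z)"
  using assms unfolding equal_integrals_def by (blast intro: has_bochner_integral_add)

lemma simple_isometry_single:
  assumes G: "G \<in> borel_measurable (F r)" "\<And>\<omega>. \<omega> \<in> space M \<Longrightarrow> \<bar>G \<omega>\<bar> \<le> B"
    and e: "elem_ok M F (X, (a, b, c, d))" "r \<le> a" and e': "elem_ok M F (X', (a', b', c', d'))" "r \<le> a'"
  shows "equal_integrals (\<lambda>\<omega>. G \<omega> * (X \<omega> * incr a b c d \<omega>) * (X' \<omega> * incr a' b' c' d' \<omega>))
    (\<lambda>(\<omega>, s, y). G \<omega> * (X \<omega> * indicator {a<..b} s * indicator {c<..d} y)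
      * (X' \<omega> * indicator {a'<..b'} s * indicator {c'<..d'} y))"
proof -
  obtain C where X: "0 \<le> a" "a \<le> b" "c \<le> d" "X \<in> borel_measurable (F a)" "\<And>\<omega>. \<omega> \<in> space M \<Longrightarrow> \<bar>X \<omega>\<bar> \<le> C"
    using e(1) by (rule elem_okE) blast
  obtain C' where X': "0 \<le> a'" "a' \<le> b'" "c' \<le> d'" "X' \<in> borel_measurable (F a')" "\<And>\<omega>. \<omega> \<in> space M \<Longrightarrow> \<bar>X' \<omega>\<bar> \<le> C'"
    using e'(1) by (rule elem_okE) blast
  define H where "H = (\<lambda>\<omega>. G \<omega> * (X \<omega> * X' \<omega>))"
  have Hm: "H \<in> borel_measurable (F (max a a'))"
    unfolding H_def using e(2) e'(2)
    by (intro borel_measurable_times F_measurable_mono[OF G(1)] F_measurable_mono[OF X(4)] F_measurable_mono[OF X'(4)]) auto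
  have Hb: "\<bar>H \<omega>\<bar> \<le> \<bar>B\<bar> * (\<bar>C\<bar> * \<bar>C'\<bar>)" if "\<omega> \<in> space M" for \<omega>
    unfolding H_def abs_mult using G(2)[OF that] X(5)[OF that] X'(5)[OF that]
    by (intro mult_mono) auto
  have "integrable M H"
    using F_measurable_M[OF Hm] Hb by (intro integrable_const_bound[where B="\<bar>B\<bar> * (\<bar>C\<bar> * \<bar>C'\<bar>)"]) auto
  then have "has_bochner_integral M H (expectation H)" by (rule has_bochner_integral_integrable)
  from has_bochner_integral_pair_times[OF sigma_finite_measure_axioms sigma_finite_plane this hbi_indicator_rect]
  have "has_bochner_integral MP (\<lambda>(\<omega>, s, y). H \<omega> * ((indicator {a<..b} s * indicator {a'<..b'} s) * (indicator {c<..d} y * indicator {c'<..d'} y)))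
     (expectation H * (max 0 (min b b' - max a a') * max 0 (min d d' - max c c')))"
    by (simp add: case_prod_unfold)
  moreover have "has_bochner_integral M (\<lambda>\<omega>. H \<omega> * incr a b c d \<omega> * incr a' b' c' d' \<omega>)
     (expectation H * (max 0 (min b b' - max a a') * max 0 (min d d' - max c c')))"
    by (rule rect_incr_product[OF X(1,2) X'(1,2) X(3) X'(3) Hm Hb])
  ultimately show ?thesis
    unfolding equal_integrals_def by (intro exI conjI) (simp_all add: H_def mult_ac)
qed

text \<open>The two lists are kept separate because a square does not split along a list, whereas a
  bilinear form allows one induction per argument.\<close>

lemma simple_isometry_bilinear:
  assumes G: "G \<in> borel_measurable (F r)" "\<And>\<omega>. \<omega> \<in> space M \<Longrightarrow> \<bar>G \<omega>\<bar> \<le> B"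
    and es: "elems_from r es" and es': "elems_from r es'"
  shows "equal_integrals (\<lambda>\<omega>. G \<omega> * simple_int W es \<omega> * simple_int W es' \<omega>)
    (\<lambda>(\<omega>, s, y). G \<omega> * simple_fun es \<omega> s y * simple_fun es' \<omega> s y)"
  using es
proof (induction es)
  case Nil
  then show ?case by (auto simp: equal_integrals_def intro!: exI[of _ 0])
next
  case (Cons e es)
  obtain X a b c d where e: "e = (X, (a, b, c, d))" by (cases e) auto
  with Cons have ok: "elem_ok M F (X, (a, b, c, d))" "r \<le> a" by (simp_all add: elems_from_Cons)
  have "equal_integrals (\<lambda>\<omega>. G \<omega> * (X \<omega> * incr a b c d \<omega>) * simple_int W es' \<omega>)
    (\<lambda>(\<omega>, s, y). G \<omega> * (X \<omega> * indicator {a<..b} s * indicator {c<..d} y) * simple_fun es' \<omega> s y)"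
    using es'
  proof (induction es')
    case Nil
    then show ?case by (auto simp: equal_integrals_def intro!: exI[of _ 0])
  next
    case (Cons e' es')
    obtain X' a' b' c' d' where e': "e' = (X', (a', b', c', d'))" by (cases e') auto
    with Cons have ok': "elem_ok M F (X', (a', b', c', d'))" "r \<le> a'" by (simp_all add: elems_from_Cons)
    show ?case
      using equal_integrals_add[OF simple_isometry_single[OF G ok ok'] Cons.IH] Cons.prems
      by (simp add: e' elems_from_Cons simple_int_Cons simple_fun_Cons case_prod_unfold distrib_left)
  qed
  from equal_integrals_add[OF this Cons.IH] Cons.prems show ?case
    by (simp add: e elems_from_Cons simple_int_Cons simple_fun_Cons case_prod_unfold distrib_left distrib_right)
qed

text \<open>The Ito isometry with a weight known before the integrand starts. In the discrete Ito
  formula the weight is \<open>trunc_weight\<close> of the integral accumulated so far, and the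
  integrand is its next time slab.\<close>

lemma simple_isometry:
  assumes G: "G \<in> borel_measurable (F r)" "\<And>\<omega>. \<omega> \<in> space M \<Longrightarrow> 0 \<le> G \<omega>" "\<And>\<omega>. \<omega> \<in> space M \<Longrightarrow> G \<omega> \<le> B"
    and es: "elems_from r es"
  shows "integrable M (\<lambda>\<omega>. G \<omega> * (simple_int W es \<omega>)\<^sup>2)"
    and "(\<integral>\<^sup>+ \<omega>. ennreal (G \<omega> * (simple_int W es \<omega>)\<^sup>2) \<partial>M) =
      (\<integral>\<^sup>+ (\<omega>, s, y). ennreal (G \<omega> * (simple_fun es \<omega> s y)\<^sup>2) \<partial>MP)"
proof -
  have "\<bar>G \<omega>\<bar> \<le> B" if "\<omega> \<in> space M" for \<omega> using G(2,3)[OF that] by simp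
  from simple_isometry_bilinear[OF G(1) this es es] obtain v where
    v: "has_bochner_integral M (\<lambda>\<omega>. G \<omega> * (simple_int W es \<omega>)\<^sup>2) v"
      "has_bochner_integral MP (\<lambda>z. case z of (\<omega>, s, y) \<Rightarrow> G \<omega> * (simple_fun es \<omega> s y)\<^sup>2) v"
    by (auto simp: equal_integrals_def power2_eq_square mult.assoc)
  show "integrable M (\<lambda>\<omega>. G \<omega> * (simple_int W es \<omega>)\<^sup>2)" using v(1) by (rule integrable.intros)
  have "(\<integral>\<^sup>+ \<omega>. ennreal (G \<omega> * (simple_int W es \<omega>)\<^sup>2) \<partial>M) = ennreal v"
    using v(1) G(2) by (subst nn_integral_eq_integral) (auto simp: has_bochner_integral_iff)
  moreover have "(\<integral>\<^sup>+ z. ennreal (case z of (\<omega>, s, y) \<Rightarrow> G \<omega> * (simple_fun es \<omega> s y)\<^sup>2) \<partial>MP) = ennreal v"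
    using v(2) G(2) by (subst nn_integral_eq_integral) (auto simp: has_bochner_integral_iff space_pair_measure)
  ultimately show "(\<integral>\<^sup>+ \<omega>. ennreal (G \<omega> * (simple_int W es \<omega>)\<^sup>2) \<partial>M) =
      (\<integral>\<^sup>+ (\<omega>, s, y). ennreal (G \<omega> * (simple_fun es \<omega> s y)\<^sup>2) \<partial>MP)"
    by (simp add: case_prod_unfold)
qed

text \<open>The factor \<open>H\<close> is only required to be integrable, because it will be the
  truncated slope, which grows linearly and is unbounded.\<close>

lemma simple_int_martingale:
  assumes H: "H \<in> borel_measurable (F r)" "integrable M H" and es: "elems_from r es"
  shows "has_bochner_integral M (\<lambda>\<omega>. H \<omega> * simple_int W es \<omega>) 0"
  using es
proof (induction es)
  case Nil
  then show ?case by (simp add: has_bochner_integral_zero)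
next
  case (Cons e es)
  obtain X a b c d where e: "e = (X, (a, b, c, d))" by (cases e) auto
  with Cons have ok: "elem_ok M F (X, (a, b, c, d))" "r \<le> a" by (simp_all add: elems_from_Cons)
  obtain C where X: "0 \<le> a" "a \<le> b" "c \<le> d" "X \<in> borel_measurable (F a)" "X \<in> borel_measurable M"
    "\<And>\<omega>. \<omega> \<in> space M \<Longrightarrow> \<bar>X \<omega>\<bar> \<le> C"
    using ok(1) by (rule elem_okE) blast
  have m: "(\<lambda>\<omega>. X \<omega> * H \<omega>) \<in> borel_measurable (F a)"
    using X(4) F_measurable_mono[OF H(1) ok(2)] by (rule borel_measurable_times)
  have "integrable M (\<lambda>\<omega>. X \<omega> * H \<omega>)" by (rule integrable_bounded_mult[OF X(5,6) H(2)])
  from rect_incr_cond_moment[OF X(1-3) m this, of 1] rect_incr_moments(1)[OF X(1-3)]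
  have "has_bochner_integral M (\<lambda>\<omega>. X \<omega> * H \<omega> * incr a b c d \<omega>) 0" by simp
  moreover have "has_bochner_integral M (\<lambda>\<omega>. H \<omega> * simple_int W es \<omega>) 0"
    using Cons by (simp add: e elems_from_Cons)
  ultimately have "has_bochner_integral M (\<lambda>\<omega>. X \<omega> * H \<omega> * incr a b c d \<omega> + H \<omega> * simple_int W es \<omega>) (0 + 0)"
    by (rule has_bochner_integral_add)
  moreover have "X \<omega> * H \<omega> * incr a b c d \<omega> + H \<omega> * simple_int W es \<omega> = H \<omega> * simple_int W (e # es) \<omega>" for \<omega>
    by (simp add: e simple_int_Cons algebra_simps)
  ultimately show ?case by simp
qed

section \<open>Cutting elementary integrals along a time grid\<close>

lemma elems_from_strip:
  assumes "elems_from 0 es" "0 \<le> r'" shows "elems_from r' (strip r' r es)"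
  using assms(1)
proof (induction es)
  case (Cons e es)
  obtain X a b c d where e: "e = (X, (a, b, c, d))" by (cases e) auto
  with Cons have ok: "elem_ok M F (X, (a, b, c, d))" and IH: "elems_from r' (strip r' r es)"
    by (simp_all add: elems_from_Cons)
  define p where "p = max a r'"
  define q where "q = max p (min b r)"
  have pq: "a \<le> p" "r' \<le> p" "p \<le> q" by (simp_all add: p_def q_def)
  obtain B where X: "c \<le> d" "X \<in> borel_measurable (F a)" "\<And>\<omega>. \<omega> \<in> space M \<Longrightarrow> \<bar>X \<omega>\<bar> \<le> B"
    using ok by (rule elem_okE) blast
  have "0 \<le> p" using pq(2) assms(2) by linarith
  with X pq(3) F_measurable_mono[OF X(2) pq(1)] have "elem_ok M F (X, (p, q, c, d))"
    unfolding elem_ok_def prod.case by blast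
  then show ?case using IH pq by (simp add: e strip_Cons elems_from_Cons flip: p_def q_def)
qed simp

lemma simple_int_strip_add:
  assumes "elems_from 0 es" "0 \<le> r'" "r' \<le> r"
  shows "simple_int W (strip 0 r es) \<omega> = simple_int W (strip 0 r' es) \<omega> + simple_int W (strip r' r es) \<omega>"
  using assms(1)
proof (induction es)
  case (Cons e es)
  obtain X a b c d where e: "e = (X, (a, b, c, d))" by (cases e) auto
  with Cons have ab: "0 \<le> a" "a \<le> b" by (auto simp: elems_from_Cons elem_ok_def)
  have "W (max (max a 0) (min b r)) x \<omega> - W (max a 0) x \<omega> = (W (max (max a 0) (min b r')) x \<omega> - W (max a 0) x \<omega>)
     + (W (max (max a r') (min b r)) x \<omega> - W (max a r') x \<omega>)" for x
    using ab assms(2,3) by (cases "b \<le> r'"; cases "a \<le> r'"; cases "b \<le> r"; cases "a \<le> r") (auto simp: max_def min_def)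
  from this[of c] this[of d]
  have "rect_incr W (max a 0, max (max a 0) (min b r), c, d) \<omega> = rect_incr W (max a 0, max (max a 0) (min b r'), c, d) \<omega>
     + rect_incr W (max a r', max (max a r') (min b r), c, d) \<omega>"
    by (simp add: rect_incr_def)
  then show ?case using Cons by (simp add: e strip_Cons simple_int_Cons elems_from_Cons distrib_left)
qed simp

lemma simple_int_strip_0: "elems_from 0 es \<Longrightarrow> simple_int W (strip 0 0 es) \<omega> = 0"
proof (induction es)
  case (Cons e es)
  obtain X a b c d where e: "e = (X, (a, b, c, d))" by (cases e) auto
  with Cons have ab: "0 \<le> a" "a \<le> b" by (auto simp: elems_from_Cons elem_ok_def)
  then show ?case using Cons by (simp add: e strip_Cons simple_int_Cons elems_from_Cons)
qed simp

lemma simple_int_strip_measurable: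
  assumes "elems_from 0 es" "0 \<le> r" shows "simple_int W (strip 0 r es) \<in> borel_measurable (F r)"
  using assms(1)
proof (induction es)
  case Nil
  then show ?case by (simp add: simple_int_def[abs_def])
next
  case (Cons e es)
  obtain X a b c d where e: "e = (X, (a, b, c, d))" by (cases e) auto
  with Cons have ok: "elem_ok M F (X, (a, b, c, d))" by (simp add: elems_from_Cons)
  then obtain B where X: "0 \<le> a" "a \<le> b" "X \<in> borel_measurable (F a)" by (rule elem_okE) blast
  have "(\<lambda>\<omega>. X \<omega> * rect_incr W (a, max a (min b r), c, d) \<omega>) \<in> borel_measurable (F r)"
  proof (cases "a \<le> r")
    case True
    then have "max a (min b r) = min b r" using X by auto
    then show ?thesis using True X
      by (intro borel_measurable_times F_measurable_mono[OF X(3)] F_measurable_mono[OF rect_incr_measurable_F]) auto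
  next
    case False
    then have "max a (min b r) = a" by auto
    then show ?thesis by simp
  qed
  moreover have "simple_int W (strip 0 r es) \<in> borel_measurable (F r)" using Cons by (simp add: e elems_from_Cons)
  ultimately have "(\<lambda>\<omega>. X \<omega> * rect_incr W (a, max a (min b r), c, d) \<omega> + simple_int W (strip 0 r es) \<omega>) \<in> borel_measurable (F r)"
    by (rule borel_measurable_add)
  then show ?case using X by (simp add: e strip_Cons simple_int_Cons[abs_def])
qed

lemma strip_eventually_id:
  assumes "elems_from 0 es" shows "\<exists>T\<ge>0. strip 0 T es = es"
proof -
  have "\<exists>T\<ge>0. \<forall>t\<ge>T. strip 0 t es = es" using assms
  proof (induction es)
    case (Cons e es)
    obtain X a b c d where e: "e = (X, (a, b, c, d))" by (cases e) auto
    with Cons obtain T where "T \<ge> 0" "\<forall>t\<ge>T. strip 0 t es = es" "0 \<le> a" "a \<le> b"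
      by (auto simp: elems_from_Cons elem_ok_def)
    then show ?case by (intro exI[of _ "max T b"]) (auto simp: e strip_Cons)
  qed auto
  then show ?thesis by blast
qed

text \<open>A Gaussian increment over a rectangle of area v has fourth moment 3 v^2, and v is at
  most proportional to the length of the time slab. The constant depends on the whole list; that is
  harmless, since the bound serves only to discard an error as the mesh tends to zero.\<close>

lemma simple_int_strip_fourth_moment:
  assumes "elems_from 0 es"
  shows "\<exists>C\<ge>0. \<forall>r' r. 0 \<le> r' \<longrightarrow> r' \<le> r \<longrightarrow> integrable M (\<lambda>\<omega>. simple_int W (strip r' r es) \<omega> ^ 4) \<and>
     expectation (\<lambda>\<omega>. simple_int W (strip r' r es) \<omega> ^ 4) \<le> C * (r - r')\<^sup>2"
  using assms
proof (induction es)
  case Nil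
  then show ?case by (auto intro!: exI[of _ 0])
next
  case (Cons e es)
  obtain X a b c d where e: "e = (X, (a, b, c, d))" by (cases e) auto
  with Cons have ok: "elem_ok M F (X, (a, b, c, d))" by (simp_all add: elems_from_Cons)
  obtain B where X: "0 \<le> a" "a \<le> b" "c \<le> d" "X \<in> borel_measurable (F a)" "X \<in> borel_measurable M"
    "\<And>\<omega>. \<omega> \<in> space M \<Longrightarrow> \<bar>X \<omega>\<bar> \<le> B"
    using ok(1) by (rule elem_okE) blast
  from Cons obtain C where C: "C \<ge> 0" "\<And>r' r. 0 \<le> r' \<Longrightarrow> r' \<le> r \<Longrightarrow> integrable M (\<lambda>\<omega>. simple_int W (strip r' r es) \<omega> ^ 4)"
     "\<And>r' r. 0 \<le> r' \<Longrightarrow> r' \<le> r \<Longrightarrow> expectation (\<lambda>\<omega>. simple_int W (strip r' r es) \<omega> ^ 4) \<le> C * (r - r')\<^sup>2"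
    by (auto simp: e elems_from_Cons)
  define C' where "C' = 8 * (B^4 * (3 * (d - c)\<^sup>2)) + 8 * C"
  have "integrable M (\<lambda>\<omega>. simple_int W (strip r' r (e # es)) \<omega> ^ 4) \<and>
     expectation (\<lambda>\<omega>. simple_int W (strip r' r (e # es)) \<omega> ^ 4) \<le> C' * (r - r')\<^sup>2" if r: "0 \<le> r'" "r' \<le> r" for r r'
  proof -
    define p where "p = max a r'"
    define q where "q = max p (min b r)"
    have pq: "0 \<le> p" "p \<le> q" "q - p \<le> r - r'" "a \<le> p" using r X(1,2) by (auto simp: p_def q_def max_def min_def)
    let ?D = "incr p q c d" and ?J = "simple_int W (strip r' r es)"
    have X4: "\<bar>X \<omega> ^ 4\<bar> \<le> B^4" if "\<omega> \<in> space M" for \<omega>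
      unfolding power_abs using X(6)[OF that] by (intro power_mono) auto
    have X4i: "integrable M (\<lambda>\<omega>. X \<omega> ^ 4)"
      using X(5) X4 by (intro integrable_const_bound[where B="B^4"]) auto
    have X4m: "(\<lambda>\<omega>. X \<omega> ^ 4) \<in> borel_measurable (F p)"
      using F_measurable_mono[OF X(4) pq(4)] by simp
    have hb: "has_bochner_integral M (\<lambda>\<omega>. X \<omega> ^ 4 * ?D \<omega> ^ 4) (expectation (\<lambda>\<omega>. X \<omega> ^ 4) * (3 * ((q - p) * (d - c))\<^sup>2))"
      using rect_incr_cond_moment[OF pq(1,2) X(3) X4m X4i, of 4] rect_incr_moments(3)[OF pq(1,2) X(3)] by simp
    have E4: "expectation (\<lambda>\<omega>. X \<omega> ^ 4) \<le> B^4"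
      using integral_mono[OF X4i integrable_const[of "B^4"]] X4 by (force simp: prob_space)
    have pqd: "((q - p) * (d - c))\<^sup>2 \<le> (d - c)\<^sup>2 * (r - r')\<^sup>2"
      unfolding power_mult_distrib mult.commute[of "(d - c)\<^sup>2"]
      using pq by (intro mult_right_mono power_mono) auto
    have bound: "expectation (\<lambda>\<omega>. X \<omega> ^ 4 * ?D \<omega> ^ 4) \<le> B^4 * (3 * ((d - c)\<^sup>2 * (r - r')\<^sup>2))"
      unfolding has_bochner_integral_integral_eq[OF hb]
      using E4 pqd by (intro mult_mono) auto
    have le: "(x + y)^4 \<le> 8 * x^4 + 8 * y^4" for x y :: real
    proof -
      have "(x + y)\<^sup>2 \<le> 2 * (x\<^sup>2 + y\<^sup>2)" using sum_squares_bound[of x y] by (simp add: power2_sum)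
      then have "((x + y)\<^sup>2)\<^sup>2 \<le> (2 * (x\<^sup>2 + y\<^sup>2))\<^sup>2" by (rule power_mono) simp
      also have "\<dots> \<le> 8 * x^4 + 8 * y^4"
        using sum_squares_bound[of "x\<^sup>2" "y\<^sup>2"] by (simp add: power2_sum power_mult_distrib)
      finally show ?thesis by simp
    qed
    have [measurable]: "?J \<in> borel_measurable M" "X \<in> borel_measurable M" "?D \<in> borel_measurable M"
      using simple_int_measurable[OF elems_from_strip[OF _ r(1)]] Cons.prems X(5) rect_incr_measurable[OF pq(1,2)]
      by (auto simp: e elems_from_Cons)
    have int: "integrable M (\<lambda>\<omega>. 8 * (X \<omega> ^ 4 * ?D \<omega> ^ 4) + 8 * ?J \<omega> ^ 4)"
      using hb C(2)[OF r] by (auto simp: has_bochner_integral_iff)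
    have eq: "simple_int W (strip r' r (e # es)) \<omega> = X \<omega> * ?D \<omega> + ?J \<omega>" for \<omega>
      by (simp add: e strip_Cons simple_int_Cons p_def q_def)
    have pt: "simple_int W (strip r' r (e # es)) \<omega> ^ 4 \<le> 8 * (X \<omega> ^ 4 * ?D \<omega> ^ 4) + 8 * ?J \<omega> ^ 4" for \<omega>
      using le[of "X \<omega> * ?D \<omega>" "?J \<omega>"] by (simp add: eq power_mult_distrib)
    have int': "integrable M (\<lambda>\<omega>. simple_int W (strip r' r (e # es)) \<omega> ^ 4)"
    proof (rule Bochner_Integration.integrable_bound[OF int])
      show "(\<lambda>\<omega>. simple_int W (strip r' r (e # es)) \<omega> ^ 4) \<in> borel_measurable M" unfolding eq by measurable
      show "AE \<omega> in M. norm (simple_int W (strip r' r (e # es)) \<omega> ^ 4) \<le> norm (8 * (X \<omega> ^ 4 * ?D \<omega> ^ 4) + 8 * ?J \<omega> ^ 4)"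
        using pt by (intro AE_I2) (simp add: abs_le_iff order_trans[OF pt])
    qed
    have "expectation (\<lambda>\<omega>. simple_int W (strip r' r (e # es)) \<omega> ^ 4)
       \<le> expectation (\<lambda>\<omega>. 8 * (X \<omega> ^ 4 * ?D \<omega> ^ 4) + 8 * ?J \<omega> ^ 4)"
      by (rule integral_mono[OF int' int pt])
    also have "\<dots> = 8 * expectation (\<lambda>\<omega>. X \<omega> ^ 4 * ?D \<omega> ^ 4) + 8 * expectation (\<lambda>\<omega>. ?J \<omega> ^ 4)"
      using hb C(2)[OF r] by (simp add: has_bochner_integral_iff)
    also have "\<dots> \<le> 8 * (B^4 * (3 * ((d - c)\<^sup>2 * (r - r')\<^sup>2))) + 8 * (C * (r - r')\<^sup>2)"
      using bound C(3)[OF r] by linarith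
    also have "\<dots> = C' * (r - r')\<^sup>2" by (simp add: C'_def algebra_simps)
    finally show ?thesis using int' by blast
  qed
  moreover have "0 \<le> C'" using C(1) by (simp add: C'_def)
  ultimately show ?case by blast
qed

end

section \<open>Moment bounds for stochastic integrals\<close>

text \<open>Half of \<open>S\<close> can be moved to the left only if \<open>S\<close> is finite.
  Both applications obtain this finiteness from the truncation, by way of second moments.\<close>

lemma ennreal_absorb_half:
  fixes S x a :: ennreal
  assumes "S \<le> a * S + x" "a \<le> ennreal (1/2)" "S < top"
  shows "S \<le> 2 * x"
proof (cases x)
  case (real x')
  obtain s where s: "S = ennreal s" "0 \<le> s" using assms(3) by (cases S) auto
  have "S \<le> ennreal (1/2) * S + x"
    using assms(1,2) by (meson add_right_mono mult_right_mono order_trans zero_le)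
  also have "\<dots> = ennreal (s / 2 + x')"
  proof -
    have "ennreal (s / 2 + x') = ennreal (1/2 * s) + ennreal x'" using s real by simp
    also have "ennreal (1/2 * s) = ennreal (1/2) * ennreal s" using s by (intro ennreal_mult) auto
    finally show ?thesis using s real by simp
  qed
  finally have "s \<le> s / 2 + x'" using s real by (simp add: ennreal_le_iff del: ennreal_plus)
  then have "ennreal s \<le> ennreal (2 * x')" by (intro ennreal_leI) simp
  also have "\<dots> = 2 * x" using real by (simp add: ennreal_mult)
  finally show ?thesis using s by simp
qed (simp add: ennreal_mult_top)

lemma ennreal_le_lincomb:
  assumes "x \<le> a * y + b * z" "0 \<le> a" "0 \<le> y" "0 \<le> b" "0 \<le> z"
  shows "ennreal x \<le> ennreal a * ennreal y + ennreal b * ennreal z"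
  using ennreal_leI[OF assms(1)] assms(2-) by (simp add: ennreal_mult)

lemma simple_fun_neg:
  assumes "\<forall>e\<in>set es. elem_ok M F e" "s \<le> 0" shows "simple_fun es \<omega> s y = 0"
  using assms(1)
proof (induction es)
  case (Cons e es)
  obtain X a b c d where e: "e = (X, (a, b, c, d))" by (cases e) auto
  with Cons assms(2) show ?case by (simp add: simple_fun_Cons elem_ok_def)
qed simp

context white_noise
begin

abbreviation exp_trunc :: "nat \<Rightarrow> real \<Rightarrow> ('a \<Rightarrow> real) \<Rightarrow> ennreal" where
  "exp_trunc k K X \<equiv> (\<integral>\<^sup>+ \<omega>. ennreal (trunc_pow k K (X \<omega>)) \<partial>M)"

text \<open>A discrete Ito formula: the first-order term is a martingale increment and the fourth-order
  error is of size \<open>(r - r')^2\<close>, hence negligible on fine grids.\<close>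

lemma trunc_pow_step:
  assumes k: "1 \<le> k" and K: "0 < K" and es: "elems_from 0 es"
  shows "\<exists>C\<ge>0. \<forall>r' r. 0 \<le> r' \<longrightarrow> r' \<le> r \<longrightarrow>
    exp_trunc k K (simple_int W (strip 0 r es)) \<le>
    exp_trunc k K (simple_int W (strip 0 r' es))
    + ennreal (4^(2*k+2)) * (\<integral>\<^sup>+ (\<omega>, s, y). ennreal (trunc_weight k K (simple_int W (strip 0 r' es) \<omega>) *
        (indicator {r'<..r} s * simple_fun es \<omega> s y)\<^sup>2) \<partial>MP)
    + ennreal (C * (r - r')\<^sup>2)"
proof -
  obtain C where C: "C \<ge> 0" "\<And>r' r. 0 \<le> r' \<Longrightarrow> r' \<le> r \<Longrightarrow> integrable M (\<lambda>\<omega>. simple_int W (strip r' r es) \<omega> ^ 4)"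
     "\<And>r' r. 0 \<le> r' \<Longrightarrow> r' \<le> r \<Longrightarrow> expectation (\<lambda>\<omega>. simple_int W (strip r' r es) \<omega> ^ 4) \<le> C * (r - r')\<^sup>2"
    using simple_int_strip_fourth_moment[OF es] by blast
  define c1 where "c1 = 4^(k+1) * max 1 K"
  have c1: "0 \<le> c1" by (simp add: c1_def)
  have "exp_trunc k K (simple_int W (strip 0 r es)) \<le>
    exp_trunc k K (simple_int W (strip 0 r' es))
    + ennreal (4^(2*k+2)) * (\<integral>\<^sup>+ (\<omega>, s, y). ennreal (trunc_weight k K (simple_int W (strip 0 r' es) \<omega>) *
        (indicator {r'<..r} s * simple_fun es \<omega> s y)\<^sup>2) \<partial>MP)
    + ennreal ((c1 * C) * (r - r')\<^sup>2)" if r: "0 \<le> r'" "r' \<le> r" for r' r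
  proof -
    define Y where "Y = (\<lambda>t. simple_int W (strip 0 t es))"
    define D where "D = simple_int W (strip r' r es)"
    have r0: "0 \<le> r" using r by simp
    have ok: "elems_from 0 (strip 0 t es)" for t using elems_from_strip[OF es, of 0] by simp
    have okD: "elems_from r' (strip r' r es)" by (rule elems_from_strip[OF es r(1)])
    have YD: "Y r \<omega> = Y r' \<omega> + D \<omega>" for \<omega>
      unfolding Y_def D_def by (rule simple_int_strip_add[OF es r])
    have [measurable]: "Y t \<in> borel_measurable M" for t unfolding Y_def by (rule simple_int_measurable[OF ok])
    have [measurable]: "D \<in> borel_measurable M" unfolding D_def by (rule simple_int_measurable[OF okD])
    have YF: "Y r' \<in> borel_measurable (F r')" unfolding Y_def by (rule simple_int_strip_measurable[OF es r(1)])
    have Y2: "integrable M (\<lambda>\<omega>. (Y t \<omega>)\<^sup>2)" for t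
      using simple_isometry(1)[of "\<lambda>_. 1" 0 1 "strip 0 t es"] ok by (simp add: Y_def)
    have Y1: "integrable M (Y t)" for t
      by (rule square_integrable_imp_integrable) (use Y2 in auto)
    \<comment> \<open>At most quadratic growth of the truncated power, and linear growth of its
      slope below, give integrability from second moments alone.\<close>
    have phiI: "integrable M (\<lambda>\<omega>. trunc_pow k K (Y t \<omega>))" for t
      using trunc_pow_nonneg[OF K] trunc_pow_le_square[OF K] K
      by (intro Bochner_Integration.integrable_bound[OF integrable_mult_right[OF Y2[of t], of K]]) auto
    have slopeI: "integrable M (\<lambda>\<omega>. trunc_slope k K (Y r' \<omega>))"
    proof (rule Bochner_Integration.integrable_bound)
      show "integrable M (\<lambda>\<omega>. real (2*k+2) * K * Y r' \<omega>)" using Y1 by simp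
      show "AE \<omega> in M. norm (trunc_slope k K (Y r' \<omega>)) \<le> norm (real (2*k+2) * K * Y r' \<omega>)"
        using abs_trunc_slope_le[OF K] K by (intro AE_I2) (simp add: abs_mult)
    qed measurable
    have slopeF: "(\<lambda>\<omega>. trunc_slope k K (Y r' \<omega>)) \<in> borel_measurable (F r')"
      using YF by measurable
    have weightF: "(\<lambda>\<omega>. trunc_weight k K (Y r' \<omega>)) \<in> borel_measurable (F r')"
      using YF by measurable
    have m: "has_bochner_integral M (\<lambda>\<omega>. trunc_slope k K (Y r' \<omega>) * D \<omega>) 0"
      unfolding D_def by (rule simple_int_martingale[OF slopeF slopeI okD])
    \<comment> \<open>The weighted isometry with the weight frozen at time \<open>r'\<close> turns
      the second-order term into a space-time integral of the elementary integrand over the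
      slab.\<close>
    note iso = simple_isometry[OF weightF trunc_weight_nonneg[OF K] trunc_weight_le[OF K] okD, folded D_def]
    have D4: "integrable M (\<lambda>\<omega>. D \<omega> ^ 4)" "expectation (\<lambda>\<omega>. D \<omega> ^ 4) \<le> C * (r - r')\<^sup>2"
      unfolding D_def using C(2,3)[OF r] by auto
    have "expectation (\<lambda>\<omega>. trunc_pow k K (Y r \<omega>)) \<le> expectation (\<lambda>\<omega>. trunc_pow k K (Y r' \<omega>) + trunc_slope k K (Y r' \<omega>) * D \<omega>
        + 4^(2*k+2) * (trunc_weight k K (Y r' \<omega>) * (D \<omega>)\<^sup>2) + c1 * D \<omega> ^ 4)"
    proof (rule integral_mono)
      show "integrable M (\<lambda>\<omega>. trunc_pow k K (Y r' \<omega>) + trunc_slope k K (Y r' \<omega>) * D \<omega>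
        + 4^(2*k+2) * (trunc_weight k K (Y r' \<omega>) * (D \<omega>)\<^sup>2) + c1 * D \<omega> ^ 4)"
        using m by (intro Bochner_Integration.integrable_add phiI integrable_mult_right iso(1) D4(1)) (auto simp: has_bochner_integral_iff)
      show "trunc_pow k K (Y r \<omega>) \<le> trunc_pow k K (Y r' \<omega>) + trunc_slope k K (Y r' \<omega>) * D \<omega>
        + 4^(2*k+2) * (trunc_weight k K (Y r' \<omega>) * (D \<omega>)\<^sup>2) + c1 * D \<omega> ^ 4" for \<omega>
        using trunc_pow_expand[OF K k, of "Y r' \<omega>" "D \<omega>"] unfolding YD c1_def by (simp only: mult.assoc)
    qed (rule phiI)
    also have "\<dots> = expectation (\<lambda>\<omega>. trunc_pow k K (Y r' \<omega>))
        + 4^(2*k+2) * expectation (\<lambda>\<omega>. trunc_weight k K (Y r' \<omega>) * (D \<omega>)\<^sup>2) + c1 * expectation (\<lambda>\<omega>. D \<omega> ^ 4)"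
      using m iso(1) D4(1) phiI[of r'] by (simp add: has_bochner_integral_iff)
    also have "\<dots> \<le> expectation (\<lambda>\<omega>. trunc_pow k K (Y r' \<omega>))
        + 4^(2*k+2) * expectation (\<lambda>\<omega>. trunc_weight k K (Y r' \<omega>) * (D \<omega>)\<^sup>2) + c1 * (C * (r - r')\<^sup>2)"
      by (intro add_left_mono mult_left_mono D4(2) c1)
    finally have "ennreal (expectation (\<lambda>\<omega>. trunc_pow k K (Y r \<omega>))) \<le> ennreal (expectation (\<lambda>\<omega>. trunc_pow k K (Y r' \<omega>))
        + 4^(2*k+2) * expectation (\<lambda>\<omega>. trunc_weight k K (Y r' \<omega>) * (D \<omega>)\<^sup>2) + c1 * (C * (r - r')\<^sup>2))"
      by (rule ennreal_leI)
    also have "\<dots> = ennreal (expectation (\<lambda>\<omega>. trunc_pow k K (Y r' \<omega>)))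
        + ennreal (4^(2*k+2)) * ennreal (expectation (\<lambda>\<omega>. trunc_weight k K (Y r' \<omega>) * (D \<omega>)\<^sup>2)) + ennreal (c1 * (C * (r - r')\<^sup>2))"
    proof -
      have "0 \<le> expectation (\<lambda>\<omega>. trunc_pow k K (Y r' \<omega>))" "0 \<le> expectation (\<lambda>\<omega>. trunc_weight k K (Y r' \<omega>) * (D \<omega>)\<^sup>2)"
        using trunc_pow_nonneg[OF K] trunc_weight_nonneg[OF K] by (auto intro!: integral_nonneg)
      moreover have "0 \<le> c1 * (C * (r - r')\<^sup>2)" using C(1) c1 by simp
      moreover have "ennreal (a + b * c + d) = ennreal a + ennreal b * ennreal c + ennreal d"
        if "0 \<le> a" "0 \<le> b" "0 \<le> c" "0 \<le> d" for a b c d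
        using that by (simp add: ennreal_mult)
      ultimately show ?thesis by simp
    qed
    finally have "exp_trunc k K (Y r) \<le> exp_trunc k K (Y r')
      + ennreal (4^(2*k+2)) * (\<integral>\<^sup>+ (\<omega>, s, y). ennreal (trunc_weight k K (Y r' \<omega>) * (simple_fun (strip r' r es) \<omega> s y)\<^sup>2) \<partial>MP)
      + ennreal (c1 * (C * (r - r')\<^sup>2))"
      using phiI iso(1) trunc_pow_nonneg[OF K] trunc_weight_nonneg[OF K]
      by (simp add: nn_integral_eq_integral flip: iso(2))
    then show ?thesis unfolding Y_def simple_fun_strip by (simp only: mult.assoc)
  qed
  moreover have "0 \<le> c1 * C" using c1 C(1) by simp
  ultimately show ?thesis by blast
qed

text \<open>The one-step inequality is summed over a uniform grid and the mesh is sent to zero. On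
  \<open>Q\<close> the second-order term is split by \<open>trunc_weight_mult_square\<close>: one
  share is a small multiple of the current moment and is absorbed, the other stays. Off
  \<open>Q\<close>, where \<delta> is not assumed to have a small integral, the weight is simply
  bounded by \<open>K\<close>. In the application the true integrand vanishes off \<open>Q\<close>,
  so that part is pure approximation error.\<close>

lemma simple_trunc_bound:
  fixes Q :: "(real \<times> real) set" and \<delta> :: "real \<times> real \<Rightarrow> real"
  assumes k: "1 \<le> k" and K: "0 < K" and es: "elems_from 0 es"
    and Q [measurable]: "Q \<in> sets lplane" and \<delta> [measurable]: "\<delta> \<in> borel_measurable lplane"
    and \<delta>01: "\<And>z. 0 < \<delta> z" "\<And>z. \<delta> z \<le> 1"
    and small: "ennreal (4^(2*k+2)) * (\<integral>\<^sup>+ z. indicator Q z * ennreal (\<delta> z) \<partial>lplane) \<le> ennreal (1/2)"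
  shows "exp_trunc k K (simple_int W es) \<le>
    2 * (ennreal (4^(2*k+2)) * (\<integral>\<^sup>+ (\<omega>, s, y). (indicator Q (s, y) * ennreal ((1 / \<delta> (s, y))^k * trunc_pow k K (simple_fun es \<omega> s y))
        + indicator (- Q) (s, y) * ennreal (K * (simple_fun es \<omega> s y)\<^sup>2)) \<partial>MP))"
proof -
  define c where "c = ennreal (4^(2*k+2))"
  define Y where "Y = (\<lambda>t. simple_int W (strip 0 t es))"
  define e where "e = (\<lambda>t. \<integral>\<^sup>+ \<omega>. ennreal (trunc_pow k K (Y t \<omega>)) \<partial>M)"
  define h where "h = (\<lambda>(\<omega>, s, y). indicator Q (s, y) * ennreal ((1 / \<delta> (s, y))^k * trunc_pow k K (simple_fun es \<omega> s y))
        + indicator (- Q) (s, y) * ennreal (K * (simple_fun es \<omega> s y)\<^sup>2))"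
  \<comment> \<open>\<open>A\<close> is the mass of \<delta> on a time slab, the coefficient of the
    moment to be absorbed; \<open>B\<close> is the forcing. Both are additive in time, so the steps
    of the grid telescope.\<close>
  define A where "A = (\<lambda>r' r. \<integral>\<^sup>+ z. indicator {r'<..r} (fst z) * (indicator Q z * ennreal (\<delta> z)) \<partial>lplane)"
  define B where "B = (\<lambda>r' r. \<integral>\<^sup>+ z. indicator {r'<..r} (fst (snd z)) * h z \<partial>MP)"
  have ok: "elems_from 0 (strip 0 t es)" for t using elems_from_strip[OF es, of 0] by simp
  have Ym [measurable]: "Y t \<in> borel_measurable M" for t unfolding Y_def by (rule simple_int_measurable[OF ok])
  have sfm [measurable]: "(\<lambda>z. simple_fun es (fst z) (fst (snd z)) (snd (snd z))) \<in> borel_measurable MP"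
    using simple_fun_measurable[OF es] by (simp add: case_prod_unfold)
  have hm [measurable]: "h \<in> borel_measurable MP"
    unfolding h_def case_prod_unfold by measurable
  obtain C where C: "C \<ge> 0" and step: "\<And>r' r. 0 \<le> r' \<Longrightarrow> r' \<le> r \<Longrightarrow>
    e r \<le> e r' + c * (\<integral>\<^sup>+ (\<omega>, s, y). ennreal (trunc_weight k K (Y r' \<omega>) *
        (indicator {r'<..r} s * simple_fun es \<omega> s y)\<^sup>2) \<partial>MP) + ennreal (C * (r - r')\<^sup>2)"
    using trunc_pow_step[OF k K es] unfolding e_def Y_def c_def by blast
  have step': "e r \<le> e r' + c * (A r' r * e r' + B r' r) + ennreal (C * (r - r')\<^sup>2)" if r: "0 \<le> r'" "r' \<le> r" for r' r
  proof -
    have "(\<integral>\<^sup>+ (\<omega>, s, y). ennreal (trunc_weight k K (Y r' \<omega>) * (indicator {r'<..r} s * simple_fun es \<omega> s y)\<^sup>2) \<partial>MP)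
      \<le> (\<integral>\<^sup>+ z. ennreal (trunc_pow k K (Y r' (fst z))) * (indicator {r'<..r} (fst (snd z)) * (indicator Q (snd z) * ennreal (\<delta> (snd z))))
          + indicator {r'<..r} (fst (snd z)) * h z \<partial>MP)"
    proof (rule nn_integral_mono, clarsimp)
      fix \<omega> s y
      let ?g = "simple_fun es \<omega> s y" and ?q = "trunc_weight k K (Y r' \<omega>)" and ?\<phi> = "trunc_pow k K"
      show "ennreal (?q * (indicator {r'<..r} s * ?g)\<^sup>2) \<le> ennreal (?\<phi> (Y r' \<omega>)) * (indicator {r'<..r} s *
          (indicator Q (s, y) * ennreal (\<delta> (s, y)))) + indicator {r'<..r} s * h (\<omega>, s, y)"
      proof (cases "s \<in> {r'<..r}")
        case s: True
        show ?thesis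
        proof (cases "(s, y) \<in> Q")
          case True
          have "?q * ?g\<^sup>2 \<le> \<delta> (s, y) * ?\<phi> (Y r' \<omega>) + 1 * ((1 / \<delta> (s, y))^k * ?\<phi> ?g)"
            using trunc_weight_mult_square[OF K \<delta>01, where k = k] by simp
          then have "ennreal (?q * ?g\<^sup>2) \<le> ennreal (\<delta> (s, y)) * ennreal (?\<phi> (Y r' \<omega>)) + ennreal 1 * ennreal ((1 / \<delta> (s, y))^k * ?\<phi> ?g)"
            using trunc_pow_nonneg[OF K] \<delta>01(1)[of "(s, y)"] by (intro ennreal_le_lincomb) auto
          then show ?thesis using True s by (simp add: h_def mult.commute)
        next
          case False
          have "ennreal (?q * ?g\<^sup>2) \<le> ennreal (K * ?g\<^sup>2)"
            by (intro ennreal_leI mult_right_mono trunc_weight_le K) simp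
          then show ?thesis using False s by (simp add: h_def)
        qed
      qed simp
    qed
    also have "\<dots> = (\<integral>\<^sup>+ z. ennreal (trunc_pow k K (Y r' (fst z))) * (indicator {r'<..r} (fst (snd z)) * (indicator Q (snd z) * ennreal (\<delta> (snd z)))) \<partial>MP)
        + B r' r"
      unfolding B_def by (rule nn_integral_add) measurable
    also have "(\<integral>\<^sup>+ z. ennreal (trunc_pow k K (Y r' (fst z))) * (indicator {r'<..r} (fst (snd z)) * (indicator Q (snd z) * ennreal (\<delta> (snd z)))) \<partial>MP)
       = (\<integral>\<^sup>+ \<omega>. \<integral>\<^sup>+ z. ennreal (trunc_pow k K (Y r' \<omega>)) * (indicator {r'<..r} (fst z) * (indicator Q z * ennreal (\<delta> z))) \<partial>lplane \<partial>M)"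
      by (subst sigma_finite_measure.nn_integral_fst[OF sigma_finite_plane, symmetric]) auto
    also have "\<dots> = (\<integral>\<^sup>+ \<omega>. ennreal (trunc_pow k K (Y r' \<omega>)) * A r' r \<partial>M)"
      unfolding A_def by (intro nn_integral_cong nn_integral_cmult) measurable
    also have "\<dots> = A r' r * e r'"
      unfolding e_def by (subst nn_integral_multc) (auto simp: mult.commute)
    finally have "c * (\<integral>\<^sup>+ (\<omega>, s, y). ennreal (trunc_weight k K (Y r' \<omega>) *
        (indicator {r'<..r} s * simple_fun es \<omega> s y)\<^sup>2) \<partial>MP) \<le> c * (A r' r * e r' + B r' r)"
      by (intro mult_left_mono) auto
    then show ?thesis using step[OF r] by (meson add_left_mono add_right_mono order_trans)
  qed
  have Aadd: "A 0 r = A 0 r' + A r' r" and Badd: "B 0 r = B 0 r' + B r' r" if "0 \<le> r'" "r' \<le> r" for r' r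
  proof -
    have ind: "indicator {0<..r} s = (indicator {0<..r'} s + indicator {r'<..r} s :: ennreal)" for s
      using that by (auto simp: indicator_def)
    show "A 0 r = A 0 r' + A r' r" unfolding A_def ind distrib_right by (rule nn_integral_add) measurable
    show "B 0 r = B 0 r' + B r' r" unfolding B_def ind distrib_right by (rule nn_integral_add) measurable
  qed
  have e0: "e 0 = 0"
  proof -
    have "Y 0 \<omega> = 0" for \<omega> unfolding Y_def by (rule simple_int_strip_0[OF es])
    then show ?thesis by (simp add: e_def trunc_pow_def)
  qed
  have fin: "e r \<le> c * (A 0 r * S + B 0 r)" if r: "0 \<le> r" and S: "\<And>t. 0 \<le> t \<Longrightarrow> t \<le> r \<Longrightarrow> e t \<le> S" for r S
  proof -
    \<comment> \<open>Each of the \<open>Suc n\<close> steps of length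
      \<open>r / real (Suc n)\<close> contributes an error C times the square of its length, in
      total C r^2 / (n + 1).\<close>
    have grid: "e r \<le> c * (A 0 r * S + B 0 r) + ennreal (C * r\<^sup>2 / real (Suc n))" for n
    proof -
      define t where "t = (\<lambda>j. real j * (r / real (Suc n)))"
      have t: "0 \<le> t j" "t j \<le> t (Suc j)" "t (Suc j) - t j = r / real (Suc n)" for j
      proof -
        show d: "t (Suc j) - t j = r / real (Suc n)" by (simp add: t_def add_divide_distrib distrib_right)
        show "0 \<le> t j" using r by (simp add: t_def)
        have "0 \<le> r / real (Suc n)" using r by simp
        then show "t j \<le> t (Suc j)" using d by linarith
      qed
      have tr: "t j \<le> r" if "j \<le> Suc n" for j
        using that r mult_right_mono[of "real j" "real (Suc n)" r] by (simp add: t_def field_simps)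
      have "e (t j) \<le> c * (A 0 (t j) * S + B 0 (t j)) + ennreal (real j * (C * (r / real (Suc n))\<^sup>2))" if "j \<le> Suc n" for j
        using that
      proof (induction j)
        case 0
        have "t 0 = 0" by (simp add: t_def)
        then show ?case by (simp add: e0)
      next
        case (Suc j)
        define w where "w = C * (r / real (Suc n))\<^sup>2"
        have w: "0 \<le> w" using C by (simp add: w_def)
        have IH: "e (t j) \<le> c * (A 0 (t j) * S + B 0 (t j)) + ennreal (real j * w)"
          using Suc by (simp add: w_def)
        have "e (t j) \<le> S" using Suc.prems by (intro S t tr) simp
        then have AS: "A (t j) (t (Suc j)) * e (t j) \<le> A (t j) (t (Suc j)) * S" by (intro mult_left_mono) auto
        have "e (t (Suc j)) \<le> e (t j) + c * (A (t j) (t (Suc j)) * e (t j) + B (t j) (t (Suc j))) + ennreal w"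
          using step'[OF t(1,2)[of j]] by (simp add: t(3) w_def)
        also have "\<dots> \<le> (c * (A 0 (t j) * S + B 0 (t j)) + ennreal (real j * w))
            + c * (A (t j) (t (Suc j)) * S + B (t j) (t (Suc j))) + ennreal w"
          by (intro add_mono IH mult_left_mono AS order_refl) auto
        also have "\<dots> = c * (A 0 (t (Suc j)) * S + B 0 (t (Suc j))) + (ennreal (real j * w) + ennreal w)"
          unfolding Aadd[OF t(1,2)[of j]] Badd[OF t(1,2)[of j]] by (simp add: algebra_simps)
        also have "ennreal (real j * w) + ennreal w = ennreal (real (Suc j) * w)"
          using w by (subst ennreal_plus[symmetric]) (auto simp: algebra_simps)
        finally show ?case by (simp add: w_def)
      qed
      from this[of "Suc n"] have "e (t (Suc n)) \<le> c * (A 0 (t (Suc n)) * S + B 0 (t (Suc n))) + ennreal (real (Suc n) * (C * (r / real (Suc n))\<^sup>2))"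
        by simp
      moreover have "t (Suc n) = r" by (simp add: t_def)
      moreover have "real (Suc n) * (C * (r / real (Suc n))\<^sup>2) = C * r\<^sup>2 / real (Suc n)"
        by (simp add: power2_eq_square divide_simps)
      ultimately show ?thesis by simp
    qed
    have "(\<lambda>n. C * r\<^sup>2 / real (Suc n)) \<longlonglongrightarrow> 0"
      using LIMSEQ_Suc[OF lim_const_over_n[of "C * r\<^sup>2"]] by simp
    then have "(\<lambda>n. c * (A 0 r * S + B 0 r) + ennreal (C * r\<^sup>2 / real (Suc n))) \<longlonglongrightarrow> c * (A 0 r * S + B 0 r) + ennreal 0"
      by (intro tendsto_add tendsto_const tendsto_ennrealI)
    then show ?thesis using grid by (intro LIMSEQ_le_const) auto
  qed
  obtain T where T: "T \<ge> 0" "strip 0 T es = es" using strip_eventually_id[OF es] by blast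
  define S where "S = (SUP t\<in>{0..T}. e t)"
  have eS: "e t \<le> S" if "0 \<le> t" "t \<le> T" for t unfolding S_def using that by (intro SUP_upper) auto
  let ?G = "\<integral>\<^sup>+ (\<omega>, s, y). ennreal (1 * (simple_fun es \<omega> s y)\<^sup>2) \<partial>MP"
  \<comment> \<open>A crude bound through the isometry. It depends on \<open>K\<close> and on the
    list, but only makes the supremum finite and does not enter the conclusion.\<close>
  have "e t \<le> ennreal K * ?G" for t
  proof -
    have "e t \<le> (\<integral>\<^sup>+ \<omega>. ennreal K * ennreal ((Y t \<omega>)\<^sup>2) \<partial>M)"
      unfolding e_def using trunc_pow_le_square[OF K, of k] K
      by (intro nn_integral_mono) (simp add: ennreal_mult[symmetric] ennreal_leI)
    also have "\<dots> = ennreal K * (\<integral>\<^sup>+ \<omega>. ennreal (1 * (Y t \<omega>)\<^sup>2) \<partial>M)"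
      by (subst nn_integral_cmult) auto
    also have "(\<integral>\<^sup>+ \<omega>. ennreal (1 * (Y t \<omega>)\<^sup>2) \<partial>M) = (\<integral>\<^sup>+ (\<omega>, s, y). ennreal (1 * (simple_fun (strip 0 t es) \<omega> s y)\<^sup>2) \<partial>MP)"
      unfolding Y_def by (rule simple_isometry(2)[OF _ _ _ ok]) auto
    also have "\<dots> \<le> ?G"
      by (intro nn_integral_mono) (auto simp: simple_fun_strip indicator_def intro!: ennreal_leI)
    finally show ?thesis by (simp add: mult_left_mono)
  qed
  then have "S \<le> ennreal K * ?G"
    unfolding S_def by (intro SUP_least) auto
  also have "\<dots> < top"
  proof -
    have "integrable M (\<lambda>\<omega>. 1 * (simple_int W es \<omega>)\<^sup>2)"
      by (rule simple_isometry(1)[OF _ _ _ es]) auto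
    then have "(\<integral>\<^sup>+ \<omega>. ennreal (1 * (simple_int W es \<omega>)\<^sup>2) \<partial>M) < top"
      by (simp add: integrable_iff_bounded)
    moreover have "(\<integral>\<^sup>+ \<omega>. ennreal (1 * (simple_int W es \<omega>)\<^sup>2) \<partial>M) = ?G"
      by (rule simple_isometry(2)[OF _ _ _ es]) auto
    ultimately show ?thesis by (simp add: ennreal_mult_less_top)
  qed
  finally have Sfin: "S < top" .
  have A_le: "c * A 0 t \<le> ennreal (1/2)" for t
  proof -
    have "A 0 t \<le> (\<integral>\<^sup>+ z. indicator Q z * ennreal (\<delta> z) \<partial>lplane)"
      unfolding A_def by (intro nn_integral_mono) (auto simp: indicator_def)
    then have "c * A 0 t \<le> c * (\<integral>\<^sup>+ z. indicator Q z * ennreal (\<delta> z) \<partial>lplane)" by (intro mult_left_mono) auto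
    then show ?thesis using small unfolding c_def by (rule order_trans)
  qed
  have B_le: "B 0 t \<le> (\<integral>\<^sup>+ z. h z \<partial>MP)" for t
    unfolding B_def by (intro nn_integral_mono) (auto simp: indicator_def)
  have "S \<le> ennreal (1/2) * S + c * (\<integral>\<^sup>+ z. h z \<partial>MP)"
    unfolding S_def
  proof (rule SUP_least)
    fix t assume t: "t \<in> {0..T}"
    have "e t \<le> c * (A 0 t * S + B 0 t)" using t eS by (intro fin) auto
    also have "\<dots> = c * A 0 t * S + c * B 0 t" by (simp add: distrib_left mult.assoc)
    also have "\<dots> \<le> ennreal (1/2) * S + c * (\<integral>\<^sup>+ z. h z \<partial>MP)"
      by (intro add_mono mult_right_mono mult_left_mono A_le B_le) auto
    finally show "e t \<le> ennreal (1/2) * (SUP t\<in>{0..T}. e t) + c * (\<integral>\<^sup>+ z. h z \<partial>MP)" by (simp add: S_def)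
  qed
  then have "S \<le> 2 * (c * (\<integral>\<^sup>+ z. h z \<partial>MP))" by (rule ennreal_absorb_half) (use Sfin in auto)
  then have "e T \<le> 2 * (c * (\<integral>\<^sup>+ z. h z \<partial>MP))" using eS[of T] T(1) by simp
  then show ?thesis by (simp add: e_def Y_def T(2) c_def h_def)
qed

section \<open>Passage from elementary integrals to the stochastic integral\<close>

lemma walsh_approx:
  assumes "walsh_integral M F W f Y" and f0: "\<And>\<omega> s y. s < 0 \<Longrightarrow> f \<omega> s y = 0"
  shows "\<exists>es. (\<forall>n. elems_from 0 (es n)) \<and>
    (\<lambda>n. \<integral>\<^sup>+ (\<omega>, s, y). ennreal ((simple_fun (es n) \<omega> s y - f \<omega> s y)\<^sup>2) \<partial>MP) \<longlonglongrightarrow> 0 \<and>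
    (\<lambda>n. \<integral>\<^sup>+ \<omega>. ennreal ((simple_int W (es n) \<omega> - Y \<omega>)\<^sup>2) \<partial>M) \<longlonglongrightarrow> 0 \<and> Y \<in> borel_measurable M"
proof -
  from assms(1) obtain es where es: "Y \<in> borel_measurable M" "\<And>n. \<forall>e\<in>set (es n). elem_ok M F e"
    "(\<lambda>n. \<integral>\<^sup>+ (\<omega>, s, y). ennreal ((simple_fun (es n) \<omega> s y - f \<omega> s y)\<^sup>2) * indicator {0..} s \<partial>MP) \<longlonglongrightarrow> 0"
    "(\<lambda>n. \<integral>\<^sup>+ \<omega>. ennreal ((simple_int W (es n) \<omega> - Y \<omega>)\<^sup>2) \<partial>M) \<longlonglongrightarrow> 0"
    unfolding walsh_integral_def by blast
  have "ennreal ((simple_fun (es n) \<omega> s y - f \<omega> s y)\<^sup>2) * indicator {0..} s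
      = ennreal ((simple_fun (es n) \<omega> s y - f \<omega> s y)\<^sup>2)" for n \<omega> s y
    using simple_fun_neg[OF es(2)[of n], of s \<omega> y] f0[of s \<omega> y] by (auto simp: indicator_def)
  with es(3) have "(\<lambda>n. \<integral>\<^sup>+ (\<omega>, s, y). ennreal ((simple_fun (es n) \<omega> s y - f \<omega> s y)\<^sup>2) \<partial>MP) \<longlonglongrightarrow> 0"
    by simp
  with es(1,2,4) show ?thesis by (intro exI[of _ es] conjI allI) (simp_all add: elems_from_0)
qed

text \<open>In the passage to the limit, constant factors are given away freely, which avoids any
  continuity or Minkowski argument for the truncated powers.\<close>

lemma walsh_trunc_bound:
  fixes Q :: "(real \<times> real) set" and \<delta> :: "real \<times> real \<Rightarrow> real"
  assumes k: "1 \<le> k" and K: "0 < K" and wi: "walsh_integral M F W f Y"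
    and fm [measurable]: "(\<lambda>(\<omega>, s, y). f \<omega> s y) \<in> borel_measurable MP"
    and f0: "\<And>\<omega> s y. s < 0 \<Longrightarrow> f \<omega> s y = 0" and fQ: "\<And>\<omega> s y. (s, y) \<notin> Q \<Longrightarrow> f \<omega> s y = 0"
    and Q [measurable]: "Q \<in> sets lplane" and \<delta> [measurable]: "\<delta> \<in> borel_measurable lplane"
    and \<delta>01: "\<And>z. 0 < \<delta> z" "\<And>z. \<delta> z \<le> 1" and D: "\<And>z. z \<in> Q \<Longrightarrow> (1 / \<delta> z)^k \<le> D"
    and small: "ennreal (4^(2*k+2)) * (\<integral>\<^sup>+ z. indicator Q z * ennreal (\<delta> z) \<partial>lplane) \<le> ennreal (1/2)"
  shows "exp_trunc k K Y \<le>
    ennreal (2 * 4^(2*k+2) * 16^(k+1)) * (\<integral>\<^sup>+ (\<omega>, s, y). ennreal ((1 / \<delta> (s, y))^k * trunc_pow k K (f \<omega> s y)) \<partial>MP)"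
proof -
  obtain es where es: "\<And>n. elems_from 0 (es n)"
    "(\<lambda>n. \<integral>\<^sup>+ (\<omega>, s, y). ennreal ((simple_fun (es n) \<omega> s y - f \<omega> s y)\<^sup>2) \<partial>MP) \<longlonglongrightarrow> 0"
    "(\<lambda>n. \<integral>\<^sup>+ \<omega>. ennreal ((simple_int W (es n) \<omega> - Y \<omega>)\<^sup>2) \<partial>M) \<longlonglongrightarrow> 0"
    and [measurable]: "Y \<in> borel_measurable M"
    using walsh_approx[OF wi f0] by blast
  define \<epsilon> where "\<epsilon> = (\<lambda>n. \<integral>\<^sup>+ (\<omega>, s, y). ennreal ((simple_fun (es n) \<omega> s y - f \<omega> s y)\<^sup>2) \<partial>MP)"
  define \<eta> where "\<eta> = (\<lambda>n. \<integral>\<^sup>+ \<omega>. ennreal ((simple_int W (es n) \<omega> - Y \<omega>)\<^sup>2) \<partial>M)"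
  define c where "c = ennreal (4^(2*k+2))"
  define b where "b = (4::real)^(k+1)"
  define R where "R = (\<integral>\<^sup>+ (\<omega>, s, y). ennreal ((1 / \<delta> (s, y))^k * trunc_pow k K (f \<omega> s y)) \<partial>MP)"
  \<comment> \<open>\<open>L\<close> covers the approximation error on \<open>Q\<close>, where
    \<delta>^(-k) is at most \<open>D\<close>, and off \<open>Q\<close>, where \<open>f\<close> is
    zero. It multiplies only a quantity that tends to zero, so \<open>D\<close> does not appear in
    the conclusion.\<close>
  define L where "L = \<bar>D\<bar> * b * K + K"
  have b: "0 \<le> b" "0 \<le> L" using K by (simp_all add: b_def L_def)
  have fm' [measurable]: "(\<lambda>z. f (fst z) (fst (snd z)) (snd (snd z))) \<in> borel_measurable MP"
    using fm by (simp add: case_prod_unfold)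
  have bound: "exp_trunc k K Y \<le>
     ennreal b * (2 * (c * (ennreal b * R + ennreal L * \<epsilon> n))) + ennreal (b * K) * \<eta> n" for n
  proof -
    have [measurable]: "simple_int W (es n) \<in> borel_measurable M" by (rule simple_int_measurable[OF es(1)])
    have [measurable]: "(\<lambda>z. simple_fun (es n) (fst z) (fst (snd z)) (snd (snd z))) \<in> borel_measurable MP"
      using simple_fun_measurable[OF es(1)] by (simp add: case_prod_unfold)
    let ?I = "simple_int W (es n)"
    have "exp_trunc k K Y \<le>
       (\<integral>\<^sup>+ \<omega>. ennreal b * ennreal (trunc_pow k K (?I \<omega>)) + ennreal (b * K) * ennreal ((?I \<omega> - Y \<omega>)\<^sup>2) \<partial>M)"
    proof (rule nn_integral_mono)
      fix \<omega>
      have "trunc_pow k K (?I \<omega> + (Y \<omega> - ?I \<omega>)) \<le> b * (trunc_pow k K (?I \<omega>) + trunc_pow k K (Y \<omega> - ?I \<omega>))"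
        unfolding b_def by (rule trunc_pow_add[OF K])
      also have "\<dots> \<le> b * (trunc_pow k K (?I \<omega>) + K * (Y \<omega> - ?I \<omega>)\<^sup>2)"
        by (intro mult_left_mono add_left_mono trunc_pow_le_square K b)
      finally have "trunc_pow k K (Y \<omega>) \<le> b * trunc_pow k K (?I \<omega>) + (b * K) * (?I \<omega> - Y \<omega>)\<^sup>2"
        by (simp add: distrib_left mult.assoc power2_commute)
      then show "ennreal (trunc_pow k K (Y \<omega>)) \<le> ennreal b * ennreal (trunc_pow k K (?I \<omega>)) + ennreal (b * K) * ennreal ((?I \<omega> - Y \<omega>)\<^sup>2)"
        using trunc_pow_nonneg[OF K] b K by (intro ennreal_le_lincomb) auto
    qed
    also have "\<dots> = ennreal b * exp_trunc k K ?I + ennreal (b * K) * \<eta> n"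
      unfolding \<eta>_def by (subst nn_integral_add) (auto simp: nn_integral_cmult)
    also have "exp_trunc k K ?I \<le>
      2 * (c * (\<integral>\<^sup>+ (\<omega>, s, y). (indicator Q (s, y) * ennreal ((1 / \<delta> (s, y))^k * trunc_pow k K (simple_fun (es n) \<omega> s y))
        + indicator (- Q) (s, y) * ennreal (K * (simple_fun (es n) \<omega> s y)\<^sup>2)) \<partial>MP))"
      unfolding c_def by (rule simple_trunc_bound[OF k K es(1) Q \<delta> \<delta>01 small])
    also have "(\<integral>\<^sup>+ (\<omega>, s, y). (indicator Q (s, y) * ennreal ((1 / \<delta> (s, y))^k * trunc_pow k K (simple_fun (es n) \<omega> s y))
        + indicator (- Q) (s, y) * ennreal (K * (simple_fun (es n) \<omega> s y)\<^sup>2)) \<partial>MP) \<le>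
      (\<integral>\<^sup>+ z. ennreal b * (case z of (\<omega>, s, y) \<Rightarrow> ennreal ((1 / \<delta> (s, y))^k * trunc_pow k K (f \<omega> s y)))
         + ennreal L * (case z of (\<omega>, s, y) \<Rightarrow> ennreal ((simple_fun (es n) \<omega> s y - f \<omega> s y)\<^sup>2)) \<partial>MP)"
    proof (rule nn_integral_mono, clarsimp)
      fix \<omega> s y
      let ?g = "simple_fun (es n) \<omega> s y" and ?f = "f \<omega> s y" and ?\<phi> = "trunc_pow k K"
      have nn: "0 \<le> (1 / \<delta> (s, y))^k" "0 \<le> ?\<phi> ?f" using \<delta>01(1)[of "(s, y)"] trunc_pow_nonneg[OF K] by auto
      show "indicator Q (s, y) * ennreal ((1 / \<delta> (s, y))^k * ?\<phi> ?g) + indicator (- Q) (s, y) * ennreal (K * ?g\<^sup>2)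
        \<le> ennreal b * ennreal ((1 / \<delta> (s, y))^k * ?\<phi> ?f) + ennreal L * ennreal ((?g - ?f)\<^sup>2)"
      proof (cases "(s, y) \<in> Q")
        case True
        have "?\<phi> (?f + (?g - ?f)) \<le> b * (?\<phi> ?f + ?\<phi> (?g - ?f))"
          unfolding b_def by (rule trunc_pow_add[OF K])
        also have "\<dots> \<le> b * (?\<phi> ?f + K * (?g - ?f)\<^sup>2)"
          by (intro mult_left_mono add_left_mono trunc_pow_le_square K b)
        finally have "(1 / \<delta> (s, y))^k * ?\<phi> ?g \<le> (1 / \<delta> (s, y))^k * (b * (?\<phi> ?f + K * (?g - ?f)\<^sup>2))"
          using nn by (intro mult_left_mono) auto
        also have "\<dots> = b * ((1 / \<delta> (s, y))^k * ?\<phi> ?f) + (1 / \<delta> (s, y))^k * (b * K * (?g - ?f)\<^sup>2)"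
          by (simp add: algebra_simps)
        also have "\<dots> \<le> b * ((1 / \<delta> (s, y))^k * ?\<phi> ?f) + \<bar>D\<bar> * (b * K * (?g - ?f)\<^sup>2)"
          using D[OF True] b K by (intro add_left_mono mult_right_mono) auto
        also have "\<dots> \<le> b * ((1 / \<delta> (s, y))^k * ?\<phi> ?f) + L * (?g - ?f)\<^sup>2"
          using K by (simp add: L_def algebra_simps)
        finally have "ennreal ((1 / \<delta> (s, y))^k * ?\<phi> ?g) \<le> ennreal b * ennreal ((1 / \<delta> (s, y))^k * ?\<phi> ?f) + ennreal L * ennreal ((?g - ?f)\<^sup>2)"
          using nn b by (intro ennreal_le_lincomb) auto
        then show ?thesis using True by simp
      next
        case False
        then have "?f = 0" by (rule fQ)
        moreover have "K * ?g\<^sup>2 \<le> L * ?g\<^sup>2" using b K by (intro mult_right_mono) (auto simp: L_def)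
        then have "ennreal (K * ?g\<^sup>2) \<le> ennreal L * ennreal (?g\<^sup>2)"
          using b by (subst ennreal_mult[symmetric]) (auto intro: ennreal_leI)
        ultimately show ?thesis using False by (simp add: trunc_pow_def)
      qed
    qed
    also have "\<dots> = ennreal b * R + ennreal L * \<epsilon> n"
      unfolding R_def \<epsilon>_def case_prod_unfold by (subst nn_integral_add) (auto simp: nn_integral_cmult)
    finally show ?thesis by (simp add: mult_left_mono add_right_mono)
  qed
  have \<epsilon>: "\<epsilon> \<longlonglongrightarrow> 0" and \<eta>: "\<eta> \<longlonglongrightarrow> 0" using es(2,3) by (simp_all add: \<epsilon>_def \<eta>_def)
  have "(\<lambda>n. ennreal b * (2 * (c * (ennreal b * R + ennreal L * \<epsilon> n))) + ennreal (b * K) * \<eta> n)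
     \<longlonglongrightarrow> ennreal b * (2 * (c * (ennreal b * R + ennreal L * 0))) + ennreal (b * K) * 0"
    by (intro tendsto_add tendsto_const ennreal_tendsto_cmult \<epsilon> \<eta>) (auto simp: c_def)
  then have "exp_trunc k K Y \<le> ennreal b * (2 * (c * (ennreal b * R + ennreal L * 0))) + ennreal (b * K) * 0"
    by (rule LIMSEQ_le_const) (use bound in auto)
  also have "\<dots> = (ennreal b * (ennreal 2 * (ennreal (4^(2*k+2)) * ennreal b))) * R"
    by (simp add: c_def mult_ac)
  also have "ennreal b * (ennreal 2 * (ennreal (4^(2*k+2)) * ennreal b)) = ennreal (b * (2 * (4^(2*k+2) * b)))"
  proof -
    have "ennreal (b * (2 * (4^(2*k+2) * b))) = ennreal b * ennreal (2 * (4^(2*k+2) * b))" using b by (intro ennreal_mult) auto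
    also have "ennreal (2 * (4^(2*k+2) * b)) = ennreal 2 * ennreal (4^(2*k+2) * b)" using b by (intro ennreal_mult) auto
    also have "ennreal (4^(2*k+2) * b) = ennreal (4^(2*k+2)) * ennreal b" using b by (intro ennreal_mult) auto
    finally show ?thesis by (rule sym)
  qed
  also have "b * (2 * (4^(2*k+2) * b)) = 2 * 4^(2*k+2) * (b * b)" by simp
  \<comment> \<open>One factor \<open>b\<close> comes from replacing \<open>Y\<close> by an
    elementary integral, the other from replacing the elementary integrand by
    \<open>f\<close>.\<close>
  also have "b * b = 16^(k+1)" unfolding b_def power_mult_distrib[symmetric] by simp
  finally show ?thesis by (simp add: R_def)
qed

text \<open>For an elementary integral the identity E (J + I)^2 = J^2 + E I^2 is exact, since I is
  centred. The inequality (a + b)^2 <= 2 a^2 + 2 b^2 is then used twice, once for the integral and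
  once for the integrand, which explains the factor 4.\<close>

lemma walsh_second_moment_lower:
  fixes J :: real
  assumes wi: "walsh_integral M F W f Y"
    and fm [measurable]: "(\<lambda>(\<omega>, s, y). f \<omega> s y) \<in> borel_measurable MP"
    and f0: "\<And>\<omega> s y. s < 0 \<Longrightarrow> f \<omega> s y = 0"
  shows "2 * ennreal (J\<^sup>2) + (\<integral>\<^sup>+ (\<omega>, s, y). ennreal ((f \<omega> s y)\<^sup>2) \<partial>MP) \<le> 4 * (\<integral>\<^sup>+ \<omega>. ennreal ((J + Y \<omega>)\<^sup>2) \<partial>M)"
    (is "2 * _ + ?f2 \<le> 4 * ?JY")
proof -
  obtain es where es: "\<And>n. elems_from 0 (es n)"
    "(\<lambda>n. \<integral>\<^sup>+ (\<omega>, s, y). ennreal ((simple_fun (es n) \<omega> s y - f \<omega> s y)\<^sup>2) \<partial>MP) \<longlonglongrightarrow> 0"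
    "(\<lambda>n. \<integral>\<^sup>+ \<omega>. ennreal ((simple_int W (es n) \<omega> - Y \<omega>)\<^sup>2) \<partial>M) \<longlonglongrightarrow> 0"
    and [measurable]: "Y \<in> borel_measurable M"
    using walsh_approx[OF wi f0] by blast
  define \<epsilon> where "\<epsilon> = (\<lambda>n. \<integral>\<^sup>+ (\<omega>, s, y). ennreal ((simple_fun (es n) \<omega> s y - f \<omega> s y)\<^sup>2) \<partial>MP)"
  define \<eta> where "\<eta> = (\<lambda>n. \<integral>\<^sup>+ \<omega>. ennreal ((simple_int W (es n) \<omega> - Y \<omega>)\<^sup>2) \<partial>M)"
  have fm' [measurable]: "(\<lambda>z. f (fst z) (fst (snd z)) (snd (snd z))) \<in> borel_measurable MP"
    using fm by (simp add: case_prod_unfold)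
  have sq: "ennreal ((a + b)\<^sup>2) \<le> 2 * ennreal (a\<^sup>2) + 2 * ennreal (b\<^sup>2)" for a b :: real
  proof -
    have "(a + b)\<^sup>2 \<le> 2 * a\<^sup>2 + 2 * b\<^sup>2" using sum_squares_bound[of a b] by (simp add: power2_sum)
    from ennreal_le_lincomb[OF this] show ?thesis by simp
  qed
  have bound: "2 * ennreal (J\<^sup>2) + ?f2
     \<le> 4 * ?JY + 4 * \<eta> n + 2 * \<epsilon> n" for n
  proof -
    let ?I = "simple_int W (es n)"
    let ?S = "\<integral>\<^sup>+ (\<omega>, s, y). ennreal ((simple_fun (es n) \<omega> s y)\<^sup>2) \<partial>MP"
    let ?JI = "\<integral>\<^sup>+ \<omega>. ennreal ((J + ?I \<omega>)\<^sup>2) \<partial>M"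
    have [measurable]: "?I \<in> borel_measurable M" by (rule simple_int_measurable[OF es(1)])
    have [measurable]: "(\<lambda>z. simple_fun (es n) (fst z) (fst (snd z)) (snd (snd z))) \<in> borel_measurable MP"
      using simple_fun_measurable[OF es(1)] by (simp add: case_prod_unfold)
    have one: "(\<lambda>_. 1 :: real) \<in> borel_measurable (F 0)" by simp
    have I2: "integrable M (\<lambda>\<omega>. (?I \<omega>)\<^sup>2)" and iso: "(\<integral>\<^sup>+ \<omega>. ennreal ((?I \<omega>)\<^sup>2) \<partial>M) = ?S"
      using simple_isometry[OF one _ _ es(1), of 1] by (simp_all only: mult_1_left zero_le_one order_refl)
    have I1: "has_bochner_integral M ?I 0"
      using simple_int_martingale[OF one _ es(1)] by simp
    have "?JI = ennreal (expectation (\<lambda>\<omega>. J\<^sup>2 + 2 * J * ?I \<omega> + (?I \<omega>)\<^sup>2))"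
    proof -
      have expand: "(J + ?I \<omega>)\<^sup>2 = J\<^sup>2 + 2 * J * ?I \<omega> + (?I \<omega>)\<^sup>2" for \<omega> by (simp add: power2_sum)
      have "integrable M (\<lambda>\<omega>. J\<^sup>2 + 2 * J * ?I \<omega> + (?I \<omega>)\<^sup>2)"
        using I1 I2 by (intro Bochner_Integration.integrable_add integrable_mult_right) (auto simp: has_bochner_integral_iff)
      then show ?thesis
        unfolding expand by (rule nn_integral_eq_integral) (simp flip: expand)
    qed
    also have "expectation (\<lambda>\<omega>. J\<^sup>2 + 2 * J * ?I \<omega> + (?I \<omega>)\<^sup>2) = J\<^sup>2 + expectation (\<lambda>\<omega>. (?I \<omega>)\<^sup>2)"
      using I1 I2 by (simp add: has_bochner_integral_iff prob_space)
    also have "ennreal \<dots> = ennreal (J\<^sup>2) + (\<integral>\<^sup>+ \<omega>. ennreal ((?I \<omega>)\<^sup>2) \<partial>M)"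
      using I2 by (simp add: nn_integral_eq_integral)
    finally have eq: "?JI = ennreal (J\<^sup>2) + ?S"
      by (simp add: iso)
    have 1: "?JI \<le> 2 * ?JY + 2 * \<eta> n"
    proof -
      have "?JI \<le> (\<integral>\<^sup>+ \<omega>. 2 * ennreal ((J + Y \<omega>)\<^sup>2) + 2 * ennreal ((?I \<omega> - Y \<omega>)\<^sup>2) \<partial>M)"
      proof (rule nn_integral_mono)
        show "ennreal ((J + ?I \<omega>)\<^sup>2) \<le> 2 * ennreal ((J + Y \<omega>)\<^sup>2) + 2 * ennreal ((?I \<omega> - Y \<omega>)\<^sup>2)" for \<omega>
          using sq[of "J + Y \<omega>" "?I \<omega> - Y \<omega>"] by simp
      qed
      also have "\<dots> = 2 * ?JY + 2 * \<eta> n"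
        unfolding \<eta>_def by (subst nn_integral_add) (auto simp: nn_integral_cmult)
      finally show ?thesis .
    qed
    have 2: "?f2 \<le> 2 * ?S + 2 * \<epsilon> n"
    proof -
      have "?f2 \<le> (\<integral>\<^sup>+ z. 2 * (case z of (\<omega>, s, y) \<Rightarrow> ennreal ((simple_fun (es n) \<omega> s y)\<^sup>2))
          + 2 * (case z of (\<omega>, s, y) \<Rightarrow> ennreal ((simple_fun (es n) \<omega> s y - f \<omega> s y)\<^sup>2)) \<partial>MP)"
      proof (rule nn_integral_mono, clarsimp)
        fix \<omega> s y
        show "ennreal ((f \<omega> s y)\<^sup>2) \<le> 2 * ennreal ((simple_fun (es n) \<omega> s y)\<^sup>2) + 2 * ennreal ((simple_fun (es n) \<omega> s y - f \<omega> s y)\<^sup>2)"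
          using sq[of "simple_fun (es n) \<omega> s y" "f \<omega> s y - simple_fun (es n) \<omega> s y"] by (simp add: power2_commute)
      qed
      also have "\<dots> = 2 * ?S + 2 * \<epsilon> n"
        unfolding \<epsilon>_def case_prod_unfold by (subst nn_integral_add) (auto simp: nn_integral_cmult)
      finally show ?thesis .
    qed
    have "2 * ennreal (J\<^sup>2) + ?f2
      \<le> 2 * ennreal (J\<^sup>2) + (2 * ?S + 2 * \<epsilon> n)"
      by (intro add_left_mono 2)
    also have "\<dots> = 2 * ?JI + 2 * \<epsilon> n"
      unfolding eq by (simp add: distrib_left add.assoc)
    also have "\<dots> \<le> 2 * (2 * ?JY + 2 * \<eta> n) + 2 * \<epsilon> n"
      by (intro add_right_mono mult_left_mono 1) simp
    also have "\<dots> = 4 * ?JY + 4 * \<eta> n + 2 * \<epsilon> n"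
      by (simp add: distrib_left mult.assoc[symmetric])
    finally show ?thesis .
  qed
  have \<epsilon>: "\<epsilon> \<longlonglongrightarrow> 0" and \<eta>: "\<eta> \<longlonglongrightarrow> 0" using es(2,3) by (simp_all add: \<epsilon>_def \<eta>_def)
  have "(\<lambda>n. 4 * ?JY + 4 * \<eta> n + 2 * \<epsilon> n)
     \<longlonglongrightarrow> 4 * ?JY + 4 * 0 + 2 * 0"
    by (intro tendsto_add tendsto_const ennreal_tendsto_cmult \<epsilon> \<eta>) auto
  then have "2 * ennreal (J\<^sup>2) + ?f2
     \<le> 4 * ?JY + 4 * 0 + 2 * 0"
    by (rule LIMSEQ_le_const) (use bound in auto)
  then show ?thesis by simp
qed

end

section \<open>Moments of the mild solution\<close>

definition cone :: "real \<Rightarrow> real \<Rightarrow> real \<Rightarrow> (real \<times> real) set" where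
  "cone \<kappa> t x = {(s, y). 0 \<le> s \<and> s \<le> t \<and> \<bar>y - x\<bar> \<le> \<kappa> * (t - s)}"

lemma cone_measurable [measurable]: "cone \<kappa> t x \<in> sets (lborel \<Otimes>\<^sub>M lborel)"
proof -
  have "closed (cone \<kappa> t x)"
    unfolding cone_def case_prod_unfold
    by (intro closed_Collect_conj closed_Collect_le continuous_intros)
  then show ?thesis unfolding lborel_prod by simp
qed

text \<open>The cone has width 2 \<kappa> (t - s) at time s, so the integral is at most that of 2
  \<kappa> r exp(-\<beta> r) over positive r. The bound does not depend on the apex, and it becomes
  small as \<beta> grows; both facts are essential for the renewal argument.\<close>

lemma nn_integral_cone_exp:
  assumes \<kappa>: "0 < \<kappa>" and \<beta>: "0 < \<beta>"
  shows "(\<integral>\<^sup>+ z. indicator (cone \<kappa> t x) z * ennreal (exp (- \<beta> * (t - fst z))) \<partial>(lborel \<Otimes>\<^sub>M lborel)) \<le> ennreal (2 * \<kappa> / \<beta>\<^sup>2)"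
proof (cases "0 \<le> t")
  case True
  \<comment> \<open>An antiderivative of the width times the exponential. It is nonnegative at 0 and
    equals 2 \<kappa> / \<beta>^2 at t.\<close>
  define G where "G = (\<lambda>s. 2 * \<kappa> * ((t - s) / \<beta> + 1 / \<beta>\<^sup>2) * exp (- \<beta> * (t - s)))"
  have "(\<integral>\<^sup>+ z. indicator (cone \<kappa> t x) z * ennreal (exp (- \<beta> * (t - fst z))) \<partial>(lborel \<Otimes>\<^sub>M lborel))
     = (\<integral>\<^sup>+ s. \<integral>\<^sup>+ y. indicator (cone \<kappa> t x) (s, y) * ennreal (exp (- \<beta> * (t - s))) \<partial>lborel \<partial>lborel)"
    by (subst lborel.nn_integral_fst[symmetric]) auto
  also have "\<dots> = (\<integral>\<^sup>+ s. ennreal (2 * \<kappa> * (t - s) * exp (- \<beta> * (t - s))) * indicator {0..t} s \<partial>lborel)"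
  proof (rule nn_integral_cong)
    fix s
    show "(\<integral>\<^sup>+ y. indicator (cone \<kappa> t x) (s, y) * ennreal (exp (- \<beta> * (t - s))) \<partial>lborel)
       = ennreal (2 * \<kappa> * (t - s) * exp (- \<beta> * (t - s))) * indicator {0..t} s"
    proof (cases "s \<in> {0..t}")
      case s: True
      then have "0 \<le> \<kappa> * (t - s)" using \<kappa> by simp
      have "indicator (cone \<kappa> t x) (s, y) = (indicator {x - \<kappa> * (t - s)..x + \<kappa> * (t - s)} y :: ennreal)" for y
        using s by (auto simp: cone_def indicator_def abs_le_iff)
      then have "(\<integral>\<^sup>+ y. indicator (cone \<kappa> t x) (s, y) * ennreal (exp (- \<beta> * (t - s))) \<partial>lborel)
         = emeasure lborel {x - \<kappa> * (t - s)..x + \<kappa> * (t - s)} * ennreal (exp (- \<beta> * (t - s)))"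
        by (simp add: nn_integral_multc)
      also have "\<dots> = ennreal (2 * \<kappa> * (t - s)) * ennreal (exp (- \<beta> * (t - s)))"
        using \<open>0 \<le> \<kappa> * (t - s)\<close> by (simp add: mult.assoc)
      also have "\<dots> = ennreal (2 * \<kappa> * (t - s) * exp (- \<beta> * (t - s)))"
        using \<open>0 \<le> \<kappa> * (t - s)\<close> by (subst ennreal_mult) auto
      finally show ?thesis using s by simp
    next
      case False
      then have "indicator (cone \<kappa> t x) (s, y) = (0 :: ennreal)" for y by (auto simp: cone_def indicator_def)
      then show ?thesis using False by simp
    qed
  qed
  also have "\<dots> = ennreal (G t - G 0)"
  proof (rule nn_integral_FTC_Icc)
    fix s assume s: "s \<in> {0..t}"
    show "(G has_real_derivative 2 * \<kappa> * (t - s) * exp (- \<beta> * (t - s))) (at s)"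
      unfolding G_def using \<beta>
      by (auto intro!: derivative_eq_intros simp: field_simps power2_eq_square)
    show "0 \<le> 2 * \<kappa> * (t - s) * exp (- \<beta> * (t - s))" using s \<kappa> by simp
  qed (use True in auto)
  also have "\<dots> \<le> ennreal (2 * \<kappa> / \<beta>\<^sup>2)"
    using True \<kappa> \<beta> by (intro ennreal_leI) (simp add: G_def)
  finally show ?thesis .
next
  case False
  then have "cone \<kappa> t x = {}" by (auto simp: cone_def)
  then show ?thesis by simp
qed

text \<open>\<open>Lip\<close> is normalised to be at least 1 so that
  \<open>trunc_pow_scale\<close>, which dilates by factors of at least 1, applies to it.\<close>

locale wave_equation = white_noise M F W
  for M :: "'a measure" and F W +
  fixes \<kappa> :: real and \<sigma> u0 v0 :: "real \<Rightarrow> real" and u :: "real \<Rightarrow> real \<Rightarrow> 'a \<Rightarrow> real"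
    and Lip ell :: real
  assumes kappa: "0 < \<kappa>"
    and sigma_cont: "continuous_on UNIV \<sigma>"
    and sigma_upper: "\<And>x. \<bar>\<sigma> x\<bar> \<le> Lip * \<bar>x\<bar>" "1 \<le> Lip"
    and sigma_lower: "\<And>x. ell * \<bar>x\<bar> \<le> \<bar>\<sigma> x\<bar>" "0 < ell"
    and mild: "mild_solution M F W \<kappa> \<sigma> u0 v0 u"
begin

abbreviation velocity_part :: "real \<Rightarrow> real \<Rightarrow> real" where
  "velocity_part t x \<equiv> (\<integral>y\<in>{x - \<kappa> * t .. x + \<kappa> * t}. v0 y \<partial>lborel)"

definition J :: "real \<Rightarrow> real \<Rightarrow> real" where
  "J t x = (u0 (x + \<kappa> * t) + u0 (x - \<kappa> * t)) / 2
            + 1 / (2 * \<kappa>) * velocity_part t x"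

definition integrand :: "real \<Rightarrow> real \<Rightarrow> 'a \<Rightarrow> real \<Rightarrow> real \<Rightarrow> real" where
  "integrand t x \<omega> s y = indicator {0..t} s * Gamma \<kappa> (t - s) (y - x) * \<sigma> (u s y \<omega>)"

lemma integrand_eq: "integrand t x \<omega> s y = indicator (cone \<kappa> t x) (s, y) * (\<sigma> (u s y \<omega>) / 2)"
  by (auto simp: integrand_def Gamma_def cone_def indicator_def abs_le_iff)

lemma sigma_measurable [measurable]: "\<sigma> \<in> borel_measurable borel"
  using sigma_cont by (rule borel_measurable_continuous_onI)

text \<open>Predictability refers to a sigma-algebra on nonnegative times. Its generating boxes are
  measurable in the product space, so it lies inside the trace of the product sigma-algebra;
  extension by zero to negative times then gives measurability on the whole product.\<close>

lemma u_joint_measurable [measurable]: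
  "(\<lambda>z. u (fst (snd z)) (snd (snd z)) (fst z) * indicator {0..} (fst (snd z))) \<in> borel_measurable MP"
proof -
  define \<Omega> where "\<Omega> = space M \<times> {0::real..} \<times> (UNIV :: real set)"
  define \<G> where "\<G> = {A \<times> {a<..b} \<times> B | A a b B. 0 \<le> a \<and> a \<le> b \<and> A \<in> sets (F a) \<and> B \<in> sets (borel :: real measure)} \<union>
      {A \<times> {0} \<times> B | A B. A \<in> sets (F 0) \<and> B \<in> sets (borel :: real measure)}"
  have ps: "pred_sigma M F = sigma \<Omega> \<G>" by (simp add: pred_sigma_def \<Omega>_def \<G>_def)
  have A: "A \<in> sets M" if "A \<in> sets (F a)" for A a using that sets_F by blast
  have prod: "A \<times> C \<times> B \<in> sets MP" if "A \<in> sets M" "C \<in> sets borel" "B \<in> sets borel" for A and B C :: "real set"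
    using that by (intro pair_measureI) auto
  have \<Omega>: "\<Omega> \<in> sets MP" unfolding \<Omega>_def by (intro prod) auto
  have sub: "A \<subseteq> space M" if "A \<in> sets (F a)" for A a using sets.sets_into_space[OF A[OF that]] .
  have G\<Omega>: "\<G> \<subseteq> Pow \<Omega>" unfolding \<G>_def \<Omega>_def using sub by fastforce
  have "\<G> \<subseteq> sets MP" unfolding \<G>_def using A by (auto intro!: prod)
  have "\<G> \<subseteq> sets (restrict_space MP \<Omega>)"
  proof
    fix A assume "A \<in> \<G>"
    then have "A \<subseteq> \<Omega>" "A \<in> sets MP" using G\<Omega> \<open>\<G> \<subseteq> sets MP\<close> by blast+
    then show "A \<in> sets (restrict_space MP \<Omega>)"
      using \<Omega> by (simp add: sets_restrict_space_iff)
  qed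
  moreover have sp: "space (restrict_space MP \<Omega>) = \<Omega>"
    using sets.sets_into_space[OF \<Omega>] by (auto simp: space_restrict_space)
  ultimately have "sigma_sets \<Omega> \<G> \<subseteq> sets (restrict_space MP \<Omega>)"
    using sets.sigma_sets_subset[of \<G> "restrict_space MP \<Omega>"] by simp
  moreover have "(\<lambda>(\<omega>, s, y). u s y \<omega>) \<in> borel_measurable (sigma \<Omega> \<G>)"
    using mild by (simp add: mild_solution_def predictable_def ps)
  ultimately have "(\<lambda>(\<omega>, s, y). u s y \<omega>) \<in> borel_measurable (restrict_space MP \<Omega>)"
    using G\<Omega> sp by (auto simp: measurable_def)
  then have "(\<lambda>z. (case z of (\<omega>, s, y) \<Rightarrow> u s y \<omega>) * indicator \<Omega> z) \<in> borel_measurable MP"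
    using \<Omega> by (subst (asm) borel_measurable_restrict_space_iff) (auto simp: mult.commute)
  then show ?thesis
    by (rule measurable_cong[THEN iffD1, rotated]) (auto simp: \<Omega>_def indicator_def space_pair_measure)
qed

lemma u_measurable: "0 \<le> t \<Longrightarrow> u t x \<in> borel_measurable M"
proof -
  assume "0 \<le> t"
  have "(\<lambda>\<omega>. (\<omega>, t, x)) \<in> measurable M MP" by measurable
  from measurable_compose[OF this u_joint_measurable] \<open>0 \<le> t\<close> show ?thesis by simp
qed

lemma second_moment_bounded: "\<exists>C\<ge>0. \<forall>t\<in>{0..T}. \<forall>x. (\<integral>\<^sup>+ \<omega>. ennreal ((u t x \<omega>)\<^sup>2) \<partial>M) \<le> ennreal C"
proof -
  obtain C where "\<forall>t\<in>{0..T}. \<forall>x. (\<integral>\<^sup>+ \<omega>. ennreal ((u t x \<omega>)\<^sup>2) \<partial>M) \<le> ennreal C"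
    using mild unfolding mild_solution_def by blast
  then show ?thesis by (intro exI[of _ "max 0 C"]) (auto simp: ennreal_max_0)
qed

abbreviation trunc_moment :: "nat \<Rightarrow> real \<Rightarrow> real \<Rightarrow> real \<Rightarrow> ennreal" where
  "trunc_moment k K t x \<equiv> (\<integral>\<^sup>+ \<omega>. ennreal (trunc_pow k K (u t x \<omega>)) \<partial>M)"

abbreviation second_moment :: "real \<Rightarrow> real \<Rightarrow> ennreal" where
  "second_moment t x \<equiv> (\<integral>\<^sup>+ \<omega>. ennreal ((u t x \<omega>)\<^sup>2) \<partial>M)"

abbreviation trunc_cone_moment :: "nat \<Rightarrow> real \<Rightarrow> real \<Rightarrow> real \<Rightarrow> ennreal" where
  "trunc_cone_moment k K t x \<equiv> (\<integral>\<^sup>+ z. indicator (cone \<kappa> t x) z * ennreal (exp (real k * (t - fst z))) *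
     trunc_moment k K (fst z) (snd z) \<partial>lplane)"

lemma mild_eq:
  assumes "0 \<le> t"
  shows "\<exists>Y. walsh_integral M F W (integrand t x) Y \<and> (AE \<omega> in M. u t x \<omega> = J t x + Y \<omega>)"
  using mild assms unfolding mild_solution_def integrand_def[abs_def] J_def by auto

lemma integrand_u: "integrand t x \<omega> s y = indicator (cone \<kappa> t x) (s, y) * (\<sigma> (u s y \<omega> * indicator {0..} s) / 2)"
  by (auto simp: integrand_eq cone_def indicator_def)

lemma integrand_measurable: "(\<lambda>(\<omega>, s, y). integrand t x \<omega> s y) \<in> borel_measurable MP"
proof -
  have "(\<lambda>z. indicator (cone \<kappa> t x) (snd z) * (\<sigma> (u (fst (snd z)) (snd (snd z)) (fst z) * indicator {0..} (fst (snd z))) / 2)) \<in> borel_measurable MP"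
    by measurable
  then show ?thesis by (simp add: integrand_u case_prod_unfold)
qed

text \<open>Joint measurability is available only after cutting off negative times. The cone
  contains none of these, so the cutoff can be inserted for Fubini and removed afterwards.\<close>

lemma nn_integral_cone_Fubini:
  fixes g :: "real \<Rightarrow> ennreal" and h :: "real \<times> real \<Rightarrow> ennreal"
  assumes [measurable]: "g \<in> borel_measurable borel" "h \<in> borel_measurable lplane"
  shows "(\<integral>\<^sup>+ z. indicator (cone \<kappa> t x) (snd z) * h (snd z) * g (u (fst (snd z)) (snd (snd z)) (fst z)) \<partial>MP)
     = (\<integral>\<^sup>+ z. indicator (cone \<kappa> t x) z * h z * (\<integral>\<^sup>+ \<omega>. g (u (fst z) (snd z) \<omega>) \<partial>M) \<partial>lplane)"
proof -
  interpret lp: sigma_finite_measure lplane by (rule sigma_finite_plane)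
  interpret P: pair_sigma_finite M lplane ..
  have eq: "indicator (cone \<kappa> t x) z * h z * g (u (fst z) (snd z) \<omega>)
     = indicator (cone \<kappa> t x) z * h z * g (u (fst z) (snd z) \<omega> * indicator {0..} (fst z))" for z \<omega>
    by (auto simp: cone_def indicator_def)
  have "(\<integral>\<^sup>+ z. indicator (cone \<kappa> t x) (snd z) * h (snd z) * g (u (fst (snd z)) (snd (snd z)) (fst z)) \<partial>MP)
     = (\<integral>\<^sup>+ z. indicator (cone \<kappa> t x) (snd z) * h (snd z) * g (u (fst (snd z)) (snd (snd z)) (fst z) * indicator {0..} (fst (snd z))) \<partial>MP)"
    by (simp only: eq)
  also have "\<dots> = (\<integral>\<^sup>+ z. \<integral>\<^sup>+ \<omega>. indicator (cone \<kappa> t x) z * h z * g (u (fst z) (snd z) \<omega> * indicator {0..} (fst z)) \<partial>M \<partial>lplane)"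
    by (subst P.nn_integral_snd[symmetric]) auto
  also have "\<dots> = (\<integral>\<^sup>+ z. indicator (cone \<kappa> t x) z * h z * (\<integral>\<^sup>+ \<omega>. g (u (fst z) (snd z) \<omega>) \<partial>M) \<partial>lplane)"
  proof (rule nn_integral_cong)
    fix z :: "real \<times> real"
    show "(\<integral>\<^sup>+ \<omega>. indicator (cone \<kappa> t x) z * h z * g (u (fst z) (snd z) \<omega> * indicator {0..} (fst z)) \<partial>M)
        = indicator (cone \<kappa> t x) z * h z * (\<integral>\<^sup>+ \<omega>. g (u (fst z) (snd z) \<omega>) \<partial>M)"
    proof (cases "z \<in> cone \<kappa> t x")
      case True
      then have z: "0 \<le> fst z" by (auto simp: cone_def)
      have [measurable]: "u (fst z) (snd z) \<in> borel_measurable M" by (rule u_measurable[OF z])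
      show ?thesis using True z by (simp add: nn_integral_cmult)
    qed simp
  qed
  finally show ?thesis .
qed

lemma cone_moment_measurable:
  fixes g :: "real \<Rightarrow> ennreal" and h :: "real \<times> real \<Rightarrow> ennreal"
  assumes [measurable]: "g \<in> borel_measurable borel" "h \<in> borel_measurable lplane"
  shows "(\<lambda>z. indicator (cone \<kappa> t x) z * h z * (\<integral>\<^sup>+ \<omega>. g (u (fst z) (snd z) \<omega>) \<partial>M)) \<in> borel_measurable lplane"
proof -
  have "(\<lambda>x. (snd x, fst x)) \<in> measurable (lplane \<Otimes>\<^sub>M M) MP" by measurable
  from measurable_compose[OF this u_joint_measurable]
  have [measurable]: "(\<lambda>x. u (fst (fst x)) (snd (fst x)) (snd x) * indicator {0..} (fst (fst x))) \<in> borel_measurable (lplane \<Otimes>\<^sub>M M)"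
    by simp
  have "(\<lambda>z. \<integral>\<^sup>+ \<omega>. g (u (fst z) (snd z) \<omega> * indicator {0..} (fst z)) \<partial>M) \<in> borel_measurable lplane"
    by (rule borel_measurable_nn_integral) (simp add: case_prod_unfold)
  then have "(\<lambda>z. indicator (cone \<kappa> t x) z * h z * (\<integral>\<^sup>+ \<omega>. g (u (fst z) (snd z) \<omega> * indicator {0..} (fst z)) \<partial>M)) \<in> borel_measurable lplane"
    by measurable
  then show ?thesis
    by (rule measurable_cong[THEN iffD1, rotated]) (auto simp: cone_def indicator_def)
qed

text \<open>The moment bound for stochastic integrals is applied on the backward cone of (t, x),
  with \<delta> decaying exponentially away from the apex. The constant is chosen before the
  truncation level and the space-time point, because all three will vary.\<close>

lemma trunc_moment_ineq:
  assumes k: "1 \<le> k"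
  shows "\<exists>C\<ge>0. \<forall>K>0. \<forall>t\<ge>0. \<forall>x.
    trunc_moment k K t x \<le> ennreal (C * trunc_pow k K (J t x)) +
      ennreal C * trunc_cone_moment k K t x"
proof -
  define c where "c = (4::real)^(2*k+2)"
  \<comment> \<open>The cone integral of exp(-(t - s)) is at most 2 \<kappa>, so this
    \<open>d\<close> makes \<open>c\<close> times the integral of \<delta> at most 1/2; the cap at 1
    ensures that \<delta> is at most 1.\<close>
  define d where "d = min 1 (1 / (4 * \<kappa> * c))"
  define b where "b = (4::real)^(k+1)"
  define C1 where "C1 = (2::real) * 4^(2*k+2) * 16^(k+1)"
  define e where "e = (1 / d)^k * Lip^(2*k+2)"
  define C2 where "C2 = b * C1 * e"
  define C where "C = max b C2"
  have pos: "0 < c" "0 < d" "d \<le> 1" "0 \<le> b" "0 \<le> C1" using kappa by (auto simp: c_def d_def b_def C1_def)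
  have e: "0 \<le> e" using pos(2) sigma_upper(2) by (simp add: e_def)
  have Cpos: "0 \<le> C" "b \<le> C" "C2 \<le> C" "0 \<le> C2" using pos e by (auto simp: C_def C2_def)
  have "trunc_moment k K t x \<le> ennreal (C * trunc_pow k K (J t x)) +
      ennreal C * trunc_cone_moment k K t x"
    if K: "0 < K" and t: "0 \<le> t" for K t x
  proof -
    let ?\<phi> = "trunc_pow k K"
    let ?I = "trunc_cone_moment k K t x"
    obtain Y where wi: "walsh_integral M F W (integrand t x) Y" and uY: "AE \<omega> in M. u t x \<omega> = J t x + Y \<omega>"
      using mild_eq[OF t] by blast
    have [measurable]: "Y \<in> borel_measurable M" using wi by (simp add: walsh_integral_def)
    \<comment> \<open>The absolute value keeps \<delta> between 0 and 1 also at times after t; on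
      the cone it is just t - s.\<close>
    define \<delta> where "\<delta> = (\<lambda>z :: real \<times> real. d * exp (- \<bar>t - fst z\<bar>))"
    have \<delta>m: "\<delta> \<in> borel_measurable lplane" unfolding \<delta>_def by measurable
    have \<delta>01: "0 < \<delta> z" "\<delta> z \<le> 1" for z
      using pos(2,3) mult_mono[of d 1 "exp (- \<bar>t - fst z\<bar>)" 1] by (auto simp: \<delta>_def)
    have \<delta>k: "(1 / \<delta> z)^k = (1 / d)^k * exp (real k * (t - fst z))" if "z \<in> cone \<kappa> t x" for z
    proof -
      have "\<bar>t - fst z\<bar> = t - fst z" using that by (auto simp: cone_def)
      then have "1 / \<delta> z = (1 / d) * exp (t - fst z)" by (simp add: \<delta>_def exp_minus field_simps)
      then show ?thesis by (simp add: power_mult_distrib exp_of_nat_mult power_divide)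
    qed
    have D: "(1 / \<delta> z)^k \<le> (1 / d)^k * exp (real k * t)" if "z \<in> cone \<kappa> t x" for z
    proof -
      have "0 \<le> fst z" using that by (auto simp: cone_def)
      then have "exp (real k * (t - fst z)) \<le> exp (real k * t)" by (simp add: mult_left_mono)
      then show ?thesis unfolding \<delta>k[OF that] using pos by (intro mult_left_mono) auto
    qed
    have small: "ennreal (4^(2*k+2)) * (\<integral>\<^sup>+ z. indicator (cone \<kappa> t x) z * ennreal (\<delta> z) \<partial>lplane) \<le> ennreal (1/2)"
    proof -
      have "(\<integral>\<^sup>+ z. indicator (cone \<kappa> t x) z * ennreal (\<delta> z) \<partial>lplane)
         = (\<integral>\<^sup>+ z. ennreal d * (indicator (cone \<kappa> t x) z * ennreal (exp (- 1 * (t - fst z)))) \<partial>lplane)"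
      proof (rule nn_integral_cong)
        fix z :: "real \<times> real"
        show "indicator (cone \<kappa> t x) z * ennreal (\<delta> z) = ennreal d * (indicator (cone \<kappa> t x) z * ennreal (exp (- 1 * (t - fst z))))"
          using pos(2) by (auto simp: \<delta>_def cone_def indicator_def ennreal_mult)
      qed
      also have "\<dots> = ennreal d * (\<integral>\<^sup>+ z. indicator (cone \<kappa> t x) z * ennreal (exp (- 1 * (t - fst z))) \<partial>lplane)"
        by (rule nn_integral_cmult) measurable
      also have "\<dots> \<le> ennreal d * ennreal (2 * \<kappa> / 1\<^sup>2)"
        by (intro mult_left_mono nn_integral_cone_exp kappa) auto
      also have "\<dots> = ennreal (d * (2 * \<kappa>))" using pos kappa by (simp add: ennreal_mult)
      finally have "ennreal c * (\<integral>\<^sup>+ z. indicator (cone \<kappa> t x) z * ennreal (\<delta> z) \<partial>lplane) \<le> ennreal c * ennreal (d * (2 * \<kappa>))"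
        by (intro mult_left_mono) auto
      also have "\<dots> = ennreal (c * (d * (2 * \<kappa>)))" using pos kappa by (intro ennreal_mult[symmetric]) auto
      also have "\<dots> \<le> ennreal (1/2)"
      proof (rule ennreal_leI)
        have "d \<le> 1 / (4 * \<kappa> * c)" by (simp add: d_def)
        then have "c * (2 * \<kappa>) * d \<le> c * (2 * \<kappa>) * (1 / (4 * \<kappa> * c))" using pos kappa by (intro mult_left_mono) auto
        also have "\<dots> = 1/2" using pos kappa by (simp add: field_simps)
        finally show "c * (d * (2 * \<kappa>)) \<le> 1/2" by (simp add: mult_ac)
      qed
      finally show ?thesis by (simp add: c_def)
    qed
    have "(\<integral>\<^sup>+ \<omega>. ennreal (?\<phi> (Y \<omega>)) \<partial>M) \<le>
      ennreal C1 * (\<integral>\<^sup>+ (\<omega>, s, y). ennreal ((1 / \<delta> (s, y))^k * ?\<phi> (integrand t x \<omega> s y)) \<partial>MP)"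
      unfolding C1_def
      by (rule walsh_trunc_bound[where Q = "cone \<kappa> t x", OF k K wi integrand_measurable _ _ cone_measurable \<delta>m \<delta>01 D small])
        (auto simp: integrand_eq indicator_def cone_def)
    also have "(\<integral>\<^sup>+ (\<omega>, s, y). ennreal ((1 / \<delta> (s, y))^k * ?\<phi> (integrand t x \<omega> s y)) \<partial>MP)
       \<le> (\<integral>\<^sup>+ z. indicator (cone \<kappa> t x) (snd z) * ennreal (e * exp (real k * (t - fst (snd z)))) * ennreal (?\<phi> (u (fst (snd z)) (snd (snd z)) (fst z))) \<partial>MP)"
    proof (rule nn_integral_mono)
      fix z :: "'a \<times> real \<times> real"
      obtain \<omega> s y where z: "z = (\<omega>, s, y)" by (cases z)
      have "ennreal ((1 / \<delta> (s, y))^k * ?\<phi> (integrand t x \<omega> s y)) \<le>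
        indicator (cone \<kappa> t x) (s, y) * ennreal (e * exp (real k * (t - s))) * ennreal (?\<phi> (u s y \<omega>))"
      proof (cases "(s, y) \<in> cone \<kappa> t x")
        case True
        have "\<bar>\<sigma> (u s y \<omega>) / 2\<bar> \<le> \<bar>Lip * u s y \<omega>\<bar>"
          using sigma_upper(1)[of "u s y \<omega>"] sigma_upper(2) by (simp add: abs_mult)
        then have "?\<phi> (integrand t x \<omega> s y) \<le> ?\<phi> (Lip * u s y \<omega>)"
          using True by (simp add: integrand_eq trunc_pow_mono[OF K])
        also have "\<dots> \<le> Lip^(2*k+2) * ?\<phi> (u s y \<omega>)" by (rule trunc_pow_scale[OF K sigma_upper(2)])
        finally have "(1 / \<delta> (s, y))^k * ?\<phi> (integrand t x \<omega> s y) \<le> ((1 / d)^k * exp (real k * (t - s))) * (Lip^(2*k+2) * ?\<phi> (u s y \<omega>))"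
          unfolding \<delta>k[OF True] using pos(2) by (simp add: mult_left_mono)
        also have "\<dots> = (e * exp (real k * (t - s))) * ?\<phi> (u s y \<omega>)"
          by (simp only: e_def mult_ac fst_conv)
        finally show ?thesis
          using True e trunc_pow_nonneg[OF K] by (simp add: ennreal_leI flip: ennreal_mult)
      qed (simp add: integrand_eq trunc_pow_def)
      then show "(case z of (\<omega>, s, y) \<Rightarrow> ennreal ((1 / \<delta> (s, y))^k * ?\<phi> (integrand t x \<omega> s y))) \<le>
        indicator (cone \<kappa> t x) (snd z) * ennreal (e * exp (real k * (t - fst (snd z)))) * ennreal (?\<phi> (u (fst (snd z)) (snd (snd z)) (fst z)))"
        by (simp only: z prod.case fst_conv snd_conv)
    qed
    also have "\<dots> = (\<integral>\<^sup>+ z. indicator (cone \<kappa> t x) z * ennreal (e * exp (real k * (t - fst z))) * trunc_moment k K (fst z) (snd z) \<partial>lplane)"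
      by (rule nn_integral_cone_Fubini) measurable
    also have "\<dots> = (\<integral>\<^sup>+ z. ennreal e * (indicator (cone \<kappa> t x) z * ennreal (exp (real k * (t - fst z))) * trunc_moment k K (fst z) (snd z)) \<partial>lplane)"
      using e by (intro nn_integral_cong) (simp add: ennreal_mult mult_ac)
    also have "\<dots> = ennreal e * ?I"
      by (intro nn_integral_cmult cone_moment_measurable) measurable
    finally have EY: "(\<integral>\<^sup>+ \<omega>. ennreal (?\<phi> (Y \<omega>)) \<partial>M) \<le> ennreal C1 * (ennreal e * ?I)"
      by (simp add: mult_left_mono)
    have "trunc_moment k K t x = (\<integral>\<^sup>+ \<omega>. ennreal (?\<phi> (J t x + Y \<omega>)) \<partial>M)"
      by (rule nn_integral_cong_AE) (use uY in eventually_elim, simp)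
    also have "\<dots> \<le> (\<integral>\<^sup>+ \<omega>. ennreal (b * ?\<phi> (J t x)) + ennreal b * ennreal (?\<phi> (Y \<omega>)) \<partial>M)"
    proof (rule nn_integral_mono)
      fix \<omega>
      have "ennreal (?\<phi> (J t x + Y \<omega>)) \<le> ennreal (b * ?\<phi> (J t x) + b * ?\<phi> (Y \<omega>))"
        using trunc_pow_add[OF K, of k "J t x" "Y \<omega>"] by (intro ennreal_leI) (simp add: b_def distrib_left)
      then show "ennreal (?\<phi> (J t x + Y \<omega>)) \<le> ennreal (b * ?\<phi> (J t x)) + ennreal b * ennreal (?\<phi> (Y \<omega>))"
        using pos trunc_pow_nonneg[OF K] by (simp add: ennreal_mult)
    qed
    also have "\<dots> = ennreal (b * ?\<phi> (J t x)) + ennreal b * (\<integral>\<^sup>+ \<omega>. ennreal (?\<phi> (Y \<omega>)) \<partial>M)"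
      by (subst nn_integral_add) (auto simp: nn_integral_cmult emeasure_space_1)
    also have "\<dots> \<le> ennreal (C * ?\<phi> (J t x)) + ennreal C * ?I"
    proof (rule add_mono)
      show "ennreal (b * ?\<phi> (J t x)) \<le> ennreal (C * ?\<phi> (J t x))"
        using Cpos trunc_pow_nonneg[OF K] by (intro ennreal_leI mult_right_mono) auto
      have "ennreal b * (\<integral>\<^sup>+ \<omega>. ennreal (?\<phi> (Y \<omega>)) \<partial>M) \<le> ennreal b * (ennreal C1 * (ennreal e * ?I))"
        by (intro mult_left_mono EY) auto
      also have "\<dots> = ennreal C2 * ?I"
        using pos e by (simp add: C2_def ennreal_mult mult.assoc)
      also have "ennreal C2 * ?I \<le> ennreal C * ?I" using Cpos by (intro mult_right_mono ennreal_leI) auto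
      finally show "ennreal b * (\<integral>\<^sup>+ \<omega>. ennreal (?\<phi> (Y \<omega>)) \<partial>M) \<le> ennreal C * ?I" .
    qed
    finally show ?thesis .
  qed
  then show ?thesis using Cpos(1) by blast
qed

lemma trunc_pow_SUP:
  fixes a :: real
  shows "(SUP n. ennreal (trunc_pow k (real (Suc n)) a)) = ennreal (a^(2*k+2))"
proof (rule antisym)
  show "(SUP n. ennreal (trunc_pow k (real (Suc n)) a)) \<le> ennreal (a^(2*k+2))"
    by (intro SUP_least ennreal_leI trunc_pow_le_power) simp
  obtain n where n: "a^(2*k) \<le> real n" using real_arch_simple by blast
  then have "trunc_pow k (real (Suc n)) a = a^(2*k+2)"
    by (simp add: trunc_pow_def trunc_weight_def power2_eq_square)
  then show "ennreal (a^(2*k+2)) \<le> (SUP n. ennreal (trunc_pow k (real (Suc n)) a))"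
    by (intro SUP_upper2[of n]) auto
qed

text \<open>The constant is given a name because the rate \<beta> of
  \<open>weighted_moment_bound\<close> has to be chosen in terms of it.\<close>

definition moment_const :: "nat \<Rightarrow> real" where
  "moment_const k = (SOME C. 0 \<le> C \<and> (\<forall>K>0. \<forall>t\<ge>0. \<forall>x.
    trunc_moment k K t x \<le> ennreal (C * trunc_pow k K (J t x)) +
      ennreal C * trunc_cone_moment k K t x))"

lemma moment_const:
  assumes "1 \<le> k"
  shows "0 \<le> moment_const k"
    and "0 < K \<Longrightarrow> 0 \<le> t \<Longrightarrow>
    trunc_moment k K t x \<le> ennreal (moment_const k * trunc_pow k K (J t x)) +
      ennreal (moment_const k) * trunc_cone_moment k K t x"
  using someI_ex[OF trunc_moment_ineq[OF assms], folded moment_const_def] by simp_all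

text \<open>The weighted supremum over \<open>[0, T]\<close> is finite thanks to the truncation, so it can be absorbed
  on the left-hand side; the bound does not depend on the truncation level, on \<open>T\<close> or on \<open>R\<close>.\<close>

lemma weighted_moment_bound:
  fixes w :: "real \<Rightarrow> real \<Rightarrow> real"
  assumes k: "1 \<le> k"
    and c: "0 \<le> c" "c + real k < \<beta>" "moment_const k * (2 * \<kappa> / (\<beta> - c - real k)\<^sup>2) \<le> 1/2"
    and w: "\<And>t x. 0 \<le> w t x \<and> w t x \<le> R"
    and wcone: "\<And>s t x y. 0 \<le> s \<Longrightarrow> s \<le> t \<Longrightarrow> \<bar>y - x\<bar> \<le> \<kappa> * (t - s) \<Longrightarrow> w t x \<le> exp (c * (t - s)) * w s y"
    and A: "\<And>t x. 0 \<le> t \<Longrightarrow> exp (- \<beta> * t) * w t x * J t x ^ (2*k+2) \<le> A"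
    and T: "0 \<le> T"
  shows "ennreal (exp (- \<beta> * T) * w T X) * (\<integral>\<^sup>+ \<omega>. ennreal (u T X \<omega> ^ (2*k+2)) \<partial>M) \<le> 2 * ennreal (moment_const k * A)"
proof -
  define C where "C = moment_const k"
  note C = moment_const(1)[OF k, folded C_def] and ineq = moment_const(2)[OF k, folded C_def] and c = c[folded C_def]
  \<comment> \<open>The decay left over from \<beta> after paying the rate \<open>c\<close> for
    moving the weight along the cone and the rate \<open>k\<close> for \<delta>^(-k). The hypothesis
    on \<open>moment_const\<close> makes the renewal kernel with this decay a contraction by
    1/2.\<close>
  define a where "a = \<beta> - c - real k"
  have a: "0 < a" using c by (simp add: a_def)
  have trunc: "ennreal (exp (- \<beta> * T) * w T X) * trunc_moment k K T X \<le> 2 * ennreal (C * A)" if K: "0 < K" for K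
  proof -
    define g where "g = (\<lambda>t x. ennreal (exp (- \<beta> * t) * w t x) * trunc_moment k K t x)"
    define S where "S = (SUP z\<in>{0..T} \<times> UNIV. g (fst z) (snd z))"
    have gS: "g t x \<le> S" if "0 \<le> t" "t \<le> T" for t x
      unfolding S_def by (rule SUP_upper2[of "(t, x)"]) (use that in auto)
    obtain D where D: "0 \<le> D" "\<And>t x. t \<in> {0..T} \<Longrightarrow> second_moment t x \<le> ennreal D"
      using second_moment_bounded[of T] by blast
    have R: "0 \<le> R" using w[of 0 0] by linarith
    have "S \<le> ennreal R * (ennreal K * ennreal D)"
      unfolding S_def
    proof (rule SUP_least)
      fix z :: "real \<times> real" assume z: "z \<in> {0..T} \<times> UNIV"
      obtain t x where tx: "z = (t, x)" by (cases z)
      have t: "t \<in> {0..T}" "0 \<le> t" using z tx by auto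
      have [measurable]: "u t x \<in> borel_measurable M" by (rule u_measurable[OF t(2)])
      have "trunc_moment k K t x \<le> (\<integral>\<^sup>+ \<omega>. ennreal K * ennreal ((u t x \<omega>)\<^sup>2) \<partial>M)"
        using trunc_pow_le_square[OF K, of k] K by (intro nn_integral_mono) (simp add: ennreal_mult[symmetric] ennreal_leI)
      also have "\<dots> = ennreal K * second_moment t x" by (rule nn_integral_cmult) measurable
      also have "\<dots> \<le> ennreal K * ennreal D" by (intro mult_left_mono D t) simp
      finally have 1: "trunc_moment k K t x \<le> ennreal K * ennreal D" .
      have "0 \<le> \<beta>" using c by simp
      then have "exp (- \<beta> * t) \<le> 1" using t by simp
      then have "exp (- \<beta> * t) * w t x \<le> 1 * R" using w[of t x] by (intro mult_mono) auto
      then have "ennreal (exp (- \<beta> * t) * w t x) \<le> ennreal R" by (intro ennreal_leI) simp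
      then show "g (fst z) (snd z) \<le> ennreal R * (ennreal K * ennreal D)"
        unfolding g_def tx fst_conv snd_conv by (intro mult_mono 1) auto
    qed
    also have "\<dots> < top" by (simp add: ennreal_mult_less_top)
    finally have Sfin: "S < top" .
    have "S \<le> ennreal (1/2) * S + ennreal (C * A)"
      unfolding S_def
    proof (rule SUP_least)
      fix z :: "real \<times> real" assume z: "z \<in> {0..T} \<times> UNIV"
      obtain t x where tx: "z = (t, x)" by (cases z)
      have t: "t \<in> {0..T}" "0 \<le> t" "t \<le> T" using z tx by auto
      let ?I = "trunc_cone_moment k K t x"
      let ?e = "exp (- \<beta> * t) * w t x"
      have e: "0 \<le> ?e" using w by simp
      have "g t x \<le> ennreal ?e * (ennreal (C * trunc_pow k K (J t x)) + ennreal C * ?I)"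
        unfolding g_def by (intro mult_left_mono ineq K t) simp
      also have "\<dots> = ennreal ?e * ennreal (C * trunc_pow k K (J t x)) + ennreal C * (ennreal ?e * ?I)"
        by (simp add: distrib_left mult_ac)
      also have "\<dots> \<le> ennreal (C * A) + ennreal C * (S * ennreal (2 * \<kappa> / a\<^sup>2))"
      proof (intro add_mono mult_left_mono)
        have "?e * trunc_pow k K (J t x) \<le> ?e * J t x ^ (2*k+2)" by (intro mult_left_mono trunc_pow_le_power K e)
        also have "\<dots> \<le> A" by (rule A[OF t(2)])
        finally have "C * (?e * trunc_pow k K (J t x)) \<le> C * A" by (intro mult_left_mono C)
        then have "ennreal (?e * (C * trunc_pow k K (J t x))) \<le> ennreal (C * A)" by (intro ennreal_leI) (simp add: mult_ac)
        then show "ennreal ?e * ennreal (C * trunc_pow k K (J t x)) \<le> ennreal (C * A)"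
          using e C trunc_pow_nonneg[OF K] by (subst ennreal_mult[symmetric]) auto
        show "ennreal ?e * ?I \<le> S * ennreal (2 * \<kappa> / a\<^sup>2)"
        proof -
          have m: "(\<lambda>z. indicator (cone \<kappa> t x) z * ennreal (exp (- a * (t - fst z)))) \<in> borel_measurable lplane"
            by measurable
          have meas: "(\<lambda>z. indicator (cone \<kappa> t x) z * ennreal (exp (real k * (t - fst z))) *
             trunc_moment k K (fst z) (snd z)) \<in> borel_measurable lplane"
            by (rule cone_moment_measurable) measurable
          have "ennreal ?e * ?I = (\<integral>\<^sup>+ z. ennreal ?e * (indicator (cone \<kappa> t x) z * ennreal (exp (real k * (t - fst z))) *
             trunc_moment k K (fst z) (snd z)) \<partial>lplane)"
            by (rule nn_integral_cmult[symmetric, OF meas])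
          also have "\<dots> \<le> (\<integral>\<^sup>+ z. S * (indicator (cone \<kappa> t x) z * ennreal (exp (- a * (t - fst z)))) \<partial>lplane)"
          proof (rule nn_integral_mono)
            fix z :: "real \<times> real"
            obtain s y where sy: "z = (s, y)" by (cases z)
            let ?E = "\<integral>\<^sup>+ \<omega>. ennreal (trunc_pow k K (u s y \<omega>)) \<partial>M"
            show "ennreal ?e * (indicator (cone \<kappa> t x) z * ennreal (exp (real k * (t - fst z))) *
             trunc_moment k K (fst z) (snd z)) \<le> S * (indicator (cone \<kappa> t x) z * ennreal (exp (- a * (t - fst z))))"
            proof (cases "z \<in> cone \<kappa> t x")
              case True
              then have s: "0 \<le> s" "s \<le> t" "\<bar>y - x\<bar> \<le> \<kappa> * (t - s)" by (auto simp: sy cone_def)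
              have "?e * exp (real k * (t - s)) \<le> exp (- \<beta> * t) * (exp (c * (t - s)) * w s y) * exp (real k * (t - s))"
                by (intro mult_right_mono mult_left_mono wcone s) auto
              also have "\<dots> = (exp (- \<beta> * t) * exp (c * (t - s)) * exp (real k * (t - s))) * w s y" by (simp only: mult_ac)
              also have "exp (- \<beta> * t) * exp (c * (t - s)) * exp (real k * (t - s)) = exp (- a * (t - s)) * exp (- \<beta> * s)"
                unfolding exp_add[symmetric] by (simp add: a_def algebra_simps)
              finally have "?e * exp (real k * (t - s)) \<le> exp (- a * (t - s)) * (exp (- \<beta> * s) * w s y)" by (simp only: mult.assoc)
              then have "ennreal (?e * exp (real k * (t - s))) * ?E \<le> ennreal (exp (- a * (t - s)) * (exp (- \<beta> * s) * w s y)) * ?E"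
                by (intro mult_right_mono ennreal_leI) auto
              also have "ennreal (exp (- a * (t - s)) * (exp (- \<beta> * s) * w s y)) = ennreal (exp (- a * (t - s))) * ennreal (exp (- \<beta> * s) * w s y)"
                using w by (intro ennreal_mult) auto
              also have "ennreal (exp (- a * (t - s))) * ennreal (exp (- \<beta> * s) * w s y) * ?E = ennreal (exp (- a * (t - s))) * g s y"
                by (simp only: g_def mult.assoc)
              also have "\<dots> \<le> ennreal (exp (- a * (t - s))) * S"
                using s t by (intro mult_left_mono gS) auto
              finally have "ennreal ?e * ennreal (exp (real k * (t - s))) * ?E \<le> S * ennreal (exp (- a * (t - s)))"
                using e by (simp add: ennreal_mult mult.commute)
              then show ?thesis using True by (simp add: sy mult.assoc)
            qed simp
          qed
          also have "\<dots> = S * (\<integral>\<^sup>+ z. indicator (cone \<kappa> t x) z * ennreal (exp (- a * (t - fst z))) \<partial>lplane)"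
            by (rule nn_integral_cmult[OF m])
          also have "\<dots> \<le> S * ennreal (2 * \<kappa> / a\<^sup>2)"
            by (intro mult_left_mono nn_integral_cone_exp kappa a) simp
          finally show ?thesis .
        qed
      qed simp
      also have "ennreal C * (S * ennreal (2 * \<kappa> / a\<^sup>2)) = ennreal (C * (2 * \<kappa> / a\<^sup>2)) * S"
        using C kappa by (subst ennreal_mult) (auto simp: mult_ac)
      also have "\<dots> \<le> ennreal (1/2) * S" using c(3) by (intro mult_right_mono ennreal_leI) (auto simp: a_def)
      finally show "g (fst z) (snd z) \<le> ennreal (1/2) * (SUP z\<in>{0..T} \<times> UNIV. g (fst z) (snd z)) + ennreal (C * A)"
        by (simp add: tx S_def add.commute add_left_mono)
    qed
    then have "S \<le> 2 * ennreal (C * A)" by (rule ennreal_absorb_half) (use Sfin in auto)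
    then show ?thesis using gS[OF T order_refl, of X] by (simp add: g_def)
  qed
  have [measurable]: "u T X \<in> borel_measurable M" by (rule u_measurable[OF T])
  \<comment> \<open>Removal of the truncation by monotone convergence; \<open>Suc n\<close> keeps
    the level positive.\<close>
  have inc: "incseq (\<lambda>n \<omega>. ennreal (trunc_pow k (real (Suc n)) (u T X \<omega>)))"
    by (intro incseq_SucI le_funI ennreal_leI) (auto simp: trunc_pow_def trunc_weight_def intro!: mult_right_mono)
  have "(\<integral>\<^sup>+ \<omega>. ennreal (u T X \<omega> ^ (2*k+2)) \<partial>M) = (\<integral>\<^sup>+ \<omega>. (SUP n. ennreal (trunc_pow k (real (Suc n)) (u T X \<omega>))) \<partial>M)"
    by (simp only: trunc_pow_SUP)
  also have "\<dots> = (SUP n. \<integral>\<^sup>+ \<omega>. ennreal (trunc_pow k (real (Suc n)) (u T X \<omega>)) \<partial>M)"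
    by (rule nn_integral_monotone_convergence_SUP[OF inc]) measurable
  finally have "ennreal (exp (- \<beta> * T) * w T X) * (\<integral>\<^sup>+ \<omega>. ennreal (u T X \<omega> ^ (2*k+2)) \<partial>M)
     = (SUP n. ennreal (exp (- \<beta> * T) * w T X) * (\<integral>\<^sup>+ \<omega>. ennreal (trunc_pow k (real (Suc n)) (u T X \<omega>)) \<partial>M))"
    by (simp add: SUP_mult_left_ennreal)
  also have "\<dots> \<le> 2 * ennreal (C * A)" by (intro SUP_least trunc) simp
  finally show ?thesis by (simp only: C_def)
qed

text \<open>Each claim keeps one of the two nonnegative terms of the second-moment estimate. In the
  second, 16 is the factor 4 of that estimate times the 4 from squaring the value 1/2 of
  \<open>Gamma\<close>.\<close>

lemma second_moment_lower:
  assumes t: "0 \<le> t"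
  shows "ennreal ((J t x)\<^sup>2) \<le> 2 * second_moment t x"
    and "ennreal (ell\<^sup>2) * (\<integral>\<^sup>+ z. indicator (cone \<kappa> t x) z * second_moment (fst z) (snd z) \<partial>lplane)
      \<le> 16 * second_moment t x"
proof -
  let ?m = "\<integral>\<^sup>+ \<omega>. ennreal ((u t x \<omega>)\<^sup>2) \<partial>M"
  let ?I = "\<integral>\<^sup>+ z. indicator (cone \<kappa> t x) z * second_moment (fst z) (snd z) \<partial>lplane"
  obtain Y where wi: "walsh_integral M F W (integrand t x) Y" and uY: "AE \<omega> in M. u t x \<omega> = J t x + Y \<omega>"
    using mild_eq[OF t] by blast
  have "?m = (\<integral>\<^sup>+ \<omega>. ennreal ((J t x + Y \<omega>)\<^sup>2) \<partial>M)"
    by (rule nn_integral_cong_AE) (use uY in eventually_elim, simp)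
  moreover have "2 * ennreal ((J t x)\<^sup>2) + (\<integral>\<^sup>+ (\<omega>, s, y). ennreal ((integrand t x \<omega> s y)\<^sup>2) \<partial>MP) \<le> 4 * (\<integral>\<^sup>+ \<omega>. ennreal ((J t x + Y \<omega>)\<^sup>2) \<partial>M)"
    by (rule walsh_second_moment_lower[OF wi integrand_measurable]) (auto simp: integrand_eq indicator_def cone_def)
  ultimately have main: "2 * ennreal ((J t x)\<^sup>2) + (\<integral>\<^sup>+ (\<omega>, s, y). ennreal ((integrand t x \<omega> s y)\<^sup>2) \<partial>MP) \<le> 4 * ?m" by simp
  have "2 * ennreal ((J t x)\<^sup>2) \<le> 4 * ?m"
    by (rule order_trans[OF _ main]) (rule add_increasing2, simp_all)
  also have "4 * ?m = 2 * (2 * ?m)" by (simp add: mult.assoc[symmetric])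
  finally have "2 * ennreal ((J t x)\<^sup>2) \<le> 2 * (2 * ?m)" .
  then show "ennreal ((J t x)\<^sup>2) \<le> 2 * ?m"
    by (subst (asm) ennreal_mult_le_mult_iff) simp_all
  have m: "(\<lambda>z. indicator (cone \<kappa> t x) z * 1 * second_moment (fst z) (snd z)) \<in> borel_measurable lplane"
    by (rule cone_moment_measurable) measurable
  have "ennreal (ell\<^sup>2 / 4) * ?I = (\<integral>\<^sup>+ z. ennreal (ell\<^sup>2 / 4) * (indicator (cone \<kappa> t x) z * 1 * second_moment (fst z) (snd z)) \<partial>lplane)"
    using nn_integral_cmult[OF m, of "ennreal (ell\<^sup>2 / 4)"] by simp
  also have "\<dots> = (\<integral>\<^sup>+ z. indicator (cone \<kappa> t x) z * ennreal (ell\<^sup>2 / 4) * second_moment (fst z) (snd z) \<partial>lplane)"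
    by (rule nn_integral_cong) (simp only: mult_ac mult_1_right mult_1_left)
  also have "\<dots> = (\<integral>\<^sup>+ z. indicator (cone \<kappa> t x) (snd z) * ennreal (ell\<^sup>2 / 4) * ennreal ((u (fst (snd z)) (snd (snd z)) (fst z))\<^sup>2) \<partial>MP)"
    by (rule nn_integral_cone_Fubini[symmetric]) measurable
  also have "\<dots> \<le> (\<integral>\<^sup>+ z. ennreal ((integrand t x (fst z) (fst (snd z)) (snd (snd z)))\<^sup>2) \<partial>MP)"
  proof (rule nn_integral_mono)
    fix z :: "'a \<times> real \<times> real"
    let ?u = "u (fst (snd z)) (snd (snd z)) (fst z)"
    have "(ell * \<bar>?u\<bar>)\<^sup>2 \<le> \<bar>\<sigma> ?u\<bar>\<^sup>2" using sigma_lower by (intro power_mono) auto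
    then have "ell\<^sup>2 / 4 * ?u\<^sup>2 \<le> (\<sigma> ?u / 2)\<^sup>2" by (simp add: power_mult_distrib power_divide)
    then have "ennreal (ell\<^sup>2 / 4) * ennreal (?u\<^sup>2) \<le> ennreal ((\<sigma> ?u / 2)\<^sup>2)"
      by (subst ennreal_mult[symmetric]) (auto intro: ennreal_leI)
    then show "indicator (cone \<kappa> t x) (snd z) * ennreal (ell\<^sup>2 / 4) * ennreal (?u\<^sup>2)
      \<le> ennreal ((integrand t x (fst z) (fst (snd z)) (snd (snd z)))\<^sup>2)"
      by (auto simp: integrand_eq indicator_def)
  qed
  also have "\<dots> \<le> 4 * ?m"
    by (rule order_trans[OF _ main[unfolded case_prod_unfold]]) (rule add_increasing, simp_all)
  finally have "4 * (ennreal (ell\<^sup>2 / 4) * ?I) \<le> 4 * (4 * ?m)" by (intro mult_left_mono) auto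
  moreover have "4 * ennreal (ell\<^sup>2 / 4) = ennreal (ell\<^sup>2)"
    using ennreal_mult[of 4 "ell\<^sup>2 / 4"] by simp
  ultimately show "ennreal (ell\<^sup>2) * ?I \<le> 16 * ?m" by (simp add: mult.assoc[symmetric])
qed

end

section \<open>Growth indices\<close>

lemma D_exp_measurable:
  assumes "h \<in> D_exp" shows "h \<in> borel_measurable borel"
  using assms unfolding D_exp_def lower_semicont_def
  by (auto simp: borel_measurable_iff_greater)

lemma D_exp_bound:
  assumes "h \<in> D_exp"
  shows "\<exists>B \<rho>. 0 < B \<and> 0 < \<rho> \<and> (\<forall>x. h x \<le> B * exp (- \<rho> * \<bar>x\<bar>))"
proof -
  obtain \<rho> where \<rho>: "0 < \<rho>" "h \<in> O[at_infinity](\<lambda>x. exp (- \<rho> * \<bar>x\<bar>))" and bd: "bounded (range h)"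
    using assms by (auto simp: D_exp_def)
  obtain c where c: "0 < c" "eventually (\<lambda>x. norm (h x) \<le> c * norm (exp (- \<rho> * \<bar>x\<bar>))) at_infinity"
    using landau_o.bigE[OF \<rho>(2)] by blast
  obtain b where b: "\<And>x. b \<le> norm x \<Longrightarrow> norm (h x) \<le> c * norm (exp (- \<rho> * \<bar>x\<bar>))"
    using c(2) unfolding eventually_at_infinity by blast
  obtain B0 where B0: "0 < B0" "\<And>x. norm (h x) \<le> B0"
    using bd unfolding bounded_pos by auto
  \<comment> \<open>The exponential bound holds only for \<bar>x\<bar> at least \<open>b\<close>; on
    the remaining bounded set the supremum \<open>B0\<close> is inflated by the worst value of the
    exponential.\<close>
  define B where "B = max c (B0 * exp (\<rho> * \<bar>b\<bar>))"
  have "h x \<le> B * exp (- \<rho> * \<bar>x\<bar>)" for x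
  proof (cases "b \<le> \<bar>x\<bar>")
    case True
    then have "h x \<le> c * exp (- \<rho> * \<bar>x\<bar>)" using b[of x] by simp
    also have "\<dots> \<le> B * exp (- \<rho> * \<bar>x\<bar>)" by (intro mult_right_mono) (auto simp: B_def)
    finally show ?thesis .
  next
    case False
    then have "\<rho> * \<bar>x\<bar> \<le> \<rho> * \<bar>b\<bar>" using \<rho>(1) by (intro mult_left_mono) auto
    then have "1 \<le> exp (\<rho> * \<bar>b\<bar>) * exp (- \<rho> * \<bar>x\<bar>)" by (simp add: exp_add[symmetric])
    then have "B0 * 1 \<le> B0 * (exp (\<rho> * \<bar>b\<bar>) * exp (- \<rho> * \<bar>x\<bar>))" using B0(1) by (intro mult_left_mono) auto
    also have "\<dots> = (B0 * exp (\<rho> * \<bar>b\<bar>)) * exp (- \<rho> * \<bar>x\<bar>)" by simp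
    also have "\<dots> \<le> B * exp (- \<rho> * \<bar>x\<bar>)" by (intro mult_right_mono) (auto simp: B_def)
    finally show ?thesis using B0(2)[of x] by simp
  qed
  moreover have "0 < B" using c(1) by (simp add: B_def less_max_iff_disj)
  ultimately show ?thesis using \<rho>(1) by blast
qed

text \<open>The tangent to z^q at z = 1, obtained from Young's inequality for the exponents q and q
  / (q - 1) with second factor 1.\<close>

lemma mult_powr_tangent:
  fixes q z :: real
  assumes "1 \<le> q" "0 \<le> z" shows "q * z \<le> z powr q + (q - 1)"
proof (cases "z = 0")
  case False
  then have "0 < z powr q" using assms by simp
  then have "(z powr q) powr (1/q) * 1 powr (1 - 1/q) \<le> (1/q) * z powr q + (1 - 1/q) * 1"
    using assms by (intro Youngs_inequality_0) auto
  then have "z \<le> (1/q) * z powr q + (1 - 1/q)" using assms False by (simp add: powr_powr)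
  then have "q * z \<le> q * ((1/q) * z powr q + (1 - 1/q))" using assms by (intro mult_left_mono) auto
  also have "\<dots> = z powr q + (q - 1)" using assms by (simp add: algebra_simps)
  finally show ?thesis .
qed (use assms in auto)

text \<open>Jensen's inequality by integrating a tangent, after normalising X^2 by \<open>a\<close>.
  This form needs no integrability, so an infinite moment causes no trouble, and it starts from a
  lower bound on the second moment rather than its value.\<close>

lemma (in prob_space) powr_moment_lower:
  fixes X :: "'a \<Rightarrow> real"
  assumes X [measurable]: "X \<in> borel_measurable M" and \<nu>: "2 \<le> \<nu>" and a: "0 < a"
    and m: "ennreal a \<le> (\<integral>\<^sup>+ \<omega>. ennreal ((X \<omega>)\<^sup>2) \<partial>M)"
  shows "ennreal (a powr (\<nu> / 2)) \<le> (\<integral>\<^sup>+ \<omega>. ennreal (\<bar>X \<omega>\<bar> powr \<nu>) \<partial>M)"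
proof -
  define q where "q = \<nu> / 2"
  have q: "1 \<le> q" using \<nu> by (simp add: q_def)
  let ?Z = "\<integral>\<^sup>+ \<omega>. ennreal (((X \<omega>)\<^sup>2 / a) powr q) \<partial>M"
  have "ennreal (q / a) * ennreal a \<le> ennreal (q / a) * (\<integral>\<^sup>+ \<omega>. ennreal ((X \<omega>)\<^sup>2) \<partial>M)"
    by (intro mult_left_mono m) simp
  also have "\<dots> = (\<integral>\<^sup>+ \<omega>. ennreal (q / a) * ennreal ((X \<omega>)\<^sup>2) \<partial>M)"
    by (rule nn_integral_cmult[symmetric]) measurable
  also have "\<dots> \<le> (\<integral>\<^sup>+ \<omega>. ennreal (((X \<omega>)\<^sup>2 / a) powr q) + ennreal (q - 1) \<partial>M)"
  proof (rule nn_integral_mono)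
    fix \<omega>
    have "q * ((X \<omega>)\<^sup>2 / a) \<le> ((X \<omega>)\<^sup>2 / a) powr q + (q - 1)"
      using a by (intro mult_powr_tangent q) simp
    then have "ennreal (q / a * (X \<omega>)\<^sup>2) \<le> ennreal (((X \<omega>)\<^sup>2 / a) powr q + (q - 1))"
      by (intro ennreal_leI) simp
    then show "ennreal (q / a) * ennreal ((X \<omega>)\<^sup>2) \<le> ennreal (((X \<omega>)\<^sup>2 / a) powr q) + ennreal (q - 1)"
      using q a by (simp add: ennreal_mult[symmetric])
  qed
  also have "\<dots> = ?Z + ennreal (q - 1)"
    by (subst nn_integral_add) (auto simp: emeasure_space_1)
  finally have "ennreal (q / a) * ennreal a \<le> ?Z + ennreal (q - 1)" .
  moreover have "ennreal (q / a) * ennreal a = 1 + ennreal (q - 1)"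
    using q a by (simp add: ennreal_mult[symmetric] ennreal_plus[symmetric] ennreal_1[symmetric] del: ennreal_plus ennreal_1)
  ultimately have "1 \<le> ?Z" by (simp add: add.commute)
  then have "ennreal (a powr q) * 1 \<le> ennreal (a powr q) * ?Z" by (intro mult_left_mono) auto
  also have "\<dots> = (\<integral>\<^sup>+ \<omega>. ennreal (a powr q) * ennreal (((X \<omega>)\<^sup>2 / a) powr q) \<partial>M)"
    by (rule nn_integral_cmult[symmetric]) measurable
  also have "\<dots> = (\<integral>\<^sup>+ \<omega>. ennreal (\<bar>X \<omega>\<bar> powr \<nu>) \<partial>M)"
  proof (rule nn_integral_cong)
    fix \<omega>
    have "a powr q * ((X \<omega>)\<^sup>2 / a) powr q = ((X \<omega>)\<^sup>2) powr q" using a by (simp add: powr_divide)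
    also have "\<dots> = \<bar>X \<omega>\<bar> powr \<nu>"
    proof (cases "X \<omega> = 0")
      case False
      then have "\<bar>X \<omega>\<bar> powr 2 = (X \<omega>)\<^sup>2" using powr_realpow[of "\<bar>X \<omega>\<bar>" 2] by simp
      then have "((X \<omega>)\<^sup>2) powr q = (\<bar>X \<omega>\<bar> powr 2) powr q" by (simp only:)
      also have "\<dots> = \<bar>X \<omega>\<bar> powr \<nu>" unfolding powr_powr by (simp add: q_def)
      finally show ?thesis .
    qed simp
    finally show "ennreal (a powr q) * ennreal (((X \<omega>)\<^sup>2 / a) powr q) = ennreal (\<bar>X \<omega>\<bar> powr \<nu>)"
      by (simp add: ennreal_mult[symmetric])
  qed
  finally show ?thesis by (simp add: q_def)
qed

text \<open>Splitting at the threshold A = B^(1/p), with p = 2k+2: below it \<bar>X\<bar>^\<nu> is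
  at most A^\<nu>, above it at most A^(\<nu> - p) \<bar>X\<bar>^p. Both parts contribute at most
  B^(\<nu>/p), hence the factor 2.\<close>

lemma (in prob_space) powr_moment_upper:
  fixes X :: "'a \<Rightarrow> real"
  assumes X [measurable]: "X \<in> borel_measurable M" and \<nu>: "0 < \<nu>" "\<nu> \<le> real (2*k+2)" and B: "0 < B"
    and m: "(\<integral>\<^sup>+ \<omega>. ennreal (X \<omega> ^ (2*k+2)) \<partial>M) \<le> ennreal B"
  shows "(\<integral>\<^sup>+ \<omega>. ennreal (\<bar>X \<omega>\<bar> powr \<nu>) \<partial>M) \<le> ennreal (2 * B powr (\<nu> / real (2*k+2)))"
proof -
  define p where "p = real (2*k+2)"
  have p: "0 < p" by (simp add: p_def)
  define A where "A = B powr (1/p)"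
  have A: "0 < A" using B by (simp add: A_def)
  have pow: "X \<omega> ^ (2*k+2) = \<bar>X \<omega>\<bar> powr p" for \<omega>
  proof (cases "X \<omega> = 0")
    case False
    then have "\<bar>X \<omega>\<bar> powr p = \<bar>X \<omega>\<bar> ^ (2*k+2)" unfolding p_def by (intro powr_realpow) simp
    then show ?thesis by (simp add: power_even_abs)
  qed (simp add: p_def)
  have nn: "0 \<le> X \<omega> ^ (2*k+2)" for \<omega> unfolding pow by simp
  have "(\<integral>\<^sup>+ \<omega>. ennreal (\<bar>X \<omega>\<bar> powr \<nu>) \<partial>M) \<le> (\<integral>\<^sup>+ \<omega>. ennreal (A powr (\<nu> - p)) * ennreal (X \<omega> ^ (2*k+2)) + ennreal (A powr \<nu>) \<partial>M)"
  proof (rule nn_integral_mono)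
    fix \<omega>
    have "\<bar>X \<omega>\<bar> powr \<nu> \<le> A powr (\<nu> - p) * X \<omega> ^ (2*k+2) + A powr \<nu>"
    proof (cases "\<bar>X \<omega>\<bar> \<le> A")
      case True
      then have "\<bar>X \<omega>\<bar> powr \<nu> \<le> A powr \<nu>" using \<nu> by (intro powr_mono2) auto
      then show ?thesis using nn[of \<omega>] by (simp add: add_increasing)
    next
      case False
      then have "\<bar>X \<omega>\<bar> powr (\<nu> - p) \<le> A powr (\<nu> - p)" using \<nu> A by (intro powr_mono2') (auto simp: p_def)
      then have "\<bar>X \<omega>\<bar> powr (\<nu> - p) * \<bar>X \<omega>\<bar> powr p \<le> A powr (\<nu> - p) * \<bar>X \<omega>\<bar> powr p" by (intro mult_right_mono) auto
      moreover have "\<bar>X \<omega>\<bar> powr (\<nu> - p) * \<bar>X \<omega>\<bar> powr p = \<bar>X \<omega>\<bar> powr \<nu>" by (simp add: powr_add[symmetric])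
      ultimately have "\<bar>X \<omega>\<bar> powr \<nu> \<le> A powr (\<nu> - p) * X \<omega> ^ (2*k+2)" by (simp only: pow)
      then show ?thesis using powr_ge_zero[of A \<nu>] by linarith
    qed
    then have "ennreal (\<bar>X \<omega>\<bar> powr \<nu>) \<le> ennreal (A powr (\<nu> - p) * X \<omega> ^ (2*k+2) + A powr \<nu>)" by (rule ennreal_leI)
    then show "ennreal (\<bar>X \<omega>\<bar> powr \<nu>) \<le> ennreal (A powr (\<nu> - p)) * ennreal (X \<omega> ^ (2*k+2)) + ennreal (A powr \<nu>)"
      using nn[of \<omega>] by (simp add: ennreal_mult)
  qed
  also have "\<dots> = ennreal (A powr (\<nu> - p)) * (\<integral>\<^sup>+ \<omega>. ennreal (X \<omega> ^ (2*k+2)) \<partial>M) + ennreal (A powr \<nu>)"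
    by (subst nn_integral_add) (auto simp: nn_integral_cmult emeasure_space_1)
  also have "\<dots> \<le> ennreal (A powr (\<nu> - p)) * ennreal B + ennreal (A powr \<nu>)"
    by (intro add_right_mono mult_left_mono m) simp
  also have "\<dots> = ennreal (A powr (\<nu> - p) * B + A powr \<nu>)" using B by (simp add: ennreal_mult)
  also have "A powr (\<nu> - p) * B = A powr \<nu>"
  proof -
    have "B = A powr p" using B p by (simp add: A_def powr_powr)
    then show ?thesis by (simp add: powr_add[symmetric])
  qed
  also have "A powr \<nu> = B powr (\<nu> / p)" by (simp add: A_def powr_powr)
  finally show ?thesis by (simp add: p_def)
qed

section \<open>Sign criteria for the growth rate\<close>

lemma ln_ennreal_mono:
  assumes "a \<le> b" shows "ln_ennreal a \<le> ln_ennreal b"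
proof (cases "a = 0 \<or> b = \<infinity>")
  case False
  then have "a < top" "b < top" "0 < a" using assms by (auto simp: top.not_eq_extremum zero_less_iff_neq_zero order_le_less_trans)
  then have "0 < enn2real a" "enn2real a \<le> enn2real b" "0 < enn2real b"
    using assms by (auto simp: enn2real_positive_iff enn2real_mono order_less_le_trans)
  then show ?thesis using False \<open>a < top\<close> assms by (auto simp: ln_ennreal_def)
qed (auto simp: ln_ennreal_def)

lemma ln_ennreal_ennreal: "0 < r \<Longrightarrow> ln_ennreal (ennreal r) = ereal (ln r)"
  by (simp add: ln_ennreal_def ennreal_eq_0_iff)

abbreviation sup_ln_moment :: "'a measure \<Rightarrow> (real \<Rightarrow> real \<Rightarrow> 'a \<Rightarrow> real) \<Rightarrow> real \<Rightarrow> real \<Rightarrow> real \<Rightarrow> ereal" where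
  "sup_ln_moment M u \<nu> \<alpha> t \<equiv> (SUP x\<in>{x. \<alpha> * t \<le> \<bar>x\<bar>}. ln_ennreal (moment M u \<nu> t x))"

lemma growth_rate_antimono:
  assumes "\<alpha> \<le> \<beta>" shows "growth_rate M u \<nu> \<beta> \<le> growth_rate M u \<nu> \<alpha>"
  unfolding growth_rate_def
proof (rule Limsup_mono)
  show "\<forall>\<^sub>F t in at_top. ereal (1 / t) * sup_ln_moment M u \<nu> \<beta> t
     \<le> ereal (1 / t) * sup_ln_moment M u \<nu> \<alpha> t"
    using eventually_gt_at_top[of 0]
  proof eventually_elim
    case (elim t)
    have "\<alpha> * t \<le> \<beta> * t" using assms elim by (intro mult_right_mono) auto
    then have "{x. \<beta> * t \<le> \<bar>x\<bar>} \<subseteq> {x. \<alpha> * t \<le> \<bar>x\<bar>}" by auto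
    then show ?case using elim by (intro ereal_mult_left_mono SUP_subset_mono) auto
  qed
qed

lemma lower_index_le_upper_index: "lower_index M u \<nu> \<le> upper_index M u \<nu>"
  unfolding lower_index_def upper_index_def
proof (rule Sup_least, rule Inf_greatest)
  fix a b assume a: "a \<in> {0} \<union> {ereal \<alpha> | \<alpha>. \<alpha> > 0 \<and> growth_rate M u \<nu> \<alpha> > 0}"
    and "b \<in> {ereal \<alpha> | \<alpha>. \<alpha> > 0 \<and> growth_rate M u \<nu> \<alpha> < 0}"
  then obtain \<beta> where \<beta>: "b = ereal \<beta>" "\<beta> > 0" "growth_rate M u \<nu> \<beta> < 0" by auto
  show "a \<le> b"
  proof (cases "a = 0")
    case False
    then obtain \<alpha> where \<alpha>: "a = ereal \<alpha>" "growth_rate M u \<nu> \<alpha> > 0" using a by auto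
    have "\<not> \<beta> \<le> \<alpha>" using growth_rate_antimono[of \<beta> \<alpha> M u \<nu>] \<alpha>(2) \<beta>(3) by (meson leD less_trans order_le_less_trans)
    then show ?thesis by (simp add: \<alpha> \<beta>)
  qed (use \<beta> in auto)
qed

lemma growth_rate_neg:
  assumes D: "0 < D" and g: "0 < g"
    and m: "\<And>t x. t1 \<le> t \<Longrightarrow> 0 < t \<Longrightarrow> \<alpha> * t \<le> \<bar>x\<bar> \<Longrightarrow> moment M u \<nu> t x \<le> ennreal (D * exp (- g * t))"
  shows "growth_rate M u \<nu> \<alpha> < 0"
proof -
  have "growth_rate M u \<nu> \<alpha> \<le> ereal (- g / 2)"
    unfolding growth_rate_def
  proof (rule Limsup_bounded)
    show "\<forall>\<^sub>F t in at_top. ereal (1 / t) * sup_ln_moment M u \<nu> \<alpha> t \<le> ereal (- g / 2)"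
      \<comment> \<open>From time 2 ln D / g on, the constant \<open>D\<close> uses up at most half
        of the decay, so the limit superior is bounded by -g/2.\<close>
      using eventually_ge_at_top[of t1] eventually_gt_at_top[of 0] eventually_ge_at_top[of "2 * ln D / g"]
    proof eventually_elim
      case (elim t)
      have "sup_ln_moment M u \<nu> \<alpha> t \<le> ereal (ln D - g * t)"
      proof (rule SUP_least)
        fix x assume "x \<in> {x. \<alpha> * t \<le> \<bar>x\<bar>}"
        then have "ln_ennreal (moment M u \<nu> t x) \<le> ln_ennreal (ennreal (D * exp (- g * t)))"
          using elim by (intro ln_ennreal_mono m) auto
        also have "\<dots> = ereal (ln D - g * t)" using D by (simp add: ln_ennreal_ennreal ln_mult)
        finally show "ln_ennreal (moment M u \<nu> t x) \<le> ereal (ln D - g * t)" .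
      qed
      then have "ereal (1 / t) * sup_ln_moment M u \<nu> \<alpha> t \<le> ereal (1 / t) * ereal (ln D - g * t)"
        using elim by (intro ereal_mult_left_mono) auto
      also have "\<dots> \<le> ereal (- g / 2)"
        using elim g by (simp add: field_simps)
      finally show ?case .
    qed
  qed
  also have "\<dots> < 0" using g by simp
  finally show ?thesis .
qed

text \<open>Because the growth rate is a limit superior of suprema, one point \<open>X n\<close> at
  each of a sequence of times \<open>T n\<close> is enough. This matches a lower bound that grows in
  discrete steps.\<close>

lemma growth_rate_pos:
  assumes \<epsilon>: "0 < \<epsilon>" and g: "0 < g" and T: "filterlim T at_top sequentially"
    and X: "\<forall>\<^sub>F n in sequentially. \<alpha> * T n \<le> \<bar>X n\<bar>"
    and m: "\<And>n. ennreal (\<epsilon> * exp (g * T n)) \<le> moment M u \<nu> (T n) (X n)"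
  shows "0 < growth_rate M u \<nu> \<alpha>"
proof -
  have "ereal (g / 2) \<le> growth_rate M u \<nu> \<alpha>"
    unfolding growth_rate_def Limsup_def
  proof (rule INF_greatest)
    fix P :: "real \<Rightarrow> bool" assume "P \<in> {P. eventually P at_top}"
    then have "\<forall>\<^sub>F n in sequentially. P (T n)" using T by (auto simp: filterlim_iff)
    moreover have "\<forall>\<^sub>F n in sequentially. 0 < T n" using T unfolding filterlim_at_top_dense by blast
    moreover have "\<forall>\<^sub>F n in sequentially. - 2 * ln \<epsilon> / g \<le> T n" using T unfolding filterlim_at_top by blast
    ultimately have "\<forall>\<^sub>F n in sequentially. P (T n) \<and> 0 < T n \<and> - 2 * ln \<epsilon> / g \<le> T n \<and> \<alpha> * T n \<le> \<bar>X n\<bar>"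
      using X by eventually_elim auto
    then obtain n where n: "P (T n)" "0 < T n" "- 2 * ln \<epsilon> / g \<le> T n" "\<alpha> * T n \<le> \<bar>X n\<bar>"
      by (auto simp: eventually_sequentially)
    have "ereal (ln \<epsilon> + g * T n) = ln_ennreal (ennreal (\<epsilon> * exp (g * T n)))"
      using \<epsilon> by (simp add: ln_ennreal_ennreal ln_mult)
    also have "\<dots> \<le> ln_ennreal (moment M u \<nu> (T n) (X n))" by (rule ln_ennreal_mono[OF m])
    also have "\<dots> \<le> sup_ln_moment M u \<nu> \<alpha> (T n)"
      using n(4) by (intro SUP_upper) auto
    finally have "ereal (1 / T n) * ereal (ln \<epsilon> + g * T n) \<le> ereal (1 / T n) * sup_ln_moment M u \<nu> \<alpha> (T n)"
      using n(2) by (intro ereal_mult_left_mono) auto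
    moreover have "ereal (g / 2) \<le> ereal (1 / T n) * ereal (ln \<epsilon> + g * T n)"
      using n g by (simp add: field_simps)
    ultimately have "ereal (g / 2) \<le> ereal (1 / T n) * sup_ln_moment M u \<nu> \<alpha> (T n)"
      by (rule order_trans[rotated])
    then show "ereal (g / 2) \<le> (SUP t\<in>{t. P t}. ereal (1 / t) * sup_ln_moment M u \<nu> \<alpha> t)"
      using n(1) by (intro SUP_upper2[of "T n"]) simp_all
  qed
  moreover have "0 < ereal (g / 2)" using g by simp
  ultimately show ?thesis by (rule order_less_le_trans[rotated])
qed

section \<open>Exponential decay and finite propagation of moments\<close>

context wave_equation
begin

text \<open>Of the d'Alembert formula only the right-moving half of the initial position is kept;
  the other contributions are nonnegative.\<close>

lemma J_nonneg:
  assumes "\<And>x. 0 \<le> u0 x" "\<And>x. 0 \<le> v0 x"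
  shows "u0 (x - \<kappa> * t) / 2 \<le> J t x"
proof -
  have "0 \<le> velocity_part t x"
    unfolding set_lebesgue_integral_def using assms(2) by (intro Bochner_Integration.integral_nonneg) simp
  then have "0 \<le> 1 / (2 * \<kappa>) * velocity_part t x" using kappa by simp
  moreover have "u0 (x - \<kappa> * t) / 2 \<le> (u0 (x + \<kappa> * t) + u0 (x - \<kappa> * t)) / 2" using assms(1)[of "x + \<kappa> * t"] by simp
  ultimately show ?thesis unfolding J_def by (rule add_increasing2)
qed

lemma J_upper:
  assumes t: "0 \<le> t" and v0: "v0 \<in> borel_measurable borel" "\<And>x. 0 \<le> v0 x"
    and B: "0 \<le> b" "\<And>y. \<bar>y - x\<bar> \<le> \<kappa> * t \<Longrightarrow> u0 y \<le> b" "\<And>y. \<bar>y - x\<bar> \<le> \<kappa> * t \<Longrightarrow> v0 y \<le> b"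
  shows "J t x \<le> (1 + t) * b"
proof -
  have kt: "0 \<le> \<kappa> * t" using t kappa by simp
  have "velocity_part t x \<le> (\<integral>y\<in>{x - \<kappa> * t .. x + \<kappa> * t}. b \<partial>lborel)"
    unfolding set_lebesgue_integral_def
  proof (rule integral_mono)
    have ib: "integrable lborel (\<lambda>y. indicator {x - \<kappa> * t .. x + \<kappa> * t} y *\<^sub>R b)"
      using kt by (intro integrable_scaleR_left integrable_real_indicator) auto
    then show "integrable lborel (\<lambda>y. indicator {x - \<kappa> * t .. x + \<kappa> * t} y *\<^sub>R b)" .
    have le: "v0 y \<le> b" if "y \<in> {x - \<kappa> * t .. x + \<kappa> * t}" for y using that by (intro B(3)) auto
    show "integrable lborel (\<lambda>y. indicator {x - \<kappa> * t .. x + \<kappa> * t} y *\<^sub>R v0 y)"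
      by (rule Bochner_Integration.integrable_bound[OF ib])
         (use v0 le B(1) in \<open>auto simp: indicator_def\<close>)
    show "indicator {x - \<kappa> * t .. x + \<kappa> * t} y *\<^sub>R v0 y \<le> indicator {x - \<kappa> * t .. x + \<kappa> * t} y *\<^sub>R b" for y
      using le[of y] by (auto simp: indicator_def)
  qed
  also have "\<dots> = 2 * \<kappa> * t * b"
    using kt by (simp add: set_lebesgue_integral_def)
  finally have "1 / (2 * \<kappa>) * velocity_part t x \<le> 1 / (2 * \<kappa>) * (2 * \<kappa> * t * b)"
    using kappa by (intro mult_left_mono) auto
  also have "\<dots> = t * b" using kappa by simp
  finally have "1 / (2 * \<kappa>) * velocity_part t x \<le> t * b" .
  moreover have "u0 (x + \<kappa> * t) \<le> b" by (rule B(2)) (use kt in linarith)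
  moreover have "u0 (x - \<kappa> * t) \<le> b" by (rule B(2)) (use kt in linarith)
  ultimately have "J t x \<le> b + t * b" unfolding J_def by (intro add_mono) auto
  then show ?thesis by (simp add: distrib_right)
qed

text \<open>The weight exp(c \<bar>y\<bar>) changes by at most the factor exp(c \<kappa> (t - s))
  along a light cone, and c = p \<rho>, with p = 2k+2, is the decay rate of \<open>J t y ^ p\<close>
  inherited from the data.\<close>

lemma exponential_moment_bound:
  assumes k: "1 \<le> k" and u0: "\<And>x. 0 \<le> u0 x" and v0: "v0 \<in> borel_measurable borel" "\<And>x. 0 \<le> v0 x"
    and B: "0 < B" "0 < \<rho>" "\<And>x. u0 x \<le> B * exp (- \<rho> * \<bar>x\<bar>)" "\<And>x. v0 x \<le> B * exp (- \<rho> * \<bar>x\<bar>)"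
  shows "\<exists>D \<beta> c. 0 < D \<and> 0 < \<beta> \<and> 0 < c \<and>
    (\<forall>t\<ge>0. \<forall>x. (\<integral>\<^sup>+ \<omega>. ennreal (u t x \<omega> ^ (2*k+2)) \<partial>M) \<le> ennreal (D * exp (\<beta> * t - c * \<bar>x\<bar>)))"
proof -
  define p where "p = 2*k+2"
  define c where "c = real p * \<rho>"
  have c: "0 < c" using B(2) by (simp add: c_def p_def)
  define C where "C = moment_const k"
  note C = moment_const(1)[OF k, folded C_def] and bound = weighted_moment_bound[OF k, folded C_def]
  \<comment> \<open>The three summands meet three demands: 1 and 4 \<kappa> C give 4 \<kappa> C <=
    b^2, which is the contraction condition because \<beta> - c \<kappa> - k = b; the last one lets
    exp(-\<beta> t) dominate J^p, whose growth is exp(p t) from the factor (1 + t)^p and exp(p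
    \<rho> \<kappa> t) from data transported at speed \<kappa>.\<close>
  define b where "b = 1 + 4 * \<kappa> * C + real p * (1 + \<rho> * \<kappa>)"
  define \<beta> where "\<beta> = c * \<kappa> + real k + b"
  have b: "1 \<le> b" "4 * \<kappa> * C \<le> b" "real p * (1 + \<rho> * \<kappa>) \<le> \<beta>"
    using kappa C B(2) c by (auto simp: b_def \<beta>_def)
  have small: "C * (2 * \<kappa> / (\<beta> - c * \<kappa> - real k)\<^sup>2) \<le> 1/2"
  proof -
    have "4 * \<kappa> * C \<le> b * b" using b mult_mono[of 1 b b b] by linarith
    then show ?thesis using b(1) by (simp add: \<beta>_def field_simps power2_eq_square)
  qed
  define A where "A = B ^ p"
  \<comment> \<open>The summand 1 makes the constant strictly positive even if \<open>C\<close> is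
    zero.\<close>
  have "(\<integral>\<^sup>+ \<omega>. ennreal (u t x \<omega> ^ (2*k+2)) \<partial>M) \<le> ennreal ((2 * C * A + 1) * exp (\<beta> * t - c * \<bar>x\<bar>))" if t: "0 \<le> t" for t x
  proof -
    \<comment> \<open>The cap at the target point x makes the weight bounded. Minima of admissible
      weights are admissible, the bound obtained does not involve the cap, and at y = x the cap
      costs nothing.\<close>
    define w where "w = (\<lambda>(t::real) y. min (exp (c * \<bar>y\<bar>)) (exp (c * \<bar>x\<bar>)))"
    let ?E = "\<integral>\<^sup>+ \<omega>. ennreal (u t x \<omega> ^ (2*k+2)) \<partial>M"
    have "ennreal (exp (- \<beta> * t) * w t x) * ?E \<le> 2 * ennreal (C * A)"
    proof (rule bound[where c = "c * \<kappa>" and R = "exp (c * \<bar>x\<bar>)", OF _ _ small _ _ _ t])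
      show "0 \<le> c * \<kappa>" using c kappa by simp
      show "c * \<kappa> + real k < \<beta>" using b by (simp add: \<beta>_def)
      show "0 \<le> w t y \<and> w t y \<le> exp (c * \<bar>x\<bar>)" for t y by (simp add: w_def)
      show "w t x' \<le> exp (c * \<kappa> * (t - s)) * w s y" if st: "0 \<le> s" "s \<le> t" "\<bar>y - x'\<bar> \<le> \<kappa> * (t - s)" for s t x' y
      proof -
        have e1: "1 \<le> exp (c * \<kappa> * (t - s))" using st c kappa by simp
        have "c * \<bar>x'\<bar> \<le> c * (\<kappa> * (t - s) + \<bar>y\<bar>)" using st c by (intro mult_left_mono) auto
        then have "exp (c * \<bar>x'\<bar>) \<le> exp (c * \<kappa> * (t - s)) * exp (c * \<bar>y\<bar>)"
          by (simp add: exp_add[symmetric] algebra_simps)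
        moreover have "exp (c * \<bar>x\<bar>) \<le> exp (c * \<kappa> * (t - s)) * exp (c * \<bar>x\<bar>)" using e1 by simp
        ultimately show ?thesis
          by (simp add: w_def min_mult_distrib_left min.coboundedI1 min.coboundedI2)
      qed
      show "exp (- \<beta> * t) * w t y * J t y ^ (2*k+2) \<le> A" if t: "0 \<le> t" for t y
      proof -
        define E where "E = B * exp (\<rho> * \<kappa> * t - \<rho> * \<bar>y\<bar>)"
        have data: "h z \<le> E" if h: "\<And>x. h x \<le> B * exp (- \<rho> * \<bar>x\<bar>)" and z: "\<bar>z - y\<bar> \<le> \<kappa> * t" for h :: "real \<Rightarrow> real" and z
        proof -
          have "\<rho> * (\<bar>y\<bar> - \<kappa> * t) \<le> \<rho> * \<bar>z\<bar>" using z B(2) by (intro mult_left_mono) auto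
          then have "B * exp (- \<rho> * \<bar>z\<bar>) \<le> E" unfolding E_def using B(1) by (intro mult_left_mono) (auto simp: algebra_simps)
          then show ?thesis using h[of z] by linarith
        qed
        have "0 \<le> J t y" using J_nonneg[OF u0 v0(2), of y t] u0[of "y - \<kappa> * t"] by simp
        moreover have "J t y \<le> (1 + t) * E"
          by (rule J_upper[OF t v0]) (use B data in \<open>auto simp: E_def\<close>)
        moreover have "(1 + t) * E \<le> exp t * E" using B(1) by (intro mult_right_mono exp_ge_add_one_self) (simp add: E_def)
        ultimately have "J t y ^ p \<le> (exp t * E) ^ p" by (intro power_mono) auto
        also have "\<dots> = A * exp (real p * t + real p * (\<rho> * \<kappa> * t - \<rho> * \<bar>y\<bar>))"
          by (simp add: E_def A_def power_mult_distrib exp_of_nat_mult[symmetric] exp_add mult_ac)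
        also have "real p * t + real p * (\<rho> * \<kappa> * t - \<rho> * \<bar>y\<bar>) = real p * (1 + \<rho> * \<kappa>) * t - c * \<bar>y\<bar>"
          by (simp add: c_def algebra_simps)
        finally have Jp: "J t y ^ p \<le> A * exp (real p * (1 + \<rho> * \<kappa>) * t - c * \<bar>y\<bar>)" .
        have "exp (- \<beta> * t) * w t y * J t y ^ p \<le> exp (- \<beta> * t) * exp (c * \<bar>y\<bar>) * (A * exp (real p * (1 + \<rho> * \<kappa>) * t - c * \<bar>y\<bar>))"
          by (intro mult_mono Jp) (use \<open>0 \<le> J t y\<close> in \<open>auto simp: w_def\<close>)
        also have "\<dots> = A * exp ((real p * (1 + \<rho> * \<kappa>) - \<beta>) * t)"
          by (simp add: exp_add[symmetric] algebra_simps)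
        also have "\<dots> \<le> A * 1"
        proof (rule mult_left_mono)
          have "(real p * (1 + \<rho> * \<kappa>) - \<beta>) * t \<le> 0" using b(3) t by (intro mult_nonpos_nonneg) auto
          then show "exp ((real p * (1 + \<rho> * \<kappa>) - \<beta>) * t) \<le> 1" by simp
        qed (use B(1) in \<open>simp add: A_def\<close>)
        finally show ?thesis by (simp add: p_def)
      qed
    qed
    moreover have "exp (- \<beta> * t) * w t x = exp (c * \<bar>x\<bar> - \<beta> * t)" by (simp add: w_def exp_add[symmetric])
    ultimately have "ennreal (exp (c * \<bar>x\<bar> - \<beta> * t)) * ?E \<le> 2 * ennreal (C * A)" by simp
    then have "ennreal (exp (\<beta> * t - c * \<bar>x\<bar>)) * (ennreal (exp (c * \<bar>x\<bar> - \<beta> * t)) * ?E) \<le> ennreal (exp (\<beta> * t - c * \<bar>x\<bar>)) * (2 * ennreal (C * A))"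
      by (intro mult_left_mono) auto
    also have "ennreal (exp (\<beta> * t - c * \<bar>x\<bar>)) * (ennreal (exp (c * \<bar>x\<bar> - \<beta> * t)) * ?E) = ?E"
      by (simp add: mult.assoc[symmetric] ennreal_mult[symmetric] exp_add[symmetric])
    also have "ennreal (exp (\<beta> * t - c * \<bar>x\<bar>)) * (2 * ennreal (C * A)) = ennreal (2 * C * A * exp (\<beta> * t - c * \<bar>x\<bar>))"
    proof -
      have CA: "0 \<le> C * A" using C B(1) by (simp add: A_def)
      have "2 * ennreal (C * A) = ennreal (2 * (C * A))" using CA by (simp add: ennreal_mult)
      then show ?thesis using CA by (simp add: ennreal_mult[symmetric] mult_ac)
    qed
    also have "\<dots> \<le> ennreal ((2 * C * A + 1) * exp (\<beta> * t - c * \<bar>x\<bar>))" by (intro ennreal_leI mult_right_mono) auto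
    finally show ?thesis .
  qed
  moreover have "0 < 2 * C * A + 1" using C B(1) by (simp add: A_def add_nonneg_pos)
  moreover have "0 < \<beta>" using b c kappa by (simp add: \<beta>_def add_nonneg_pos)
  ultimately show ?thesis using c by blast
qed

text \<open>If (t, x) is outside the forward cone of the support, so is its whole backward cone. The
  indicator of the exterior is thus an admissible weight with c = 0; \<open>J\<close> vanishes
  there, so the general bound holds with A = 0 and already the fourth moment is zero.\<close>

lemma vanishes_outside_cone:
  assumes R0: "\<And>x. R0 < \<bar>x\<bar> \<Longrightarrow> u0 x = 0" "\<And>x. R0 < \<bar>x\<bar> \<Longrightarrow> v0 x = 0" and t: "0 \<le> t" and x: "R0 + \<kappa> * t < \<bar>x\<bar>"
  shows "AE \<omega> in M. u t x \<omega> = 0"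
proof -
  define C where "C = moment_const 1"
  note C = moment_const(1)[OF order_refl, folded C_def] and bound = weighted_moment_bound[OF order_refl, folded C_def]
  define b where "b = 1 + 4 * \<kappa> * C"
  have b: "1 \<le> b" "4 * \<kappa> * C \<le> b" using kappa C by (auto simp: b_def)
  define w where "w = (\<lambda>t x. indicator {x. R0 + \<kappa> * t < \<bar>x\<bar>} x :: real)"
  have "ennreal (exp (- (1 + b) * t) * w t x) * (\<integral>\<^sup>+ \<omega>. ennreal (u t x \<omega> ^ (2*1+2)) \<partial>M) \<le> 2 * ennreal (C * 0)"
  proof (rule bound[where c = 0 and R = 1, OF _ _ _ _ _ _ t])
    show "C * (2 * \<kappa> / (1 + b - 0 - real 1)\<^sup>2) \<le> 1/2"
    proof -
      have "4 * \<kappa> * C \<le> b * b" using b mult_mono[of 1 b b b] by linarith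
      then show ?thesis using b(1) by (simp add: field_simps power2_eq_square)
    qed
    show "w t x \<le> exp (0 * (t - s)) * w s y" if "\<bar>y - x\<bar> \<le> \<kappa> * (t - s)" for s t x y
      using that by (auto simp: w_def indicator_def right_diff_distrib)
    show "exp (- (1 + b) * t) * w t x * J t x ^ (2*1+2) \<le> 0" if t: "0 \<le> t" for t x
    proof -
      have "J t x = 0" if x: "R0 + \<kappa> * t < \<bar>x\<bar>"
      proof -
        have kt: "0 \<le> \<kappa> * t" using t kappa by simp
        have "indicat_real {x - \<kappa> * t..x + \<kappa> * t} y *\<^sub>R v0 y = 0" for y
          using R0(2)[of y] x by (auto simp: indicator_def)
        then have "velocity_part t x = 0"
          unfolding set_lebesgue_integral_def by (simp only: integral_zero)
        moreover have "u0 (x + \<kappa> * t) = 0" "u0 (x - \<kappa> * t) = 0" using x kt by (auto intro!: R0(1))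
        ultimately show ?thesis by (simp add: J_def)
      qed
      then show ?thesis by (auto simp: w_def indicator_def)
    qed
  qed (use b in \<open>auto simp: w_def\<close>)
  then have "(\<integral>\<^sup>+ \<omega>. ennreal (u t x \<omega> ^ 4) \<partial>M) = 0" using x by (simp add: w_def)
  moreover have [measurable]: "u t x \<in> borel_measurable M" by (rule u_measurable[OF t])
  ultimately have "AE \<omega> in M. ennreal (u t x \<omega> ^ 4) = 0" by (subst (asm) nn_integral_0_iff_AE) auto
  then show ?thesis by eventually_elim (simp add: ennreal_eq_0_iff)
qed

section \<open>Survival and exponential growth of the second moment inside the light cone\<close>

lemma second_moment_rectangle:
  assumes t: "0 \<le> t" and a: "0 \<le> a" and s: "s1 \<le> s2" "y1 \<le> y2"
    and rect: "\<And>s y. s1 \<le> s \<Longrightarrow> s \<le> s2 \<Longrightarrow> y1 \<le> y \<Longrightarrow> y \<le> y2 \<Longrightarrow> (s, y) \<in> cone \<kappa> t x \<and> ennreal a \<le> second_moment s y"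
  shows "ennreal (ell\<^sup>2 / 16 * (a * ((s2 - s1) * (y2 - y1)))) \<le> second_moment t x"
proof -
  have "ennreal a * (ennreal (s2 - s1) * ennreal (y2 - y1)) = ennreal a * emeasure lplane ({s1..s2} \<times> {y1..y2})"
    using s by (subst lborel.emeasure_pair_measure_Times) auto
  also have "\<dots> = (\<integral>\<^sup>+ z. ennreal a * indicator ({s1..s2} \<times> {y1..y2}) z \<partial>lplane)"
    by (rule nn_integral_cmult_indicator[symmetric]) auto
  also have "\<dots> \<le> (\<integral>\<^sup>+ z. indicator (cone \<kappa> t x) z * second_moment (fst z) (snd z) \<partial>lplane)"
  proof (rule nn_integral_mono)
    fix z :: "real \<times> real"
    obtain s' y where z: "z = (s', y)" by (cases z)
    show "ennreal a * indicator ({s1..s2} \<times> {y1..y2}) z \<le> indicator (cone \<kappa> t x) z * second_moment (fst z) (snd z)"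
      using rect[of s' y] by (auto simp: z indicator_def)
  qed
  finally have "ennreal (ell\<^sup>2) * (ennreal a * (ennreal (s2 - s1) * ennreal (y2 - y1))) \<le> 16 * second_moment t x"
    using second_moment_lower(2)[OF t, of x]
    by (meson mult_left_mono order_trans zero_le)
  then have "ennreal (1/16) * (ennreal (ell\<^sup>2) * (ennreal a * (ennreal (s2 - s1) * ennreal (y2 - y1)))) \<le> ennreal (1/16) * (16 * second_moment t x)"
    by (intro mult_left_mono) auto
  also have "ennreal (1/16) * (16 * second_moment t x) = (ennreal (1/16) * ennreal 16) * second_moment t x" by (simp add: mult.assoc)
  also have "ennreal (1/16) * ennreal 16 = 1" by (subst ennreal_mult[symmetric]) auto
  also have "ennreal (1/16) * (ennreal (ell\<^sup>2) * (ennreal a * (ennreal (s2 - s1) * ennreal (y2 - y1))))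
     = ennreal (1/16 * (ell\<^sup>2 * (a * ((s2 - s1) * (y2 - y1)))))"
  proof -
    have "0 \<le> s2 - s1" "0 \<le> y2 - y1" using s by auto
    then show ?thesis using a by (simp only: ennreal_mult zero_le_power2 mult_nonneg_nonneg zero_le_divide_1_iff zero_le_numeral)
  qed
  finally show ?thesis by (simp add: mult_ac)
qed

text \<open>Lower semicontinuity keeps \<open>u0\<close> above \<open>d\<close> on a ball around
  \<open>z\<close>, so \<open>J\<close> is at least d/2 on a strip around the characteristic through
  \<open>z\<close>, where the second moment is then at least d^2/8. Every point of a later forward
  cone has a fixed small rectangle of this strip in its backward cone, and the noise term transfers
  the bound to it.\<close>

lemma second_moment_base:
  assumes u0: "\<And>x. 0 \<le> u0 x" "lower_semicont u0" and v0: "\<And>x. 0 \<le> v0 x" and z: "0 < u0 z"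
  shows "\<exists>\<epsilon> t0. 0 < \<epsilon> \<and> 0 \<le> t0 \<and> (\<forall>t x. \<bar>x - z\<bar> \<le> \<kappa> * (t - t0) \<longrightarrow> ennreal \<epsilon> \<le> second_moment t x)"
proof -
  define d where "d = u0 z / 2"
  have d: "0 < d" using z by (simp add: d_def)
  have "open {x. d < u0 x}" using u0(2) by (simp add: lower_semicont_def)
  moreover have "z \<in> {x. d < u0 x}" using z by (simp add: d_def)
  ultimately obtain r where r: "0 < r" "ball z r \<subseteq> {x. d < u0 x}" by (rule openE)
  have strip: "ennreal (d\<^sup>2 / 8) \<le> second_moment s y" if s: "0 \<le> s" "\<bar>y - z - \<kappa> * s\<bar> < r" for s y
  proof -
    have "y - \<kappa> * s \<in> ball z r" using s(2) by (simp add: dist_real_def abs_minus_commute algebra_simps)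
    then have "d \<le> u0 (y - \<kappa> * s)" using r(2) by auto
    then have "d / 2 \<le> J s y" using J_nonneg[OF u0(1) v0, of y s] by linarith
    then have "(d / 2)\<^sup>2 \<le> (J s y)\<^sup>2" using d by (intro power_mono) auto
    then have "ennreal (2 * (d\<^sup>2 / 8)) \<le> ennreal ((J s y)\<^sup>2)" by (intro ennreal_leI) (simp add: power_divide)
    also have "\<dots> \<le> 2 * second_moment s y" by (rule second_moment_lower(1)[OF s(1)])
    also have "ennreal (2 * (d\<^sup>2 / 8)) = ennreal 2 * ennreal (d\<^sup>2 / 8)" by (rule ennreal_mult) auto
    finally have "2 * ennreal (d\<^sup>2 / 8) \<le> 2 * second_moment s y" by simp
    then show ?thesis by (subst (asm) ennreal_mult_le_mult_iff) simp_all
  qed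
  \<comment> \<open>During time \<eta> the characteristic moves by at most r/4, so a rectangle of
    half-width r/2 stays in the strip of half-width r.\<close>
  define \<eta> where "\<eta> = min 1 (r / (4 * \<kappa>))"
  have \<eta>: "0 < \<eta>" "\<eta> \<le> 1" "\<kappa> * \<eta> \<le> r / 4"
  proof -
    have "\<eta> \<le> r / (4 * \<kappa>)" by (simp add: \<eta>_def)
    then show "\<kappa> * \<eta> \<le> r / 4" using kappa by (simp add: field_simps)
  qed (use r kappa in \<open>auto simp: \<eta>_def\<close>)
  \<comment> \<open>The summand 1 dominates the duration \<eta> of the rectangle, and r / \<kappa>
    gives more than the r/2 of room that its half-width requires.\<close>
  define t0 where "t0 = 1 + r / \<kappa>"
  have t0: "\<kappa> * (t - t0) = \<kappa> * (t - 1) - r" for t using kappa by (simp add: t0_def field_simps)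
  have "ennreal (ell\<^sup>2 / 16 * (d\<^sup>2 / 8 * ((\<eta> - 0) * ((z + r / 2) - (z - r / 2))))) \<le> second_moment t x"
    if x: "\<bar>x - z\<bar> \<le> \<kappa> * (t - t0)" for t x
  proof (rule second_moment_rectangle)
    have "0 \<le> \<kappa> * (t - t0)" using x by linarith
    then have "t0 \<le> t" using kappa by (simp add: zero_le_mult_iff)
    moreover have "1 \<le> t0" using r kappa by (simp add: t0_def)
    ultimately have t: "1 \<le> t" by simp
    then show "0 \<le> t" by simp
    show "0 \<le> d\<^sup>2 / 8" by simp
    show "0 \<le> \<eta>" "z - r / 2 \<le> z + r / 2" using \<eta> r by auto
    fix s y assume s: "0 \<le> s" "s \<le> \<eta>" "z - r / 2 \<le> y" "y \<le> z + r / 2"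
    have "\<kappa> * s \<le> \<kappa> * \<eta>" using s(2) kappa by (intro mult_left_mono) auto
    then have ks: "0 \<le> \<kappa> * s" "\<kappa> * s \<le> r / 4" using s(1) kappa \<eta>(3) by (simp, linarith)
    have "\<kappa> * (t - 1) \<le> \<kappa> * (t - s)" using s \<eta> kappa by (intro mult_left_mono) auto
    then have "\<bar>y - x\<bar> \<le> \<kappa> * (t - s)" using x s(3,4) r(1) unfolding t0 by linarith
    moreover have "\<bar>y - z - \<kappa> * s\<bar> < r" using ks s(3,4) r(1) by linarith
    ultimately show "(s, y) \<in> cone \<kappa> t x \<and> ennreal (d\<^sup>2 / 8) \<le> second_moment s y"
      using strip[of s y] s \<eta>(2) t by (auto simp: cone_def)
  qed
  moreover have "0 < ell\<^sup>2 / 16 * (d\<^sup>2 / 8 * ((\<eta> - 0) * ((z + r / 2) - (z - r / 2))))"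
    using sigma_lower(2) d \<eta> r by simp
  moreover have "0 \<le> t0" using r kappa by (simp add: t0_def)
  ultimately show ?thesis by blast
qed

text \<open>The lower bound doubles each time the apex of a forward light cone moves along the ray of
  speed \<open>\<alpha>\<close> by a fixed time \<open>\<tau>\<close>: between two consecutive apexes there is a diamond of area of
  order \<open>\<tau>^2\<close> in which the previous bound holds and which the backward cone sees.\<close>

lemma second_moment_growth:
  assumes base: "0 \<le> \<epsilon>" "0 \<le> t0" "\<And>t x. \<bar>x - z\<bar> \<le> \<kappa> * (t - t0) \<Longrightarrow> ennreal \<epsilon> \<le> second_moment t x"
    and \<alpha>: "0 < \<alpha>" "\<alpha> < \<kappa>"
  shows "\<exists>\<tau>>0. \<forall>n t x. \<bar>x - (z + real n * (\<alpha> * \<tau>))\<bar> \<le> \<kappa> * (t - (t0 + real n * \<tau>)) \<longrightarrow> ennreal (\<epsilon> * 2 ^ n) \<le> second_moment t x"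
proof -
  \<comment> \<open>The rectangle used below multiplies the bound by \<gamma> \<tau>^2 / (64
    \<kappa>). This is at least 2 because \<tau> is at least both 1 and 128 \<kappa> /
    \<gamma>.\<close>
  define \<gamma> where "\<gamma> = ell\<^sup>2 * (\<kappa> - \<alpha>)\<^sup>2"
  have \<gamma>: "0 < \<gamma>" using sigma_lower(2) \<alpha> by (simp add: \<gamma>_def)
  define \<tau> where "\<tau> = 1 + 128 * \<kappa> / \<gamma>"
  have \<tau>: "1 \<le> \<tau>" "128 * \<kappa> / \<gamma> \<le> \<tau>" using kappa \<gamma> by (auto simp: \<tau>_def)
  \<comment> \<open>A quarter of the slack between light and ray over one period. A rectangle with
    half-sides \<eta> / \<kappa> in time and \<eta> in space, centred midway between the two apexes,
    then just fits: its corners need \<alpha> \<tau> / 2 + \<eta> <= \<kappa> \<tau> / 2 - \<eta>,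
    which holds with equality.\<close>
  define \<eta> where "\<eta> = (\<kappa> - \<alpha>) * \<tau> / 4"
  have \<eta>: "0 < \<eta>" using \<alpha> \<tau> by (simp add: \<eta>_def)
  have \<eta>eq: "4 * \<eta> + \<alpha> * \<tau> = \<kappa> * \<tau>" 
  proof -
    have "4 * \<eta> = (\<kappa> - \<alpha>) * \<tau>" by (simp add: \<eta>_def)
    then show ?thesis by (simp only: left_diff_distrib diff_add_cancel)
  qed
  have area: "2 \<le> ell\<^sup>2 / 16 * ((2 * \<eta> / \<kappa>) * (2 * \<eta>))"
  proof -
    have "128 * \<kappa> \<le> \<gamma> * \<tau>" using \<tau>(2) \<gamma> by (simp add: field_simps)
    also have "\<dots> \<le> \<gamma> * (\<tau> * \<tau>)" using \<gamma> \<tau>(1) by (intro mult_left_mono) auto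
    finally show ?thesis using kappa by (simp add: \<eta>_def \<gamma>_def field_simps power2_eq_square)
  qed
  have "\<forall>t x. \<bar>x - (z + real n * (\<alpha> * \<tau>))\<bar> \<le> \<kappa> * (t - (t0 + real n * \<tau>)) \<longrightarrow> ennreal (\<epsilon> * 2 ^ n) \<le> second_moment t x" for n
  proof (induction n)
    case 0
    then show ?case using base(3) by simp
  next
    case (Suc n)
    show ?case
    proof (intro allI impI)
      fix t x assume x: "\<bar>x - (z + real (Suc n) * (\<alpha> * \<tau>))\<bar> \<le> \<kappa> * (t - (t0 + real (Suc n) * \<tau>))"
      define T where "T = t0 + real n * \<tau>"
      define X where "X = z + real n * (\<alpha> * \<tau>)"
      have T: "0 \<le> T" using base(2) \<tau> by (simp add: T_def)
      have x': "\<bar>x - (X + \<alpha> * \<tau>)\<bar> \<le> \<kappa> * (t - (T + \<tau>))" using x by (simp add: T_def X_def algebra_simps)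
      have t: "T + \<tau> \<le> t"
      proof -
        have "0 \<le> \<kappa> * (t - (T + \<tau>))" using x' by linarith
        then show ?thesis using kappa by (simp add: zero_le_mult_iff)
      qed
      define s1 s2 where "s1 = T + \<tau> / 2 - \<eta> / \<kappa>" and "s2 = T + \<tau> / 2 + \<eta> / \<kappa>"
      define y1 y2 where "y1 = X + \<alpha> * \<tau> / 2 - \<eta>" and "y2 = X + \<alpha> * \<tau> / 2 + \<eta>"
      have "ennreal (ell\<^sup>2 / 16 * (\<epsilon> * 2 ^ n * ((s2 - s1) * (y2 - y1)))) \<le> second_moment t x"
      proof (rule second_moment_rectangle)
        show "0 \<le> t" using t T \<tau> by simp
        show "0 \<le> \<epsilon> * 2 ^ n" using base(1) by simp
        show "s1 \<le> s2" "y1 \<le> y2" using \<eta> kappa by (auto simp: s1_def s2_def y1_def y2_def)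
        fix s y assume s: "s1 \<le> s" "s \<le> s2" and y: "y1 \<le> y" "y \<le> y2"
        have k\<eta>: "\<kappa> * (\<eta> / \<kappa>) = \<eta>" using kappa by simp
        have "\<kappa> * (T + \<tau> / 2 - \<eta> / \<kappa>) \<le> \<kappa> * s" "\<kappa> * s \<le> \<kappa> * (T + \<tau> / 2 + \<eta> / \<kappa>)"
          using s kappa unfolding s1_def s2_def by (auto intro!: mult_left_mono)
        then have ks: "\<kappa> * T + \<kappa> * \<tau> / 2 - \<eta> \<le> \<kappa> * s" "\<kappa> * s \<le> \<kappa> * T + \<kappa> * \<tau> / 2 + \<eta>"
          using k\<eta> by (simp_all add: distrib_left right_diff_distrib)
        have a\<tau>: "0 \<le> \<alpha> * \<tau>" using \<alpha> \<tau> by simp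
        have 1: "\<bar>y - X\<bar> \<le> \<kappa> * (s - T)"
          using y ks \<eta>eq a\<tau> \<eta> unfolding y1_def y2_def right_diff_distrib by linarith
        have x'': "\<bar>x - (X + \<alpha> * \<tau>)\<bar> \<le> \<kappa> * t - \<kappa> * T - \<kappa> * \<tau>" using x' by (simp add: algebra_simps)
        have 2: "\<bar>y - x\<bar> \<le> \<kappa> * (t - s)"
          using y ks \<eta>eq a\<tau> \<eta> x'' unfolding y1_def y2_def right_diff_distrib by linarith
        have "0 \<le> \<kappa> * (s - T)" "0 \<le> \<kappa> * (t - s)" using 1 2 by linarith+
        then have "T \<le> s" "s \<le> t" using kappa by (auto simp: zero_le_mult_iff)
        then show "(s, y) \<in> cone \<kappa> t x \<and> ennreal (\<epsilon> * 2 ^ n) \<le> second_moment s y"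
          using 1 2 T Suc.IH by (auto simp: cone_def T_def X_def)
      qed
      moreover have "ell\<^sup>2 / 16 * (\<epsilon> * 2 ^ n * ((s2 - s1) * (y2 - y1))) \<ge> \<epsilon> * 2 ^ Suc n"
      proof -
        have "\<epsilon> * 2 ^ n * 2 \<le> \<epsilon> * 2 ^ n * (ell\<^sup>2 / 16 * ((2 * \<eta> / \<kappa>) * (2 * \<eta>)))"
          using base(1) by (intro mult_left_mono area) simp
        moreover have "s2 - s1 = 2 * \<eta> / \<kappa>" "y2 - y1 = 2 * \<eta>" by (simp_all add: s1_def s2_def y1_def y2_def)
        ultimately show ?thesis by (simp add: mult_ac)
      qed
      ultimately show "ennreal (\<epsilon> * 2 ^ Suc n) \<le> second_moment t x"
        by (meson ennreal_leI order_trans)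
    qed
  qed
  then show ?thesis using \<tau>(1) by (intro exI[of _ \<tau>]) auto
qed

text \<open>Growth is used along a ray of speed \<open>\<alpha>'\<close> strictly between \<alpha>
  and \<kappa>. The excess speed eventually outweighs the offsets \<open>z\<close> and
  \<open>t0\<close>, so that \<bar>X n\<bar> is at least \<alpha> \<open>T n\<close>, whatever the
  sign of \<open>z\<close>.\<close>

lemma lower_index_ge:
  assumes u0: "\<And>x. 0 \<le> u0 x" "lower_semicont u0" and v0: "\<And>x. 0 \<le> v0 x" and z: "0 < u0 z" and \<nu>: "2 \<le> \<nu>"
  shows "ereal \<kappa> \<le> lower_index M u \<nu>"
proof -
  have pos: "0 < growth_rate M u \<nu> \<alpha>" if \<alpha>: "0 < \<alpha>" "\<alpha> < \<kappa>" for \<alpha>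
  proof -
    define \<alpha>' where "\<alpha>' = (\<alpha> + \<kappa>) / 2"
    have \<alpha>': "0 < \<alpha>'" "\<alpha>' < \<kappa>" "\<alpha> < \<alpha>'" using \<alpha> by (auto simp: \<alpha>'_def)
    obtain \<epsilon> t0 where \<epsilon>: "0 < \<epsilon>" "0 \<le> t0" "\<And>t x. \<bar>x - z\<bar> \<le> \<kappa> * (t - t0) \<Longrightarrow> ennreal \<epsilon> \<le> second_moment t x"
      using second_moment_base[OF u0 v0 z] by blast
    obtain \<tau> where \<tau>: "0 < \<tau>" "\<And>n t x. \<bar>x - (z + real n * (\<alpha>' * \<tau>))\<bar> \<le> \<kappa> * (t - (t0 + real n * \<tau>)) \<Longrightarrow> ennreal (\<epsilon> * 2 ^ n) \<le> second_moment t x"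
      using second_moment_growth[OF less_imp_le[OF \<epsilon>(1)] \<epsilon>(2,3) \<alpha>'(1,2)] by blast
    define T where "T = (\<lambda>n. t0 + real n * \<tau>)"
    define X where "X = (\<lambda>n. z + real n * (\<alpha>' * \<tau>))"
    \<comment> \<open>Doubling in each period \<tau> means the rate ln 2 / \<tau> for the second
      moment, and \<nu>/2 times that for the moment of order \<nu>; \<open>e\<close> absorbs the
      initial delay \<open>t0\<close>.\<close>
    define g where "g = \<nu> / 2 * (ln 2 / \<tau>)"
    define e where "e = \<epsilon> powr (\<nu> / 2) * exp (- g * t0)"
    show ?thesis
    proof (rule growth_rate_pos[where T = T and X = X and g = g and \<epsilon> = e])
      show "0 < e" using \<epsilon> by (simp add: e_def)
      show "0 < g" using \<nu> \<tau> by (simp add: g_def)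
      show "filterlim T at_top sequentially" unfolding T_def
        by (intro filterlim_tendsto_add_at_top[OF tendsto_const] filterlim_at_top_mult_tendsto_pos[OF tendsto_const \<tau>(1) filterlim_real_sequentially])
      show "\<forall>\<^sub>F n in sequentially. \<alpha> * T n \<le> \<bar>X n\<bar>"
      proof -
        have "0 < (\<alpha>' - \<alpha>) * \<tau>" using \<alpha>' \<tau> by simp
        then have "filterlim (\<lambda>n. real n * ((\<alpha>' - \<alpha>) * \<tau>)) at_top sequentially"
          by (intro filterlim_at_top_mult_tendsto_pos[OF tendsto_const _ filterlim_real_sequentially])
        then have "\<forall>\<^sub>F n in sequentially. \<alpha> * t0 - z \<le> real n * ((\<alpha>' - \<alpha>) * \<tau>)" unfolding filterlim_at_top by blast
        then show ?thesis
        proof eventually_elim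
          case (elim n)
          then have "\<alpha> * T n \<le> X n" by (simp add: T_def X_def algebra_simps)
          then show ?case by linarith
        qed
      qed
      show "ennreal (e * exp (g * T n)) \<le> moment M u \<nu> (T n) (X n)" for n
      proof -
        have Tn: "0 \<le> T n" using \<epsilon> \<tau> by (simp add: T_def)
        have "ennreal (\<epsilon> * 2 ^ n) \<le> second_moment (T n) (X n)" by (rule \<tau>(2)) (simp add: T_def X_def)
        then have "ennreal ((\<epsilon> * 2 ^ n) powr (\<nu> / 2)) \<le> moment M u \<nu> (T n) (X n)"
          unfolding moment_def using \<epsilon>(1) by (intro powr_moment_lower u_measurable Tn \<nu>) auto
        moreover have "(\<epsilon> * 2 ^ n) powr (\<nu> / 2) = e * exp (g * T n)"
        proof -
          have "(\<epsilon> * 2 ^ n) powr (\<nu> / 2) = \<epsilon> powr (\<nu> / 2) * (2 ^ n) powr (\<nu> / 2)" using \<epsilon> by (simp add: powr_mult)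
          also have "(2 ^ n :: real) powr (\<nu> / 2) = exp (\<nu> / 2 * (real n * ln 2))"
            by (simp add: powr_def ln_realpow)
          also have "\<nu> / 2 * (real n * ln 2) = g * (real n * \<tau>)" using \<tau>(1) by (simp add: g_def)
          finally show ?thesis by (simp add: e_def T_def distrib_left exp_add exp_minus)
        qed
        ultimately show ?thesis by simp
      qed
    qed
  qed
  show ?thesis
  proof (rule dense_le)
    fix c :: ereal assume c: "c < ereal \<kappa>"
    \<comment> \<open>The maximum with 0 is needed because only positive speeds enter the
      index.\<close>
    obtain \<alpha> where \<alpha>: "max 0 c < ereal \<alpha>" "ereal \<alpha> < ereal \<kappa>"
      using ereal_dense2[of "max 0 c" "ereal \<kappa>"] c kappa by auto
    then have "0 < \<alpha>" "\<alpha> < \<kappa>" by auto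
    then have "ereal \<alpha> \<le> lower_index M u \<nu>"
      unfolding lower_index_def using pos by (intro Sup_upper) auto
    then show "c \<le> lower_index M u \<nu>" using \<alpha>(1) by (meson less_imp_le max.strict_boundedE order_trans)
  qed
qed

text \<open>Beyond the speed \<alpha> = (\<beta> + 1) / c the exponent \<beta> t - c \<bar>x\<bar>
  of the moment bound is at most -t. Passing to the moment of order \<nu> scales this rate by \<nu>
  / (2k+2), which keeps its sign.\<close>

lemma upper_index_finite:
  assumes u0: "\<And>x. 0 \<le> u0 x" "u0 \<in> D_exp" and v0: "\<And>x. 0 \<le> v0 x" "v0 \<in> D_exp" and \<nu>: "2 \<le> \<nu>"
  shows "upper_index M u \<nu> < \<infinity>"
proof -
  obtain B1 \<rho>1 where B1: "0 < B1" "0 < \<rho>1" "\<And>x. u0 x \<le> B1 * exp (- \<rho>1 * \<bar>x\<bar>)" using D_exp_bound[OF u0(2)] by blast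
  obtain B2 \<rho>2 where B2: "0 < B2" "0 < \<rho>2" "\<And>x. v0 x \<le> B2 * exp (- \<rho>2 * \<bar>x\<bar>)" using D_exp_bound[OF v0(2)] by blast
  define B where "B = max B1 B2"
  define \<rho> where "\<rho> = min \<rho>1 \<rho>2"
  have B: "0 < B" "0 < \<rho>" using B1 B2 by (auto simp: B_def \<rho>_def)
  have le: "b * exp (- r * \<bar>x\<bar>) \<le> B * exp (- \<rho> * \<bar>x\<bar>)" if "0 < b" "b \<le> B" "\<rho> \<le> r" for b r x
    using that by (intro mult_mono) (auto intro!: mult_right_mono)
  obtain k where k: "\<nu> \<le> real k" using real_arch_simple by blast
  have k1: "1 \<le> k" using k \<nu> by linarith
  obtain D \<beta> c where D: "0 < D" "0 < \<beta>" "0 < c" and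
    bd: "\<And>t x. 0 \<le> t \<Longrightarrow> (\<integral>\<^sup>+ \<omega>. ennreal (u t x \<omega> ^ (2*k+2)) \<partial>M) \<le> ennreal (D * exp (\<beta> * t - c * \<bar>x\<bar>))"
    using exponential_moment_bound[OF k1 u0(1) D_exp_measurable[OF v0(2)] v0(1) B]
      order_trans[OF B1(3) le[OF B1(1)]] order_trans[OF B2(3) le[OF B2(1)]]
    by (auto simp: B_def \<rho>_def)
  define q where "q = \<nu> / real (2*k+2)"
  have q: "0 < q" using \<nu> by (simp add: q_def)
  define \<alpha> where "\<alpha> = (\<beta> + 1) / c"
  have \<alpha>: "0 < \<alpha>" "c * \<alpha> = \<beta> + 1" using D by (auto simp: \<alpha>_def)
  have "growth_rate M u \<nu> \<alpha> < 0"
  proof (rule growth_rate_neg[where D = "2 * D powr q" and g = q and ?t1.0 = 0])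
    show "0 < 2 * D powr q" "0 < q" using D q by auto
    fix t x assume t: "(0::real) \<le> t" and x: "\<alpha> * t \<le> \<bar>x\<bar>"
    have "moment M u \<nu> t x \<le> ennreal (2 * (D * exp (\<beta> * t - c * \<bar>x\<bar>)) powr q)"
      unfolding moment_def q_def using \<nu> k D by (intro powr_moment_upper u_measurable t bd) auto
    also have "\<dots> \<le> ennreal (2 * D powr q * exp (- q * t))"
    proof (rule ennreal_leI)
      have "c * (\<alpha> * t) \<le> c * \<bar>x\<bar>" using x D by (intro mult_left_mono) auto
      then have "\<beta> * t - c * \<bar>x\<bar> \<le> - t" using \<alpha>(2) by (simp add: mult.assoc[symmetric] distrib_right)
      then have "D * exp (\<beta> * t - c * \<bar>x\<bar>) \<le> D * exp (- t)" using D by simp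
      then have "(D * exp (\<beta> * t - c * \<bar>x\<bar>)) powr q \<le> (D * exp (- t)) powr q" using D q by (intro powr_mono2) auto
      also have "\<dots> = D powr q * exp (- q * t)" using D by (simp add: powr_mult) (simp add: powr_def)
      finally show "2 * (D * exp (\<beta> * t - c * \<bar>x\<bar>)) powr q \<le> 2 * D powr q * exp (- q * t)" by simp
    qed
    finally show "moment M u \<nu> t x \<le> ennreal (2 * D powr q * exp (- q * t))" .
  qed
  then have "upper_index M u \<nu> \<le> ereal \<alpha>"
    unfolding upper_index_def using \<alpha> by (intro Inf_lower) auto
  then show ?thesis by (rule order_le_less_trans) simp
qed

lemma upper_index_compact:
  assumes R0: "\<And>x. R0 < \<bar>x\<bar> \<Longrightarrow> u0 x = 0" "\<And>x. R0 < \<bar>x\<bar> \<Longrightarrow> v0 x = 0" and \<nu>: "2 \<le> \<nu>"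
  shows "upper_index M u \<nu> \<le> ereal \<kappa>"
proof (rule dense_ge)
  fix c :: ereal assume c: "ereal \<kappa> < c"
  obtain \<alpha> where \<alpha>: "ereal \<kappa> < ereal \<alpha>" "ereal \<alpha> < c" using ereal_dense2[OF c] by auto
  then have \<alpha>\<kappa>: "\<kappa> < \<alpha>" by simp
  have "growth_rate M u \<nu> \<alpha> < 0"
  \<comment> \<open>From this time on, every x with \<bar>x\<bar> at least \<alpha> t is outside the
    cone of the support. The moments there are zero, so the constant and the rate are
    arbitrary.\<close>
  proof (rule growth_rate_neg[where D = 1 and g = 1 and ?t1.0 = "(\<bar>R0\<bar> + 1) / (\<alpha> - \<kappa>)"])
    fix t x :: real assume t: "(\<bar>R0\<bar> + 1) / (\<alpha> - \<kappa>) \<le> t" "0 < t" and x: "\<alpha> * t \<le> \<bar>x\<bar>"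
    have "\<bar>R0\<bar> + 1 \<le> (\<alpha> - \<kappa>) * t" using t(1) \<alpha>\<kappa> by (simp add: field_simps)
    then have "R0 + \<kappa> * t < \<bar>x\<bar>" using x by (simp add: left_diff_distrib)
    then have "AE \<omega> in M. u t x \<omega> = 0" using t(2) by (intro vanishes_outside_cone[OF R0]) auto
    then have "AE \<omega> in M. ennreal (\<bar>u t x \<omega>\<bar> powr \<nu>) = 0" by eventually_elim simp
    then have "moment M u \<nu> t x = (\<integral>\<^sup>+ \<omega>. 0 \<partial>M)"
      unfolding moment_def by (rule nn_integral_cong_AE)
    then show "moment M u \<nu> t x \<le> ennreal (1 * exp (- 1 * t))" by simp
  qed auto
  then have "upper_index M u \<nu> \<le> ereal \<alpha>"
    unfolding upper_index_def using \<alpha>\<kappa> kappa by (intro Inf_lower) auto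
  then show "upper_index M u \<nu> \<le> c" using \<alpha>(2) by simp
qed

end

lemma support_bounded:
  fixes h :: "real \<Rightarrow> real"
  assumes "compact (closure {x. h x \<noteq> 0})" shows "\<exists>R. \<forall>x. R < \<bar>x\<bar> \<longrightarrow> h x = 0"
proof -
  have "bounded {x. h x \<noteq> 0}" using compact_imp_bounded[OF assms] closure_subset bounded_subset by blast
  then obtain R where "\<And>x. h x \<noteq> 0 \<Longrightarrow> \<bar>x\<bar> \<le> R" unfolding bounded_iff by auto
  then show ?thesis by (meson not_le)
qed

theorem theorem5p1:
  fixes M :: "'a measure" and F :: "real \<Rightarrow> 'a measure"
    and W u :: "real \<Rightarrow> real \<Rightarrow> 'a \<Rightarrow> real"
    and \<kappa> :: real and \<sigma> u0 v0 :: "real \<Rightarrow> real"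
  assumes "\<kappa> > 0"
    and "\<exists>L. L-lipschitz_on UNIV \<sigma>"
    and "\<sigma> 0 = 0"
    and "(INF x\<in>{x. x \<noteq> 0}. \<bar>\<sigma> x / x\<bar>) > 0"
    and "\<forall>x. 0 \<le> u0 x" and "bounded (range u0)" and "bounded (range v0)"
    and "brownian_sheet M F W"
    and "mild_solution M F W \<kappa> \<sigma> u0 v0 u"
    and "u0 \<in> D_exp" and "v0 \<in> D_exp"
    and "emeasure lebesgue {x. u0 x > 0} > 0"
    and "\<forall>x. 0 \<le> v0 x"
  shows "(\<forall>\<nu>\<ge>2. 0 < lower_index M u \<nu> \<and> lower_index M u \<nu> \<le> upper_index M u \<nu>
                  \<and> upper_index M u \<nu> < \<infinity>)
       \<and> (compact (closure {x. u0 x \<noteq> 0}) \<and> compact (closure {x. v0 x \<noteq> 0}) \<longrightarrow>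
            (\<forall>\<nu>\<ge>2. lower_index M u \<nu> = ereal \<kappa> \<and> upper_index M u \<nu> = ereal \<kappa>))"
proof -
  obtain L where L: "L-lipschitz_on UNIV \<sigma>" using assms(2) by blast
  define ell where "ell = (INF x\<in>{x. x \<noteq> 0}. \<bar>\<sigma> x / x\<bar>)"
  have lower: "ell * \<bar>x\<bar> \<le> \<bar>\<sigma> x\<bar>" for x
  proof (cases "x = 0")
    case False
    then have "ell \<le> \<bar>\<sigma> x / x\<bar>" unfolding ell_def by (intro cINF_lower bdd_belowI[of _ 0]) auto
    then have "ell * \<bar>x\<bar> \<le> \<bar>\<sigma> x / x\<bar> * \<bar>x\<bar>" by (intro mult_right_mono) auto
    then show ?thesis using False by (simp add: abs_divide)
  qed simp
  have upper: "\<bar>\<sigma> x\<bar> \<le> max 1 L * \<bar>x\<bar>" for x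
  proof -
    have "\<bar>\<sigma> x\<bar> \<le> L * \<bar>x\<bar>" using lipschitz_onD[OF L, of x 0] assms(3) by (simp add: dist_real_def)
    also have "\<dots> \<le> max 1 L * \<bar>x\<bar>" by (intro mult_right_mono) auto
    finally show ?thesis .
  qed
  interpret wave_equation M F W \<kappa> \<sigma> u0 v0 u "max 1 L" ell
    using assms(1,4,8,9) lower upper lipschitz_on_continuous_on[OF L]
    by unfold_locales (auto simp: ell_def)
  have u0: "0 \<le> u0 x" and v0: "0 \<le> v0 x" for x using assms(5,13) by auto
  have lsc: "lower_semicont u0" using assms(10) by (simp add: D_exp_def)
  \<comment> \<open>Positive measure supplies a point; lower semicontinuity turns it back into a
    ball in \<open>second_moment_base\<close>.\<close>
  have "{x. u0 x > 0} \<noteq> {}" using assms(12) by (metis emeasure_empty less_irrefl)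
  then obtain z where z: "0 < u0 z" by auto
  have low: "ereal \<kappa> \<le> lower_index M u \<nu>" if "2 \<le> \<nu>" for \<nu> by (rule lower_index_ge[OF u0 lsc v0 z that])
  have "0 < lower_index M u \<nu>" if "2 \<le> \<nu>" for \<nu>
    using low[OF that] assms(1) by (meson ereal_less(2) order_less_le_trans)
  moreover have "upper_index M u \<nu> < \<infinity>" if "2 \<le> \<nu>" for \<nu>
    by (rule upper_index_finite[OF u0 assms(10) v0 assms(11) that])
  moreover have "lower_index M u \<nu> = ereal \<kappa> \<and> upper_index M u \<nu> = ereal \<kappa>"
    if c: "compact (closure {x. u0 x \<noteq> 0})" "compact (closure {x. v0 x \<noteq> 0})" and \<nu>: "2 \<le> \<nu>" for \<nu>
  proof -
    obtain R1 R2 where "\<And>x. R1 < \<bar>x\<bar> \<Longrightarrow> u0 x = 0" "\<And>x. R2 < \<bar>x\<bar> \<Longrightarrow> v0 x = 0"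
      using support_bounded[OF c(1)] support_bounded[OF c(2)] by blast
    then have "upper_index M u \<nu> \<le> ereal \<kappa>" by (intro upper_index_compact[where ?R0.0 = "max R1 R2"] \<nu>) auto
    then show ?thesis using low[OF \<nu>] lower_index_le_upper_index[of M u \<nu>] by (auto intro: antisym order_trans)
  qed
  ultimately show ?thesis using lower_index_le_upper_index by blast
qed

end
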